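(* Let $k$ be a field and let $\Delta$ be a simplicial complex on the vertex set $[n]=\{1,\dots,n\}$. Let $A=k[\Delta]$ be its Stanley--Reisner ring, of Krull dimension $d\ge 2$, and put $c=\operatorname{codim} A=n-d$. If $e(A)\ge \binom{n}{c}-c$, then $A$ is Cohen--Macaulay.
   Context: A simplicial complex $\Delta$ on $[n]$ is a family of subsets of $[n]$ (faces) closed under taking subsets, with $\{i\}\in\Delta$ for all $i\in[n]$. The Stanley--Reisner ring is $k[\Delta]=S/I_\Delta$, where $S=k[X_1,\dots,X_n]$ with $\deg X_i=1$ and $I_\Delta$ is generated by all squarefree monomials $X_{i_1}\cdots X_{i_p}$ with $\{i_1,\dots,i_p\}\notin\Delta$. The dimension of a face $F$ is $|F|-1$, facets are maximal faces, and $\dim k[\Delta]=\dim\Delta+1=d$. The multiplicity $e(A)$ equals the number of facets $F$ of $\Delta$ with $\dim F=d-1$. *)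

theory Defs
  imports
    "HOL-Algebra.Algebra"
    "HOL-Library.Poly_Mapping"
    "HOL-Library.Extended_Nat"
    "HOL-Computational_Algebra.Polynomial"
begin

section \<open>Commutative algebra\<close>

definition prime_chain :: "('a, 'b) ring_scheme \<Rightarrow> nat \<Rightarrow> (nat \<Rightarrow> 'a set) \<Rightarrow> bool" where
  "prime_chain R r P \<longleftrightarrow> (\<forall>i\<le>r. primeideal (P i) R) \<and> (\<forall>i<r. P i \<subset> P (Suc i))"

text \<open>Suprema are taken in \<^typ>\<open>enat\<close>; only the zero ring, which has no primes, gets the
  unconventional Krull dimension \<open>0\<close>.\<close>

definition krull_dim :: "('a, 'b) ring_scheme \<Rightarrow> enat" where
  "krull_dim R = Sup {enat r | r. \<exists>P. prime_chain R r P}"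

text \<open>For a prime \<open>p\<close>, this is the Krull dimension of the localization \<open>R\<^sub>p\<close>.\<close>

definition height :: "('a, 'b) ring_scheme \<Rightarrow> 'a set \<Rightarrow> enat" where
  "height R p = Sup {enat r | r. \<exists>P. prime_chain R r P \<and> P r = p}"

definition regular_sequence :: "('a, 'b) ring_scheme \<Rightarrow> 'a list \<Rightarrow> bool" where
  "regular_sequence R xs \<longleftrightarrow>
     set xs \<subseteq> carrier R \<and>
     (\<forall>i<length xs. \<forall>a\<in>carrier R.
        xs ! i \<otimes>\<^bsub>R\<^esub> a \<in> genideal R (set (take i xs)) \<longrightarrow> a \<in> genideal R (set (take i xs))) \<and>
     genideal R (set xs) \<noteq> carrier R"

definition depth :: "('a, 'b) ring_scheme \<Rightarrow> 'a set \<Rightarrow> enat" where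
  "depth R I = Sup {enat (length xs) | xs. regular_sequence R xs \<and> set xs \<subseteq> I}"

text \<open>The definition for arbitrary Noetherian rings, as in Eisenbud, \<^emph>\<open>Commutative Algebra\<close>,
  Section 18.2, and Kaplansky, \<^emph>\<open>Commutative Rings\<close>, Section 3-1: depth and height
  agree at every maximal ideal, homogeneous or not.\<close>

definition cohen_macaulay :: "('a, 'b) ring_scheme \<Rightarrow> bool" where
  "cohen_macaulay R \<longleftrightarrow>
     cring R \<and> noetherian_ring R \<and> (\<forall>m. maximalideal m R \<longrightarrow> depth R m = height R m)"

text \<open>Here \<open>K\<close> is a subfield of \<open>R\<close> and \<open>G j\<close> is the component of degree \<open>j\<close> of a grading of the
  \<open>K\<close>-algebra \<open>R\<close>; \<^const>\<open>ring.dim\<close> is vector space dimension.\<close>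

definition hilbert_function ::
    "('a, 'b) ring_scheme \<Rightarrow> 'a set \<Rightarrow> (nat \<Rightarrow> 'a set) \<Rightarrow> nat \<Rightarrow> nat" where
  "hilbert_function R K G j = ring.dim R K (G j)"

definition hilbert_polynomial ::
    "('a, 'b) ring_scheme \<Rightarrow> 'a set \<Rightarrow> (nat \<Rightarrow> 'a set) \<Rightarrow> rat Polynomial.poly" where
  "hilbert_polynomial R K G =
     (THE p. \<forall>\<^sub>F j in sequentially. of_nat (hilbert_function R K G j) = Polynomial.poly p (of_nat j))"

text \<open>For a standard graded algebra of dimension \<open>d \<ge> 1\<close>, the leading term of the Hilbert polynomial
  is \<open>e / (d - 1)! * X ^ (d - 1)\<close>; in dimension \<open>0\<close> the multiplicity is the length.\<close>

definition multiplicity_graded :: "('a, 'b) ring_scheme \<Rightarrow> 'a set \<Rightarrow> (nat \<Rightarrow> 'a set) \<Rightarrow> rat" where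
  "multiplicity_graded R K G =
     (let d = the_enat (krull_dim R) in
      if d = 0 then of_nat (ring.dim R K (carrier R))
      else fact (d - 1) * Polynomial.coeff (hilbert_polynomial R K G) (d - 1))"


section \<open>Polynomial rings in finitely many variables\<close>

text \<open>A monomial is its exponent vector, and a polynomial maps monomials to coefficients.\<close>

type_synonym 'k mpoly = "(nat \<Rightarrow>\<^sub>0 nat) \<Rightarrow>\<^sub>0 'k"

definition mpoly_ring :: "nat \<Rightarrow> 'k::field mpoly ring" where
  "mpoly_ring n =
     \<lparr>carrier = {f. \<forall>m\<in>Poly_Mapping.keys f. Poly_Mapping.keys m \<subseteq> {1..n}},
      monoid.mult = (*), one = 1, ring.zero = 0, ring.add = (+)\<rparr>"

definition Const :: "'k::field \<Rightarrow> 'k mpoly" where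
  "Const a = Poly_Mapping.single 0 a"

definition Var :: "nat \<Rightarrow> 'k::field mpoly" where
  "Var i = Poly_Mapping.single (Poly_Mapping.single i 1) 1"

definition total_degree :: "(nat \<Rightarrow>\<^sub>0 nat) \<Rightarrow> nat" where
  "total_degree m = (\<Sum>i\<in>Poly_Mapping.keys m. Poly_Mapping.lookup m i)"

definition homogeneous :: "nat \<Rightarrow> 'k::field mpoly \<Rightarrow> bool" where
  "homogeneous j f \<longleftrightarrow> (\<forall>m\<in>Poly_Mapping.keys f. total_degree m = j)"


section \<open>Stanley--Reisner rings\<close>

definition simplicial_complex :: "nat \<Rightarrow> nat set set \<Rightarrow> bool" where
  "simplicial_complex n \<Delta> \<longleftrightarrow>
     \<Delta> \<subseteq> Pow {1..n} \<and> (\<forall>F\<in>\<Delta>. \<forall>G. G \<subseteq> F \<longrightarrow> G \<in> \<Delta>) \<and> (\<forall>i\<in>{1..n}. {i} \<in> \<Delta>)"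

definition stanley_reisner_ideal :: "nat \<Rightarrow> nat set set \<Rightarrow> 'k::field mpoly set" where
  "stanley_reisner_ideal n \<Delta> =
     genideal (mpoly_ring n) {\<Prod>i\<in>F. Var i | F. F \<subseteq> {1..n} \<and> F \<notin> \<Delta>}"

definition stanley_reisner_ring :: "nat \<Rightarrow> nat set set \<Rightarrow> 'k::field mpoly set ring" where
  "stanley_reisner_ring n \<Delta> = mpoly_ring n Quot stanley_reisner_ideal n \<Delta>"

definition sr_residue :: "nat \<Rightarrow> nat set set \<Rightarrow> 'k::field mpoly \<Rightarrow> 'k mpoly set" where
  "sr_residue n \<Delta> f = stanley_reisner_ideal n \<Delta> +>\<^bsub>mpoly_ring n\<^esub> f"

definition sr_scalars :: "nat \<Rightarrow> nat set set \<Rightarrow> 'k::field mpoly set set" where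
  "sr_scalars n \<Delta> = range (\<lambda>a. sr_residue n \<Delta> (Const a))"

definition sr_component :: "nat \<Rightarrow> nat set set \<Rightarrow> nat \<Rightarrow> 'k::field mpoly set set" where
  "sr_component n \<Delta> j =
     {sr_residue n \<Delta> f | f. f \<in> carrier (mpoly_ring n) \<and> homogeneous j f}"

end

theory Submission
  imports Defs
begin

text \<open>Let \<open>M\<close> be the set of \<open>d\<close>-subsets of \<open>[n]\<close> that are not faces. Comparing the leading coefficients of
  the Hilbert polynomial, the hypothesis says \<open>|M| \<le> n - d\<close>. A \<open>(d - 1)\<close>-subset lies in \<open>n - d + 1\<close>
  sets of size \<open>d\<close>, so it is a face: \<open>\<Delta>\<close> is the full \<open>(d - 1)\<close>-skeleton of a simplex with at most
  \<open>n - d\<close> facets removed. Such complexes are vertex decomposable: choose a vertex \<open>v\<close> in a missing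
  facet; its link and its deletion satisfy the same inequality on one vertex fewer.

  The Stanley--Reisner ring of a vertex decomposable complex is Cohen--Macaulay also at
  non-homogeneous maximal ideals \<open>m\<close>, over any field. By the Nullstellensatz \<open>m\<close> contains
  \<open>y\<^sub>v = x\<^sub>v g\<^sub>v(x\<^sub>v)\<close> with \<open>g\<^sub>v\<close> nonzero, for each vertex \<open>v\<close>. The elementary symmetric functions of
  the \<open>y\<^sub>v\<close>, in the order of degrees \<open>d, ..., 1\<close>, form a regular sequence: this passes from
  \<open>I : x\<^sub>v\<close> and \<open>I + (x\<^sub>v)\<close> to \<open>I\<close>, so it is enough to treat a simplex on \<open>d\<close> vertices. There the
  first function is the product of the \<open>y\<^sub>v\<close>, and modulo one \<open>y\<^sub>v\<close> the others are the elementary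
  symmetric functions of the remaining ones. Hence the depth at \<open>m\<close> is at least \<open>d\<close>, while the height
  is at most the Krull dimension \<open>d\<close>.\<close>

section \<open>Ideals, primes and regular sequences in a commutative ring type\<close>

text \<open>A homogeneous system of parameters need not lie in a given maximal ideal
  \<open>m\<close>, and over a finite field a linear one may not exist. The factor
  \<open>g\<^sub>v\<close> puts \<open>y\<^sub>v\<close> into \<open>m\<close>; the factor
  \<open>x\<^sub>v\<close> makes \<open>y\<^sub>v\<close> vanish on every simplex without
  \<open>v\<close>. Symmetric functions let one sequence serve all faces at once: on a facet they
  restrict to the symmetric functions of its own vertices. The bound \<open>n - d\<close> is what
  the induction preserves. It reads \<open>e + |M| \<le> |V|\<close>, where \<open>V\<close> holds
  the vertices not yet coned over and \<open>e\<close> is the size of the missing sets in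
  \<open>V\<close>. The star of \<open>v\<close> lowers \<open>e\<close> and \<open>|V|\<close> by
  one; deleting \<open>v\<close> lowers \<open>|V|\<close> by one and \<open>|M|\<close> by at least
  one, as \<open>v\<close> lies in a missing set. The dimension bounds are elementary. Depth is at
  most height because a nonzerodivisor modulo an ideal avoids some prime over it below any given
  one. The Krull dimension is at most \<open>d\<close> because a chain of primes with
  \<open>d + 1\<close> steps gives \<open>d + 1\<close> algebraically independent elements, whose
  power products outnumber the monomials on faces, so that counting forces a linear
  relation.\<close>

definition subring_on :: "'a::comm_ring_1 set \<Rightarrow> bool" where
  "subring_on R \<longleftrightarrow> 0 \<in> R \<and> 1 \<in> R \<and> (\<forall>x\<in>R. - x \<in> R) \<and> (\<forall>x\<in>R. \<forall>y\<in>R. x + y \<in> R \<and> x * y \<in> R)"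

text \<open>Ideals are relative to a subring because the polynomial type has infinitely many
  variables and so is not Noetherian; finiteness is proved for subrings and transferred to
  quotients.\<close>

definition ideal_on :: "'a::comm_ring_1 set \<Rightarrow> 'a set \<Rightarrow> bool" where
  "ideal_on R I \<longleftrightarrow> I \<subseteq> R \<and> 0 \<in> I \<and> (\<forall>x\<in>I. \<forall>y\<in>I. x + y \<in> I) \<and> (\<forall>r\<in>R. \<forall>x\<in>I. r * x \<in> I)"

abbreviation is_ideal :: "'a::comm_ring_1 set \<Rightarrow> bool" where
  "is_ideal \<equiv> ideal_on UNIV"

definition is_prime :: "'a::comm_ring_1 set \<Rightarrow> bool" where
  "is_prime P \<longleftrightarrow> is_ideal P \<and> 1 \<notin> P \<and> (\<forall>x y. x * y \<in> P \<longrightarrow> x \<in> P \<or> y \<in> P)"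

definition ideal_plus :: "'a::comm_ring_1 set \<Rightarrow> 'a \<Rightarrow> 'a set" where
  "ideal_plus I y = {a + y * b | a b. a \<in> I}"

definition nzd :: "'a::comm_ring_1 set \<Rightarrow> 'a \<Rightarrow> bool" where
  "nzd I y \<longleftrightarrow> (\<forall>a. y * a \<in> I \<longrightarrow> a \<in> I)"

text \<open>Regularity on S/I, except that the ideal generated by I and the sequence may be the unit
  ideal. Properness is checked once at the end, since intermediate ideals in the inductions may be
  improper.\<close>

fun weakly_regular :: "'a::comm_ring_1 set \<Rightarrow> 'a list \<Rightarrow> bool" where
  "weakly_regular I [] \<longleftrightarrow> True"
| "weakly_regular I (y # ys) \<longleftrightarrow> nzd I y \<and> weakly_regular (ideal_plus I y) ys"

abbreviation ideal_plus_list :: "'a::comm_ring_1 set \<Rightarrow> 'a list \<Rightarrow> 'a set" where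
  "ideal_plus_list \<equiv> foldl ideal_plus"

lemma subring_onD:
  assumes "subring_on R"
  shows "0 \<in> R" "1 \<in> R" "x \<in> R \<Longrightarrow> - x \<in> R"
    "x \<in> R \<Longrightarrow> y \<in> R \<Longrightarrow> x + y \<in> R" "x \<in> R \<Longrightarrow> y \<in> R \<Longrightarrow> x * y \<in> R"
    "x \<in> R \<Longrightarrow> y \<in> R \<Longrightarrow> x - y \<in> R"
  using assms unfolding subring_on_def by (auto simp: diff_conv_add_uminus simp del: add_uminus_conv_diff)

lemma subring_on_power: "subring_on R \<Longrightarrow> x \<in> R \<Longrightarrow> x ^ n \<in> R"
  by (induction n) (auto simp: subring_onD)

lemma subring_on_sum: "subring_on R \<Longrightarrow> (\<And>i. i \<in> A \<Longrightarrow> f i \<in> R) \<Longrightarrow> sum f A \<in> R"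
  by (induction A rule: infinite_finite_induct) (auto simp: subring_onD)

lemma ideal_onD:
  assumes "ideal_on R I"
  shows "I \<subseteq> R" "0 \<in> I" "x \<in> I \<Longrightarrow> y \<in> I \<Longrightarrow> x + y \<in> I" "r \<in> R \<Longrightarrow> x \<in> I \<Longrightarrow> r * x \<in> I"
  using assms unfolding ideal_on_def by auto

lemma ideal_on_diff:
  assumes "ideal_on R I" "subring_on R" "x \<in> I" "y \<in> I"
  shows "x - y \<in> I"
proof -
  have "(- 1) * y \<in> I"
    using assms by (intro ideal_onD(4)[OF assms(1)]) (auto simp: subring_onD)
  from ideal_onD(3)[OF assms(1) assms(3) this] show ?thesis by simp
qed

lemma subring_on_UNIV [simp]: "subring_on UNIV"
  by (simp add: subring_on_def)

lemma is_idealD: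
  assumes "is_ideal I"
  shows "0 \<in> I" "x \<in> I \<Longrightarrow> y \<in> I \<Longrightarrow> x + y \<in> I" "x \<in> I \<Longrightarrow> r * x \<in> I" "x \<in> I \<Longrightarrow> x * r \<in> I"
    "x \<in> I \<Longrightarrow> y \<in> I \<Longrightarrow> x - y \<in> I" "x \<in> I \<Longrightarrow> - x \<in> I"
  using assms ideal_on_diff[OF assms, of x y] ideal_on_diff[OF assms, of 0 x]
  by (auto simp: ideal_on_def mult.commute[of x])

lemma is_ideal_sum: "is_ideal I \<Longrightarrow> (\<And>i. i \<in> A \<Longrightarrow> f i \<in> I) \<Longrightarrow> sum f A \<in> I"
  by (induction A rule: infinite_finite_induct) (auto simp: is_idealD)

lemma is_ideal_add_left: "is_ideal I \<Longrightarrow> y \<in> I \<Longrightarrow> x + y \<in> I \<longleftrightarrow> x \<in> I"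
  using is_idealD(2,5)[of I] by (metis add_diff_cancel_right')

lemma is_ideal_cong: "is_ideal I \<Longrightarrow> x - y \<in> I \<Longrightarrow> x \<in> I \<longleftrightarrow> y \<in> I"
  using is_idealD(2,5)[of I] by (metis diff_add_cancel add_diff_cancel_left')

lemma is_ideal_cong_mult:
  assumes "is_ideal I" "x - y \<in> I" "x' - y' \<in> I"
  shows "x * x' - y * y' \<in> I"
proof -
  have "x * x' - y * y' = x' * (x - y) + y * (x' - y')"
    by (simp add: algebra_simps)
  then show ?thesis using assms by (auto simp: is_idealD)
qed

lemma is_ideal_cong_power:
  assumes "is_ideal I" "x - y \<in> I"
  shows "x ^ n - y ^ n \<in> I"
proof (induction n)
  case 0
  then show ?case using assms by (simp add: is_idealD)
next
  case (Suc n)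
  then show ?case using is_ideal_cong_mult[OF assms(1,2) Suc] by simp
qed

lemma is_primeD:
  assumes "is_prime P"
  shows "is_ideal P" "1 \<notin> P" "x * y \<in> P \<Longrightarrow> x \<in> P \<or> y \<in> P"
  using assms unfolding is_prime_def by auto

lemma is_prime_power: "is_prime P \<Longrightarrow> x ^ n \<in> P \<Longrightarrow> x \<in> P"
  by (induction n) (auto dest: is_primeD)

lemma is_ideal_ideal_plus:
  assumes "is_ideal I"
  shows "is_ideal (ideal_plus I y)"
  unfolding ideal_on_def
proof (intro conjI ballI subset_UNIV)
  show "0 \<in> ideal_plus I y"
    using is_idealD(1)[OF assms] unfolding ideal_plus_def
    by (auto intro!: exI[of _ 0])
next
  fix u v assume "u \<in> ideal_plus I y" "v \<in> ideal_plus I y"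
  then obtain a b a' b' where "u = a + y * b" "v = a' + y * b'" "a \<in> I" "a' \<in> I"
    by (auto simp: ideal_plus_def)
  then have "u + v = (a + a') + y * (b + b')" "a + a' \<in> I"
    using assms by (auto simp: is_idealD algebra_simps)
  then show "u + v \<in> ideal_plus I y"
    unfolding ideal_plus_def by blast
next
  fix r v assume "v \<in> ideal_plus I y"
  then obtain a b where "v = a + y * b" "a \<in> I"
    by (auto simp: ideal_plus_def)
  then have "r * v = r * a + y * (r * b)" "r * a \<in> I"
    using assms by (auto simp: is_idealD algebra_simps)
  then show "r * v \<in> ideal_plus I y"
    unfolding ideal_plus_def by blast
qed

lemma ideal_plus_superset: "I \<subseteq> ideal_plus I y"
  unfolding ideal_plus_def by (force intro: exI[of _ 0])

lemma ideal_plus_self: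
  assumes "is_ideal I"
  shows "y \<in> ideal_plus I y"
proof -
  have "y = 0 + y * 1" by simp
  then show ?thesis
    unfolding ideal_plus_def using is_idealD(1)[OF assms] by blast
qed

lemma ideal_plus_least: "is_ideal L \<Longrightarrow> I \<subseteq> L \<Longrightarrow> y \<in> L \<Longrightarrow> ideal_plus I y \<subseteq> L"
  unfolding ideal_plus_def by (auto simp: is_idealD subset_iff)

lemma ideal_plus_mono: "I \<subseteq> L \<Longrightarrow> ideal_plus I y \<subseteq> ideal_plus L y"
  unfolding ideal_plus_def by blast

lemma ideal_plus_commute: "ideal_plus (ideal_plus I x) y = ideal_plus (ideal_plus I y) x"
  unfolding ideal_plus_def
  by (auto; metis (no_types, opaque_lifting) add.commute add.left_commute)

lemma is_ideal_ideal_plus_list: "is_ideal I \<Longrightarrow> is_ideal (ideal_plus_list I ys)"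
  by (induction ys arbitrary: I) (auto simp: is_ideal_ideal_plus)

lemma ideal_plus_list_superset: "I \<subseteq> ideal_plus_list I ys"
proof (induction ys arbitrary: I)
  case (Cons y ys)
  then show ?case using ideal_plus_superset[of I y] by (auto intro: order_trans)
qed auto

lemma ideal_plus_list_self: "is_ideal I \<Longrightarrow> set ys \<subseteq> ideal_plus_list I ys"
proof (induction ys arbitrary: I)
  case (Cons y ys)
  then show ?case
    using ideal_plus_self[of I y] ideal_plus_list_superset[of "ideal_plus I y" ys] is_ideal_ideal_plus[of I y]
    by auto
qed auto

lemma ideal_plus_list_least:
  "is_ideal L \<Longrightarrow> I \<subseteq> L \<Longrightarrow> set ys \<subseteq> L \<Longrightarrow> ideal_plus_list I ys \<subseteq> L"
  by (induction ys arbitrary: I) (auto simp: ideal_plus_least)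

lemma weakly_regular_iff_nth:
  "weakly_regular I ys \<longleftrightarrow> (\<forall>i<length ys. nzd (ideal_plus_list I (take i ys)) (ys ! i))"
proof (induction ys arbitrary: I)
  case (Cons y ys)
  show ?case
    by (simp add: Cons.IH) (auto simp: less_Suc_eq_0_disj)
qed auto

section \<open>Quotients of a commutative ring type\<close>

text \<open>A ring with explicit carrier, presented as the image of a type-class ring. Its ideals
  correspond to the ideals of the type that contain the kernel, so quotient modules never have to be
  formed.\<close>

locale ring_quotient = cring R for R :: "('b, 'c) ring_scheme" (structure) +
  fixes \<pi> :: "'a::comm_ring_1 \<Rightarrow> 'b"
  assumes surj: "range \<pi> = carrier R"
    and hom_add: "\<pi> (x + y) = \<pi> x \<oplus> \<pi> y"
    and hom_mult: "\<pi> (x * y) = \<pi> x \<otimes> \<pi> y"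
    and hom_one: "\<pi> 1 = \<one>"
begin

lemma hom_closed [simp]: "\<pi> x \<in> carrier R"
  using surj by auto

lemma carrierE:
  assumes "a \<in> carrier R"
  obtains x where "a = \<pi> x"
  using assms surj by auto

lemma hom_zero: "\<pi> 0 = \<zero>"
proof -
  have "\<pi> 0 \<oplus> \<pi> 0 = \<pi> 0" using hom_add[of 0 0] by simp
  then show ?thesis by (metis hom_closed r_zero add.l_cancel zero_closed)
qed

lemma hom_diff: "\<pi> (x - y) = \<pi> x \<ominus> \<pi> y"
proof -
  have "\<pi> (x - y) \<oplus> \<pi> y = \<pi> x" using hom_add[of "x - y" y] by simp
  then show ?thesis
    by (metis hom_closed add.inv_solve_right minus_eq)
qed

definition ker :: "'a set" where
  "ker = {x. \<pi> x = \<zero>}"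

lemma hom_eq_iff: "\<pi> x = \<pi> y \<longleftrightarrow> x - y \<in> ker"
  unfolding ker_def by (simp add: hom_diff)

lemma is_ideal_vimage: "ideal I R \<Longrightarrow> is_ideal (\<pi> -` I)"
  unfolding ideal_on_def
  by (auto simp: hom_zero hom_add hom_mult additive_subgroup.zero_closed ideal.axioms(1)
      additive_subgroup.a_closed ideal.I_l_closed)

lemma ker_subset_vimage: "ideal I R \<Longrightarrow> ker \<subseteq> \<pi> -` I"
  by (auto simp: ker_def additive_subgroup.zero_closed ideal.axioms(1))

lemma is_ideal_ker: "is_ideal ker"
  using is_ideal_vimage[OF zeroideal] by (simp add: ker_def vimage_def)

lemma ideal_image:
  assumes "is_ideal I"
  shows "ideal (\<pi> ` I) R"
proof (rule idealI)
  show "ring R" by (rule ring_axioms)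
  show "subgroup (\<pi> ` I) (add_monoid R)"
  proof (rule add.subgroupI)
    show "\<pi> ` I \<subseteq> carrier R" by auto
    show "\<pi> ` I \<noteq> {}" using is_idealD(1)[OF assms] by auto
    fix a assume "a \<in> \<pi> ` I"
    then obtain x where x: "x \<in> I" "a = \<pi> x" by auto
    have "\<ominus> a = \<pi> (0 - x)"
      by (simp only: hom_diff x hom_zero) (simp add: minus_eq)
    then show "\<ominus> a \<in> \<pi> ` I" using is_idealD(6)[OF assms x(1)] by simp
  next
    fix a b assume "a \<in> \<pi> ` I" "b \<in> \<pi> ` I"
    then show "a \<oplus> b \<in> \<pi> ` I"
      using assms by (auto simp flip: hom_add simp: is_idealD)
  qed
next
  fix a x assume "a \<in> \<pi> ` I" "x \<in> carrier R"
  then obtain b y where "a = \<pi> b" "b \<in> I" "x = \<pi> y" by (auto elim!: carrierE)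
  then show "x \<otimes> a \<in> \<pi> ` I" "a \<otimes> x \<in> \<pi> ` I"
    using assms by (auto simp flip: hom_mult simp: is_idealD)
qed

lemma image_mem_iff: "is_ideal I \<Longrightarrow> ker \<subseteq> I \<Longrightarrow> \<pi> x \<in> \<pi> ` I \<longleftrightarrow> x \<in> I"
  using hom_eq_iff is_ideal_cong by blast

lemma image_vimage: "I \<subseteq> carrier R \<Longrightarrow> \<pi> ` (\<pi> -` I) = I"
  using surj by auto

lemma image_eq_carrier_iff:
  assumes "is_ideal I" "ker \<subseteq> I"
  shows "\<pi> ` I = carrier R \<longleftrightarrow> 1 \<in> I"
proof
  assume "\<pi> ` I = carrier R"
  then have "\<pi> 1 \<in> \<pi> ` I" by auto
  then show "1 \<in> I" using image_mem_iff[OF assms] by blast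
next
  assume "1 \<in> I"
  then have "I = UNIV" using is_idealD(3)[OF assms(1), of 1] by auto
  then show "\<pi> ` I = carrier R" by (simp add: surj)
qed

lemma is_prime_vimage:
  assumes "primeideal P R"
  shows "is_prime (\<pi> -` P)"
proof -
  interpret P: primeideal P R by fact
  have "\<one> \<notin> P" using P.one_imp_carrier P.I_notcarr by blast
  then show ?thesis
    unfolding is_prime_def
    using is_ideal_vimage[OF P.ideal_axioms] P.I_prime by (auto simp: hom_one hom_mult)
qed

lemma primeideal_image:
  assumes "is_prime P" "ker \<subseteq> P"
  shows "primeideal (\<pi> ` P) R"
proof (rule primeidealI)
  note P = is_primeD[OF assms(1)]
  show "ideal (\<pi> ` P) R" by (rule ideal_image[OF P(1)])
  show "cring R" by (rule is_cring)
  show "carrier R \<noteq> \<pi> ` P" using image_eq_carrier_iff[OF P(1) assms(2)] P(2) by auto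
  fix a b assume *: "a \<in> carrier R" "b \<in> carrier R" "a \<otimes> b \<in> \<pi> ` P"
  then obtain x y where "a = \<pi> x" "b = \<pi> y" by (auto elim!: carrierE)
  with * have "x * y \<in> P"
    by (simp flip: hom_mult add: image_mem_iff[OF P(1) assms(2)])
  then show "a \<in> \<pi> ` P \<or> b \<in> \<pi> ` P"
    using P(3) \<open>a = \<pi> x\<close> \<open>b = \<pi> y\<close> by auto
qed

lemma genideal_eq_image: "genideal R (\<pi> ` set ys) = \<pi> ` ideal_plus_list ker ys"
proof
  let ?L = "ideal_plus_list ker ys"
  have L: "is_ideal ?L" by (rule is_ideal_ideal_plus_list[OF is_ideal_ker])
  show "genideal R (\<pi> ` set ys) \<subseteq> \<pi> ` ?L"
    using ideal_plus_list_self[OF is_ideal_ker, of ys]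
    by (intro genideal_minimal ideal_image L) auto
  let ?G = "genideal R (\<pi> ` set ys)"
  have G: "ideal ?G R" by (rule genideal_ideal) auto
  have "\<pi> ` set ys \<subseteq> ?G" by (rule genideal_self) auto
  then have "?L \<subseteq> \<pi> -` ?G"
    by (intro ideal_plus_list_least is_ideal_vimage G ker_subset_vimage) auto
  then show "\<pi> ` ?L \<subseteq> ?G" by auto
qed

text \<open>Ideals generated by residues are images of \<open>ideal_plus_list ker\<close>. As these
  ideals contain \<open>ker\<close>, membership of a residue can be tested on any
  representative.\<close>

lemma regular_sequence_iff:
  "regular_sequence R (map \<pi> ys) \<longleftrightarrow> weakly_regular ker ys \<and> 1 \<notin> ideal_plus_list ker ys"
proof -
  have L: "is_ideal (ideal_plus_list ker zs)" "ker \<subseteq> ideal_plus_list ker zs" for zs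
    by (auto intro: is_ideal_ideal_plus_list[OF is_ideal_ker] simp: ideal_plus_list_superset)
  have "(map \<pi> ys ! i \<otimes> \<pi> a \<in> genideal R (set (take i (map \<pi> ys))) \<longrightarrow>
      \<pi> a \<in> genideal R (set (take i (map \<pi> ys)))) \<longleftrightarrow>
    (ys ! i * a \<in> ideal_plus_list ker (take i ys) \<longrightarrow> a \<in> ideal_plus_list ker (take i ys))"
    if "i < length ys" for i a
    using that by (simp add: take_map genideal_eq_image image_mem_iff[OF L] flip: hom_mult)
  then have "(\<forall>i<length ys. \<forall>a\<in>carrier R.
        map \<pi> ys ! i \<otimes> a \<in> genideal R (set (take i (map \<pi> ys))) \<longrightarrow>
        a \<in> genideal R (set (take i (map \<pi> ys)))) \<longleftrightarrow> weakly_regular ker ys"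
    unfolding weakly_regular_iff_nth nzd_def surj[symmetric] by auto
  then show ?thesis
    unfolding regular_sequence_def set_map genideal_eq_image
    using image_eq_carrier_iff[OF L] by auto
qed

end

section \<open>Building regular sequences\<close>

definition colon :: "'a::comm_ring_1 set \<Rightarrow> 'a \<Rightarrow> 'a set" where
  "colon I u = {x. u * x \<in> I}"

lemma is_ideal_colon: "is_ideal I \<Longrightarrow> is_ideal (colon I u)"
  unfolding colon_def ideal_on_def by (auto simp: distrib_left mult.left_commute)

lemma ideal_plusE:
  assumes "x \<in> ideal_plus I y"
  obtains a b where "x = a + y * b" "a \<in> I"
  using assms unfolding ideal_plus_def by auto

lemma ideal_plusI:
  assumes "x - y * b \<in> I"
  shows "x \<in> ideal_plus I y"
proof -
  have "x = (x - y * b) + y * b" by simp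
  then show ?thesis unfolding ideal_plus_def using assms by blast
qed

lemma ideal_plus_cong:
  assumes "is_ideal I" "y - z \<in> I"
  shows "ideal_plus I y = ideal_plus I z"
proof -
  have *: "ideal_plus I y \<subseteq> ideal_plus I z" if "y - z \<in> I" for y z
  proof -
    have "y \<in> ideal_plus I z"
      by (rule ideal_plusI[of _ _ 1]) (use that in simp)
    then show ?thesis
      by (intro ideal_plus_least is_ideal_ideal_plus assms(1) ideal_plus_superset)
  qed
  have "z - y \<in> I"
    using is_idealD(6)[OF assms] by simp
  then show ?thesis using *[of y z] *[of z y] assms(2) by blast
qed

lemma nzd_cong:
  assumes "is_ideal I" "y - z \<in> I"
  shows "nzd I y \<longleftrightarrow> nzd I z"
proof -
  have "y * a - z * a \<in> I" for a
    using is_idealD(4)[OF assms, of a] by (simp add: left_diff_distrib)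
  then show ?thesis
    unfolding nzd_def using is_ideal_cong[OF assms(1)] by blast
qed

text \<open>Only the residues of the entries matter. This allows symmetric functions over different
  index sets to replace each other.\<close>

lemma weakly_regular_cong:
  "is_ideal I \<Longrightarrow> list_all2 (\<lambda>y z. y - z \<in> I) ys zs \<Longrightarrow> weakly_regular I ys \<Longrightarrow> weakly_regular I zs"
proof (induction ys arbitrary: I zs)
  case (Cons y ys)
  from Cons.prems(2) obtain z zs' where zs: "zs = z # zs'" "y - z \<in> I" "list_all2 (\<lambda>y z. y - z \<in> I) ys zs'"
    by (auto simp: list_all2_Cons1)
  have "list_all2 (\<lambda>u v. u - v \<in> ideal_plus I y) ys zs'"
    by (rule list_all2_mono[OF zs(3)]) (use ideal_plus_superset[of I y] in blast)
  from Cons.IH[OF is_ideal_ideal_plus[OF Cons.prems(1)] this] have "weakly_regular (ideal_plus I y) zs'"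
    using Cons.prems(3) by simp
  then show ?case
    using Cons.prems(3) nzd_cong[OF Cons.prems(1) zs(2)] ideal_plus_cong[OF Cons.prems(1) zs(2)]
    by (simp add: zs(1))
qed auto

text \<open>Multiplication by \<open>u\<close> gives 0 -> S/(I : u) -> S/I -> S/(I + (u)) -> 0.
  Reducing it modulo \<open>y\<close> keeps it exact, because \<open>y\<close> is a nonzerodivisor
  on the right-hand term.\<close>

lemma colon_ideal_plus:
  assumes "is_ideal I" "nzd (ideal_plus I u) y"
  shows "colon (ideal_plus I y) u = ideal_plus (colon I u) y"
proof
  show "colon (ideal_plus I y) u \<subseteq> ideal_plus (colon I u) y"
  proof
    fix x assume "x \<in> colon (ideal_plus I y) u"
    then obtain a b where ab: "u * x = a + y * b" "a \<in> I"
      by (auto simp: colon_def elim: ideal_plusE)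
    have "y * b \<in> ideal_plus I u"
      by (rule ideal_plusI[of _ _ x]) (use ab is_idealD(6)[OF assms(1) ab(2)] in simp)
    then have "b \<in> ideal_plus I u"
      using assms(2) by (auto simp: nzd_def)
    then obtain a' b' where ab': "b = a' + u * b'" "a' \<in> I"
      by (auto elim: ideal_plusE)
    have "u * (x - y * b') = a + y * a'"
      using ab(1) ab'(1) by (simp add: algebra_simps)
    then have "x - y * b' \<in> colon I u"
      using assms(1) ab(2) ab'(2) by (simp add: colon_def is_idealD)
    then show "x \<in> ideal_plus (colon I u) y"
      by (rule ideal_plusI)
  qed
  show "ideal_plus (colon I u) y \<subseteq> colon (ideal_plus I y) u"
    using assms(1) ideal_plus_superset[of I y] ideal_plus_self[OF assms(1), of y]
      is_idealD[OF is_ideal_ideal_plus[OF assms(1), of y]]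
    by (intro ideal_plus_least is_ideal_colon is_ideal_ideal_plus) (auto simp: colon_def)
qed

text \<open>In the same sequence, an element killed by \<open>y\<close> is zero on the right, hence
  comes from the left, where it is zero again.\<close>

lemma nzd_extension:
  assumes "is_ideal I" "nzd (ideal_plus I u) y" "nzd (colon I u) y"
  shows "nzd I y"
  unfolding nzd_def
proof (intro allI impI)
  fix a assume a: "y * a \<in> I"
  then have "a \<in> ideal_plus I u"
    using assms(2) ideal_plus_superset[of I u] by (auto simp: nzd_def)
  then obtain b c where bc: "a = b + u * c" "b \<in> I"
    by (auto elim: ideal_plusE)
  have "u * (y * c) = y * a - y * b"
    using bc(1) by (simp add: algebra_simps)
  then have "y * c \<in> colon I u"
    using a bc(2) assms(1) by (simp add: colon_def is_idealD)
  then have "c \<in> colon I u"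
    using assms(3) by (simp add: nzd_def)
  then show "a \<in> I"
    using bc assms(1) by (simp add: colon_def is_idealD)
qed

text \<open>The modules \<open>S/(I : u)\<close> and \<open>S/(I + (u))\<close> are the ends of a short exact sequence with middle
  term \<open>S/I\<close>.\<close>

lemma weakly_regular_extension:
  "is_ideal I \<Longrightarrow> weakly_regular (ideal_plus I u) ys \<Longrightarrow> weakly_regular (colon I u) ys \<Longrightarrow>
    weakly_regular I ys"
proof (induction ys arbitrary: I)
  case (Cons y ys)
  have "nzd I y"
    using Cons.prems by (auto intro: nzd_extension[of I u y])
  moreover have "weakly_regular (ideal_plus I y) ys"
  proof (rule Cons.IH)
    show "is_ideal (ideal_plus I y)" by (rule is_ideal_ideal_plus[OF Cons.prems(1)])
    show "weakly_regular (ideal_plus (ideal_plus I y) u) ys"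
      using Cons.prems(2) by (subst ideal_plus_commute) auto
    show "weakly_regular (colon (ideal_plus I y) u) ys"
      using Cons.prems by (subst colon_ideal_plus) auto
  qed
  ultimately show ?case by simp
qed auto

text \<open>On the zero module every element is a nonzerodivisor. This starts the induction in
  \<open>weakly_regular_prod\<close>, where the empty product is 1.\<close>

lemma weakly_regular_unit_ideal: "1 \<in> I \<Longrightarrow> is_ideal I \<Longrightarrow> weakly_regular I ys"
proof (induction ys arbitrary: I)
  case (Cons y ys)
  have "x \<in> I" for x using is_idealD(3)[OF Cons.prems(2,1), of x] by simp
  then have "nzd I y" by (simp add: nzd_def)
  moreover have "weakly_regular (ideal_plus I y) ys"
    using Cons.prems(1) ideal_plus_superset[of I y]
    by (intro Cons.IH[OF _ is_ideal_ideal_plus[OF Cons.prems(2)]]) blast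
  ultimately show ?case by simp
qed simp

lemma nzd_prod: "finite B \<Longrightarrow> (\<And>b. b \<in> B \<Longrightarrow> nzd I (y b)) \<Longrightarrow> nzd I (\<Prod>b\<in>B. y b)"
proof (induction B rule: finite_induct)
  case (insert b B)
  then have "nzd I (y b)" "nzd I (\<Prod>b\<in>B. y b)" by auto
  then have "nzd I (y b * (\<Prod>b\<in>B. y b))" unfolding nzd_def mult.assoc by blast
  then show ?case using insert by simp
qed (simp add: nzd_def)

text \<open>Induction over the factors by the exact sequence for \<open>y b\<close>. With P the
  product of the other factors, the colon of I + (y b P) by \<open>y b\<close> is I + (P), since
  \<open>y b\<close> is a nonzerodivisor modulo I, and adding \<open>y b\<close> gives I + (y
  b).\<close>

lemma weakly_regular_prod:
  assumes "finite B" "is_ideal I" "\<And>b. b \<in> B \<Longrightarrow> nzd I (y b)"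
    "\<And>b. b \<in> B \<Longrightarrow> weakly_regular (ideal_plus I (y b)) zs"
  shows "weakly_regular (ideal_plus I (\<Prod>b\<in>B. y b)) zs"
  using assms(1,3,4)
proof (induction B rule: finite_induct)
  case empty
  then show ?case
    using ideal_plus_self[OF assms(2), of 1]
    by (auto intro!: weakly_regular_unit_ideal is_ideal_ideal_plus assms(2))
next
  case (insert b B)
  define P where "P = (\<Prod>b\<in>B. y b)"
  define L where "L = ideal_plus I (y b * P)"
  have L: "is_ideal L" "I \<subseteq> L" "y b * P \<in> L"
    unfolding L_def by (auto intro: is_ideal_ideal_plus ideal_plus_self assms(2)
      simp: ideal_plus_superset[THEN subsetD])
  have nz: "nzd I (y b)" using insert by auto
  have "colon L (y b) \<subseteq> ideal_plus I P"
  proof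
    fix x assume "x \<in> colon L (y b)"
    then obtain a c where ac: "y b * x = a + y b * P * c" "a \<in> I"
      by (auto simp: colon_def L_def elim: ideal_plusE)
    then have "y b * (x - P * c) \<in> I" by (simp add: algebra_simps)
    then have "x - P * c \<in> I" using nz by (simp add: nzd_def)
    then show "x \<in> ideal_plus I P" by (rule ideal_plusI)
  qed
  moreover have "ideal_plus I P \<subseteq> colon L (y b)"
    by (intro ideal_plus_least is_ideal_colon L) (use L is_idealD(3)[OF L(1)] in \<open>auto simp: colon_def\<close>)
  ultimately have 1: "colon L (y b) = ideal_plus I P" by blast
  have 2: "ideal_plus L (y b) = ideal_plus I (y b)"
  proof
    have "y b * P \<in> ideal_plus I (y b)"
      by (intro is_idealD(4) is_ideal_ideal_plus assms(2) ideal_plus_self)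
    then have "L \<subseteq> ideal_plus I (y b)"
      unfolding L_def by (intro ideal_plus_least is_ideal_ideal_plus assms(2) ideal_plus_superset)
    then show "ideal_plus L (y b) \<subseteq> ideal_plus I (y b)"
      by (intro ideal_plus_least is_ideal_ideal_plus assms(2) ideal_plus_self)
    show "ideal_plus I (y b) \<subseteq> ideal_plus L (y b)"
      by (intro ideal_plus_mono L)
  qed
  have "weakly_regular L zs"
    by (rule weakly_regular_extension[of _ "y b"]) (use insert in \<open>auto simp: L 1 2 P_def\<close>)
  then show ?case using insert by (simp add: L_def P_def)
qed

section \<open>Elementary symmetric functions as regular sequences\<close>

definition esym :: "('i \<Rightarrow> 'a::comm_ring_1) \<Rightarrow> 'i set \<Rightarrow> nat \<Rightarrow> 'a" where
  "esym y A i = (\<Sum>T | T \<subseteq> A \<and> card T = i. \<Prod>t\<in>T. y t)"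

lemma esym_card: "finite A \<Longrightarrow> esym y A (card A) = (\<Prod>t\<in>A. y t)"
proof -
  assume "finite A"
  then have "{T. T \<subseteq> A \<and> card T = card A} = {A}" using card_subset_eq by auto
  then show ?thesis by (simp add: esym_def)
qed

text \<open>The difference consists of the products over sets containing \<open>b\<close>, each a
  multiple of \<open>y b\<close>.\<close>

lemma esym_insert_cong:
  assumes "finite A" "is_ideal I" "y b \<in> I" "b \<notin> A"
  shows "esym y (insert b A) i - esym y A i \<in> I"
proof -
  let ?S = "{T. T \<subseteq> insert b A \<and> card T = i}"
  have fin: "finite ?S" using assms by (auto intro: finite_subset[of _ "Pow (insert b A)"])
  have S: "?S = {T. T \<subseteq> A \<and> card T = i} \<union> {T\<in>?S. b \<in> T}" by auto
  have "esym y (insert b A) i = esym y A i + (\<Sum>T\<in>{T\<in>?S. b \<in> T}. \<Prod>t\<in>T. y t)"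
    unfolding esym_def
    by (subst S, rule sum.union_disjoint) (use assms in \<open>auto intro: finite_subset[OF _ fin]\<close>)
  moreover have "(\<Prod>t\<in>T. y t) \<in> I" if "T \<in> {T\<in>?S. b \<in> T}" for T
  proof -
    have "finite T" using that assms(1) by (auto intro: finite_subset)
    then have "(\<Prod>t\<in>T. y t) = y b * (\<Prod>t\<in>T - {b}. y t)"
      using that by (subst prod.remove[of _ b]) auto
    then show ?thesis using assms by (simp add: is_idealD)
  qed
  ultimately show ?thesis
    by (auto intro!: is_ideal_sum[OF assms(2)])
qed

lemma esym_superset_cong:
  assumes "finite A" "B \<subseteq> A" "is_ideal I" "\<And>b. b \<in> A - B \<Longrightarrow> y b \<in> I"
  shows "esym y A i - esym y B i \<in> I"
proof -
  have "esym y (B \<union> C) i - esym y B i \<in> I" if "finite C" "C \<subseteq> A - B" for C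
    using that
  proof (induction C rule: finite_induct)
    case empty
    then show ?case using assms by (simp add: is_idealD)
  next
    case (insert c C)
    have "esym y (insert c (B \<union> C)) i - esym y (B \<union> C) i \<in> I"
      using insert assms by (intro esym_insert_cong) (auto intro: finite_subset)
    from is_idealD(2)[OF assms(3) this insert.IH] insert.prems show ?case by simp
  qed
  from this[of "A - B"] show ?thesis using assms by (simp add: Un_absorb1)
qed

text \<open>All orders are demanded so that any index can come first: the induction in
  \<open>weakly_regular_esym\<close> cuts by an arbitrary \<open>y b\<close>.\<close>

definition permutably_regular :: "'a::comm_ring_1 set \<Rightarrow> ('i \<Rightarrow> 'a) \<Rightarrow> 'i set \<Rightarrow> bool" where
  "permutably_regular I y A \<longleftrightarrow> (\<forall>xs. distinct xs \<and> set xs \<subseteq> A \<longrightarrow> weakly_regular I (map y xs))"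

lemma weakly_regular_esym:
  "finite A \<Longrightarrow> is_ideal I \<Longrightarrow> permutably_regular I y A \<Longrightarrow>
    weakly_regular I (map (esym y A) (rev [1..<Suc (card A)]))"
proof (induction "card A" arbitrary: A I)
  case (Suc d)
  note A = Suc.prems
  have nz: "nzd I (y b)" if "b \<in> A" for b
    using A(3)[unfolded permutably_regular_def, rule_format, of "[b]"] that by auto
  let ?zs = "map (esym y A) (rev [1..<Suc d])"
  have "weakly_regular (ideal_plus I (y b)) ?zs" if b: "b \<in> A" for b
  proof -
    let ?I = "ideal_plus I (y b)"
    have d: "card (A - {b}) = d" using b A Suc.hyps(2) by simp
    have I: "is_ideal ?I" by (intro is_ideal_ideal_plus A)
    have "weakly_regular ?I (map (esym y (A - {b})) (rev [1..<Suc (card (A - {b}))]))"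
    proof (rule Suc.hyps(1))
      show "permutably_regular ?I y (A - {b})"
        unfolding permutably_regular_def
      proof (intro allI impI)
        fix xs assume "distinct xs \<and> set xs \<subseteq> A - {b}"
        then show "weakly_regular ?I (map y xs)"
          using A(3)[unfolded permutably_regular_def, rule_format, of "b # xs"] b by auto
      qed
    qed (use d A I in auto)
    moreover have "list_all2 (\<lambda>y z. y - z \<in> ?I) (map (esym y (A - {b})) (rev [1..<Suc d])) ?zs"
    proof -
      have "esym y A i - esym y (A - {b}) i \<in> ?I" for i
        using A b by (intro esym_superset_cong I) (auto intro: ideal_plus_self)
      from is_idealD(6)[OF I this] show ?thesis
        by (auto simp: list_all2_conv_all_nth simp del: upt_Suc)
    qed
    ultimately show ?thesis
      using weakly_regular_cong[OF I] d by metis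
  qed
  then have "weakly_regular (ideal_plus I (\<Prod>b\<in>A. y b)) ?zs"
    by (intro weakly_regular_prod A nz)
  moreover have "nzd I (\<Prod>b\<in>A. y b)" by (intro nzd_prod A nz)
  \<comment> \<open>The head of the list has index \<open>card A\<close>, so it is the product of
    all \<open>y b\<close>; the tail is regular modulo each single factor and hence modulo the
    product.\<close>
  ultimately show ?case
    using esym_card[OF A(1), of y] by (simp flip: Suc.hyps(2))
qed auto

section \<open>Depth is at most height\<close>

lemma is_prime_maximal_disjoint:
  assumes Q: "is_ideal Q" and disj: "Q \<inter> S = {}" and S: "1 \<in> S" "\<And>s t. s \<in> S \<Longrightarrow> t \<in> S \<Longrightarrow> s * t \<in> S"
    and max: "\<And>L. is_ideal L \<Longrightarrow> Q \<subseteq> L \<Longrightarrow> L \<inter> S = {} \<Longrightarrow> L = Q"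
  shows "is_prime Q"
proof -
  have "x \<in> Q \<or> y \<in> Q" if xy: "x * y \<in> Q" for x y
  proof (rule ccontr)
    assume not: "\<not> (x \<in> Q \<or> y \<in> Q)"
    have "ideal_plus Q z \<inter> S \<noteq> {}" if "z \<notin> Q" for z
      using max[of "ideal_plus Q z"] ideal_plus_self[OF Q, of z] that
      by (auto simp: is_ideal_ideal_plus Q ideal_plus_superset)
    with not have "ideal_plus Q x \<inter> S \<noteq> {}" "ideal_plus Q y \<inter> S \<noteq> {}" by auto
    then obtain q a q' a' where *: "q \<in> Q" "q' \<in> Q" "q + x * a \<in> S" "q' + y * a' \<in> S"
      unfolding ideal_plus_def by auto
    have "(q + x * a) * (q' + y * a') = q * (q' + y * a') + (x * a) * q' + (x * y) * (a * a')"
      by (simp add: algebra_simps)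
    also have "\<dots> \<in> Q"
      using * xy by (simp add: is_idealD[OF Q])
    finally show False using S(2)[OF *(3,4)] disj by auto
  qed
  moreover have "1 \<notin> Q" using disj S(1) by auto
  ultimately show ?thesis unfolding is_prime_def using Q by blast
qed

lemma ex_prime_disjoint:
  assumes L: "is_ideal L" and disj: "L \<inter> S = {}"
    and S: "1 \<in> S" "\<And>s t. s \<in> S \<Longrightarrow> t \<in> S \<Longrightarrow> s * t \<in> S"
  obtains Q where "is_prime Q" "L \<subseteq> Q" "Q \<inter> S = {}"
proof -
  define A where "A = {Q. is_ideal Q \<and> L \<subseteq> Q \<and> Q \<inter> S = {}}"
  have "\<exists>M\<in>A. \<forall>U\<in>A. M \<subseteq> U \<longrightarrow> U = M"
  proof (rule subset_Zorn_nonempty)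
    show "A \<noteq> {}" using L disj unfolding A_def by auto
    fix C assume C: "C \<noteq> {}" "subset.chain A C"
    have id: "is_ideal U" if "U \<in> C" for U using C that by (auto simp: subset.chain_def A_def)
    have "is_ideal (\<Union>C)"
      unfolding ideal_on_def
    proof (intro conjI ballI subset_UNIV)
      show "0 \<in> \<Union>C" using C(1) id is_idealD(1) by blast
    next
      fix x y assume "x \<in> \<Union>C" "y \<in> \<Union>C"
      then obtain U V where UV: "U \<in> C" "V \<in> C" "x \<in> U" "y \<in> V" by auto
      then have "U \<subseteq> V \<or> V \<subseteq> U" using C(2) by (auto simp: subset.chain_def)
      then show "x + y \<in> \<Union>C" using UV id is_idealD(2) by (metis UnionI subsetD)
    next
      fix r x assume "x \<in> \<Union>C"
      then show "r * x \<in> \<Union>C" using id is_idealD(3) by blast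
    qed
    then show "\<Union>C \<in> A" using C unfolding A_def by (auto simp: subset.chain_def)
  qed
  then obtain Q where Q: "Q \<in> A" "\<And>U. U \<in> A \<Longrightarrow> Q \<subseteq> U \<Longrightarrow> U = Q" by blast
  have "is_prime Q"
  proof (rule is_prime_maximal_disjoint[OF _ _ S])
    show "is_ideal Q" "Q \<inter> S = {}" using Q(1) by (auto simp: A_def)
    show "U = Q" if "is_ideal U" "Q \<subseteq> U" "U \<inter> S = {}" for U
      using Q(1) that by (intro Q(2)) (auto simp: A_def)
  qed
  then show ?thesis using that Q(1) unfolding A_def by blast
qed

text \<open>The products of a power of \<open>y\<close> with an element outside \<open>P\<close>
  form a multiplicative set. It misses \<open>L\<close> because \<open>y\<close> is a nonzerodivisor
  modulo \<open>L\<close>, and a prime over \<open>L\<close> that avoids it lies inside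
  \<open>P\<close> and omits \<open>y\<close>. This stands in for localizing at \<open>P\<close> and
  inverting \<open>y\<close>.\<close>

lemma ex_smaller_prime:
  assumes L: "is_ideal L" and y: "nzd L y" and P: "is_prime P" "L \<subseteq> P"
  obtains Q where "is_prime Q" "L \<subseteq> Q" "Q \<subseteq> P" "y \<notin> Q"
proof -
  let ?S = "{y ^ k * b | k b. b \<notin> P}"
  have nz: "a \<in> L" if "y ^ k * a \<in> L" for k a
    using that
  proof (induction k)
    case (Suc k)
    then have "y * (y ^ k * a) \<in> L" by (simp add: mult.assoc)
    then show ?case using y Suc.IH unfolding nzd_def by blast
  qed simp
  have "L \<inter> ?S = {}" using nz P(2) by blast
  moreover have "1 \<in> ?S" using is_primeD(2)[OF P(1)] by (force intro: exI[of _ 0])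
  moreover have "s * t \<in> ?S" if "s \<in> ?S" "t \<in> ?S" for s t
  proof -
    from that obtain k b k' b' where "s = y ^ k * b" "t = y ^ k' * b'" "b \<notin> P" "b' \<notin> P" by auto
    then have "s * t = y ^ (k + k') * (b * b')" "b * b' \<notin> P"
      using is_primeD(3)[OF P(1)] by (auto simp: power_add algebra_simps)
    then show ?thesis by blast
  qed
  ultimately obtain Q where Q: "is_prime Q" "L \<subseteq> Q" "Q \<inter> ?S = {}"
    using ex_prime_disjoint[OF L, of ?S] by blast
  have "Q \<subseteq> P"
  proof
    fix b assume "b \<in> Q"
    moreover have "b \<in> ?S" if "b \<notin> P" using that by (force intro: exI[of _ 0])
    ultimately show "b \<in> P" using Q(3) by blast
  qed
  moreover have "y \<notin> Q"
  proof -
    have "y \<in> ?S" using is_primeD(2)[OF P(1)] by (force intro: exI[of _ 1])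
    then show ?thesis using Q(3) by blast
  qed
  ultimately show ?thesis using that Q by blast
qed

text \<open>The tail of the sequence gives a chain that starts at a prime over L + (y). Below it
  \<open>ex_smaller_prime\<close> puts a prime over L that omits \<open>y\<close>, so the new
  inclusion is strict.\<close>

lemma ex_prime_chain:
  "is_ideal L \<Longrightarrow> weakly_regular L ys \<Longrightarrow> is_prime P \<Longrightarrow> ideal_plus_list L ys \<subseteq> P \<Longrightarrow>
    \<exists>Q. (\<forall>i\<le>length ys. is_prime (Q i)) \<and> (\<forall>i<length ys. Q i \<subset> Q (Suc i)) \<and> L \<subseteq> Q 0 \<and> Q (length ys) = P"
proof (induction ys arbitrary: L)
  case Nil
  then show ?case by (auto intro!: exI[of _ "\<lambda>_. P"])
next
  case (Cons y ys)
  have "\<exists>Q. (\<forall>i\<le>length ys. is_prime (Q i)) \<and> (\<forall>i<length ys. Q i \<subset> Q (Suc i)) \<and>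
      ideal_plus L y \<subseteq> Q 0 \<and> Q (length ys) = P"
    by (rule Cons.IH[OF is_ideal_ideal_plus[OF Cons.prems(1)]]) (use Cons.prems in simp_all)
  then obtain Q where Q: "\<And>i. i \<le> length ys \<Longrightarrow> is_prime (Q i)" "\<And>i. i < length ys \<Longrightarrow> Q i \<subset> Q (Suc i)"
      "ideal_plus L y \<subseteq> Q 0" "Q (length ys) = P" by blast
  have y: "y \<in> Q 0" using Q(3) ideal_plus_self[OF Cons.prems(1)] by auto
  have "L \<subseteq> Q 0" using Q(3) ideal_plus_superset[of L y] by auto
  then obtain Q' where Q': "is_prime Q'" "L \<subseteq> Q'" "Q' \<subseteq> Q 0" "y \<notin> Q'"
    using ex_smaller_prime[OF Cons.prems(1) _ Q(1)[of 0], of y] Cons.prems(2) by auto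
  show ?case
    using Q Q' y by (intro exI[of _ "case_nat Q' Q"]) (auto simp: le_Suc_eq less_Suc_eq_0_disj split: nat.splits)
qed

context ring_quotient
begin

text \<open>A regular sequence inside \<open>m\<close> produces a chain of primes of the same length
  that ends at \<open>m\<close> itself.\<close>

lemma depth_le_height:
  assumes "primeideal m R"
  shows "depth R m \<le> height R m"
  unfolding depth_def
proof (rule Sup_least, safe)
  fix xs assume xs: "regular_sequence R xs" "set xs \<subseteq> m"
  then have "set xs \<subseteq> range \<pi>" using surj by (auto simp: regular_sequence_def)
  then obtain ys where ys: "xs = map \<pi> ys"
    by (metis ex_map_conv rangeE subsetD)
  have m: "is_prime (\<pi> -` m)" "ker \<subseteq> \<pi> -` m"
    using is_prime_vimage[OF assms] ker_subset_vimage[OF primeideal.axioms(1)[OF assms]] by auto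
  have 1: "ideal_plus_list ker ys \<subseteq> \<pi> -` m"
    using xs(2) m(2) by (intro ideal_plus_list_least is_primeD(1)[OF m(1)]) (auto simp: ys)
  have 2: "weakly_regular ker ys" using xs(1) by (simp add: ys regular_sequence_iff)
  from ex_prime_chain[OF is_ideal_ker 2 m(1) 1] obtain Q where Q: "\<And>i. i \<le> length ys \<Longrightarrow> is_prime (Q i)"
    "\<And>i. i < length ys \<Longrightarrow> Q i \<subset> Q (Suc i)" "ker \<subseteq> Q 0" "Q (length ys) = \<pi> -` m" by blast
  have ker: "ker \<subseteq> Q i" if "i \<le> length ys" for i
    using that
  proof (induction i)
    case (Suc i)
    then show ?case using Q(2)[of i] by auto
  qed (use Q in auto)
  have "prime_chain R (length ys) (\<lambda>i. \<pi> ` Q i)"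
    unfolding prime_chain_def
  proof (intro conjI allI impI)
    fix i assume "i \<le> length ys"
    then show "primeideal (\<pi> ` Q i) R" by (intro primeideal_image Q(1) ker)
  next
    fix i assume i: "i < length ys"
    then obtain x where "x \<in> Q (Suc i)" "x \<notin> Q i" using Q(2)[of i] by auto
    moreover have "\<pi> x \<in> \<pi> ` Q i \<longleftrightarrow> x \<in> Q i"
      using i by (intro image_mem_iff is_primeD(1) Q(1) ker) auto
    ultimately show "\<pi> ` Q i \<subset> \<pi> ` Q (Suc i)" using Q(2)[OF i] by blast
  qed
  moreover have "\<pi> ` Q (length ys) = m"
    unfolding Q(4)
    by (rule image_vimage) (rule additive_subgroup.a_subset[OF ideal.axioms(1)[OF primeideal.axioms(1)[OF assms]]])
  ultimately show "enat (length xs) \<le> height R m"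
    unfolding height_def ys by (intro Sup_upper) auto
qed

end

lemma height_le_krull_dim: "height R p \<le> krull_dim R"
  unfolding height_def krull_dim_def by (rule Sup_subset_mono) auto

section \<open>Adjoining an element to a subring\<close>

text \<open>The coefficients are restricted by a predicate while the polynomial type stays over the
  ambient ring, so that evaluation at any ambient element makes sense.\<close>

definition polys_over :: "'a::comm_ring_1 set \<Rightarrow> 'a poly set" where
  "polys_over R = {p. \<forall>i. coeff p i \<in> R}"

definition adjoin :: "'a::comm_ring_1 set \<Rightarrow> 'a \<Rightarrow> 'a set" where
  "adjoin R a = (\<lambda>p. poly p a) ` polys_over R"

text \<open>The last entry of the list is adjoined first, directly above \<open>R\<close>.\<close>

fun adjoin_list :: "'a::comm_ring_1 set \<Rightarrow> 'a list \<Rightarrow> 'a set" where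
  "adjoin_list R [] = R"
| "adjoin_list R (a # as) = adjoin (adjoin_list R as) a"

context
  fixes R :: "'a::comm_ring_1 set"
  assumes R: "subring_on R"
begin

lemma polys_over_add: "p \<in> polys_over R \<Longrightarrow> q \<in> polys_over R \<Longrightarrow> p + q \<in> polys_over R"
  by (auto simp: polys_over_def subring_onD R)

lemma polys_over_diff: "p \<in> polys_over R \<Longrightarrow> q \<in> polys_over R \<Longrightarrow> p - q \<in> polys_over R"
  by (auto simp: polys_over_def subring_onD R)

lemma polys_over_uminus: "p \<in> polys_over R \<Longrightarrow> - p \<in> polys_over R"
  by (auto simp: polys_over_def subring_onD R)

lemma polys_over_mult: "p \<in> polys_over R \<Longrightarrow> q \<in> polys_over R \<Longrightarrow> p * q \<in> polys_over R"
  by (auto simp: polys_over_def coeff_mult intro!: subring_on_sum[OF R] subring_onD[OF R])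

lemma polys_over_smult: "c \<in> R \<Longrightarrow> p \<in> polys_over R \<Longrightarrow> smult c p \<in> polys_over R"
  by (auto simp: polys_over_def subring_onD R)

lemma polys_over_0: "0 \<in> polys_over R"
  by (auto simp: polys_over_def subring_onD R)

lemma polys_over_1: "1 \<in> polys_over R"
  by (auto simp: polys_over_def subring_onD R)

lemma polys_over_pCons: "c \<in> R \<Longrightarrow> p \<in> polys_over R \<Longrightarrow> pCons c p \<in> polys_over R"
  by (auto simp: polys_over_def coeff_pCons split: nat.splits)

lemma polys_over_monom: "c \<in> R \<Longrightarrow> Polynomial.monom c n \<in> polys_over R"
  by (auto simp: polys_over_def subring_onD R)

lemmas polys_over_intros = polys_over_add polys_over_diff polys_over_uminus polys_over_mult
  polys_over_smult polys_over_0 polys_over_1 polys_over_pCons polys_over_monom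

lemma polys_over_power: "p \<in> polys_over R \<Longrightarrow> p ^ n \<in> polys_over R"
  by (induction n) (auto intro: polys_over_intros)

lemma poly_in_adjoin: "p \<in> polys_over R \<Longrightarrow> poly p a \<in> adjoin R a"
  by (auto simp: adjoin_def)

lemma adjoinE:
  assumes "x \<in> adjoin R a"
  obtains p where "p \<in> polys_over R" "x = poly p a"
  using assms by (auto simp: adjoin_def)

lemma adjoin_superset: "R \<subseteq> adjoin R a"
proof
  fix r assume "r \<in> R"
  then have "poly [:r:] a \<in> adjoin R a" by (intro poly_in_adjoin polys_over_intros)
  then show "r \<in> adjoin R a" by simp
qed

lemma adjoin_self: "a \<in> adjoin R a"
proof -
  have "poly [:0, 1:] a \<in> adjoin R a" by (intro poly_in_adjoin polys_over_intros subring_onD[OF R])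
  then show ?thesis by simp
qed

lemma subring_on_adjoin: "subring_on (adjoin R a)"
  unfolding subring_on_def
proof (intro conjI ballI)
  show "0 \<in> adjoin R a" "1 \<in> adjoin R a"
    using adjoin_superset subring_onD[OF R] by auto
next
  fix x assume "x \<in> adjoin R a"
  then obtain p where "p \<in> polys_over R" "x = poly p a" by (rule adjoinE)
  then show "- x \<in> adjoin R a" by (auto simp flip: poly_minus intro!: poly_in_adjoin polys_over_intros)
next
  fix x y assume "x \<in> adjoin R a" "y \<in> adjoin R a"
  then obtain p q where "p \<in> polys_over R" "x = poly p a" "q \<in> polys_over R" "y = poly q a"
    by (auto elim!: adjoinE)
  then show "x + y \<in> adjoin R a" "x * y \<in> adjoin R a"
    by (auto simp flip: poly_add poly_mult intro!: poly_in_adjoin polys_over_intros)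
qed

text \<open>Multiplying by a power of the leading coefficient of the divisor replaces division by it.\<close>

lemma pseudo_division:
  assumes h: "h \<in> polys_over R" and e: "0 < Polynomial.degree h" and p: "p \<in> polys_over R"
  obtains k q r where "smult (lead_coeff h ^ k) p = h * q + r" "q \<in> polys_over R" "r \<in> polys_over R"
    "Polynomial.degree r < Polynomial.degree h" "Polynomial.degree q \<le> Polynomial.degree p - Polynomial.degree h"
proof -
  let ?l = "lead_coeff h" and ?e = "Polynomial.degree h"
  have l: "?l \<in> R" using h by (auto simp: polys_over_def)
  have "\<exists>k q r. smult (?l ^ k) p = h * q + r \<and> q \<in> polys_over R \<and> r \<in> polys_over R \<and>
      Polynomial.degree r < ?e \<and> Polynomial.degree q \<le> Polynomial.degree p - ?e"
    using p
  proof (induction "Polynomial.degree p" arbitrary: p rule: less_induct)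
    case less
    show ?case
    proof (cases "Polynomial.degree p < ?e")
      case True
      have "smult (?l ^ 0) p = h * 0 + p" by simp
      then show ?thesis using True less.prems polys_over_0 by (metis degree_0 le0)
    next
      case False
      let ?d = "Polynomial.degree p"
      define m where "m = Polynomial.monom (lead_coeff p) (?d - ?e)"
      \<comment> \<open>One cancellation: both terms have the coefficient
        \<open>lead_coeff h * lead_coeff p\<close> in degree \<open>?d\<close>.\<close>
      define p' where "p' = smult ?l p - h * m"
      have m: "m \<in> polys_over R" "Polynomial.degree m \<le> ?d - ?e"
        using less.prems by (auto simp: m_def polys_over_def degree_monom_le subring_onD R)
      have p': "p' \<in> polys_over R"
        unfolding p'_def by (intro polys_over_intros l m h less.prems)
      have "Polynomial.degree (h * m) \<le> ?d"
        using degree_mult_le[of h m] m(2) False by linarith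
      then have "Polynomial.degree p' \<le> ?d"
        unfolding p'_def by (intro degree_diff_le degree_smult_le order.refl) auto
      moreover have "coeff p' ?d = 0"
      proof -
        have "coeff (h * m) ?d = ?l * lead_coeff p"
          using False by (simp add: m_def mult.commute[of h] coeff_monom_mult mult.commute[of "lead_coeff p"])
        then show ?thesis by (simp add: p'_def)
      qed
      \<comment> \<open>If \<open>p'\<close> is zero, its degree is 0, still below
        \<open>?d\<close>, which is at least the positive degree of \<open>h\<close>.\<close>
      ultimately have deg: "Polynomial.degree p' < ?d"
        using False e by (metis eq_zero_or_degree_less degree_0 gr_zeroI)
      obtain k q r where IH: "smult (?l ^ k) p' = h * q + r" "q \<in> polys_over R" "r \<in> polys_over R"
        "Polynomial.degree r < ?e" "Polynomial.degree q \<le> Polynomial.degree p' - ?e"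
        using less.hyps[OF deg p'] by blast
      have "smult (?l ^ Suc k) p = h * (smult (?l ^ k) m + q) + r"
        using IH(1) by (simp add: p'_def smult_diff_right algebra_simps)
      moreover have "smult (?l ^ k) m + q \<in> polys_over R"
        by (intro polys_over_intros m IH subring_on_power[OF R] l)
      moreover have "Polynomial.degree (smult (?l ^ k) m + q) \<le> ?d - ?e"
        using m(2) IH(5) deg by (intro degree_add_le order.trans[OF degree_smult_le]) auto
      ultimately show ?thesis using IH(3,4) by blast
    qed
  qed
  then show ?thesis using that by blast
qed

end

lemma subring_on_adjoin_list: "subring_on R \<Longrightarrow> subring_on (adjoin_list R as)"
  by (induction as) (auto simp: subring_on_adjoin)

lemma adjoin_list_append: "adjoin_list R (as @ bs) = adjoin_list (adjoin_list R bs) as"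
  by (induction as) auto

lemma adjoin_list_superset: "subring_on R \<Longrightarrow> R \<subseteq> adjoin_list R as"
  by (induction as) (auto dest!: adjoin_superset[OF subring_on_adjoin_list, THEN subsetD])

lemma adjoin_list_set: "subring_on R \<Longrightarrow> set as \<subseteq> adjoin_list R as"
  by (induction as)
    (auto intro: adjoin_superset[OF subring_on_adjoin_list, THEN subsetD] adjoin_self[OF subring_on_adjoin_list])

section \<open>Hilbert's basis theorem\<close>

text \<open>Generation is expressed through minimality among the ideals over \<open>R\<close>, which
  avoids constructing the generated ideal.\<close>

definition fin_gen :: "'a::comm_ring_1 set \<Rightarrow> 'a set \<Rightarrow> bool" where
  "fin_gen R I \<longleftrightarrow> (\<exists>B. finite B \<and> B \<subseteq> I \<and> (\<forall>I'. ideal_on R I' \<longrightarrow> B \<subseteq> I' \<longrightarrow> I \<subseteq> I'))"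

definition noetherian_on :: "'a::comm_ring_1 set \<Rightarrow> bool" where
  "noetherian_on R \<longleftrightarrow> (\<forall>I. ideal_on R I \<longrightarrow> fin_gen R I)"

text \<open>Hilbert's argument, run on the polynomials over \<open>R\<close> whose value at
  \<open>a\<close> lies in the ideal: the ideals of leading coefficients stabilize, and finitely
  many polynomials realize generators for them.\<close>

lemma noetherian_on_adjoin:
  assumes R: "subring_on R" and noeth: "noetherian_on R"
  shows "noetherian_on (adjoin R a)"
  unfolding noetherian_on_def
proof (intro allI impI)
  fix I assume I: "ideal_on (adjoin R a) I"
  note T = subring_on_adjoin[OF R, of a]
  note po = polys_over_intros[OF R]
  have RT: "r \<in> R \<Longrightarrow> r \<in> adjoin R a" for r using adjoin_superset[OF R] by blast
  define P where "P I = {p \<in> polys_over R. poly p a \<in> I}" for I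
  \<comment> \<open>Allowing degree below \<open>d\<close> admits the coefficient 0, so
    \<open>L I d\<close> is an ideal; multiplication by the variable makes it grow with
    \<open>d\<close>.\<close>
  define L where "L I d = {coeff p d | p. p \<in> P I \<and> Polynomial.degree p \<le> d}" for I d
  have P_add: "p + q \<in> P J" and P_smult: "r \<in> R \<Longrightarrow> smult r p \<in> P J"
    and P_monom: "Polynomial.monom 1 n * p \<in> P J"
    if "p \<in> P J" "q \<in> P J" "ideal_on (adjoin R a) J" for p q r J n
    using that(1,2) ideal_onD(3)[OF that(3)]
      ideal_onD(4)[OF that(3) RT[of r], of "poly p a"]
      ideal_onD(4)[OF that(3) subring_on_power[OF T adjoin_self[OF R]], of "poly p a" n]
    by (auto simp: P_def poly_monom po subring_onD[OF R])
  have L_ideal: "ideal_on R (L I d)" if I: "ideal_on (adjoin R a) I" for I d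
    unfolding ideal_on_def
  proof (intro conjI ballI)
    show "L I d \<subseteq> R" by (auto simp: L_def P_def polys_over_def)
    have "0 \<in> P I" using ideal_onD(2)[OF I] by (auto simp: P_def po)
    then show "0 \<in> L I d" unfolding L_def by (auto intro!: exI[of _ 0])
  next
    fix x y assume "x \<in> L I d" "y \<in> L I d"
    then obtain p q where "p \<in> P I" "Polynomial.degree p \<le> d" "x = coeff p d"
      "q \<in> P I" "Polynomial.degree q \<le> d" "y = coeff q d" by (auto simp: L_def)
    then show "x + y \<in> L I d"
      unfolding L_def using P_add[OF _ _ I] by (auto intro!: exI[of _ "p + q"] degree_add_le)
  next
    fix r x assume "r \<in> R" "x \<in> L I d"
    then obtain p where "p \<in> P I" "Polynomial.degree p \<le> d" "x = coeff p d" by (auto simp: L_def)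
    then show "r * x \<in> L I d"
      unfolding L_def using P_smult[OF _ _ I \<open>r \<in> R\<close>]
      by (auto intro!: exI[of _ "smult r p"] order.trans[OF degree_smult_le])
  qed
  have L_mono: "L I d \<subseteq> L I d'" if "d \<le> d'" for d d'
  proof
    fix x assume "x \<in> L I d"
    then obtain p where p: "p \<in> P I" "Polynomial.degree p \<le> d" "x = coeff p d" by (auto simp: L_def)
    let ?q = "Polynomial.monom 1 (d' - d) * p"
    have "?q \<in> P I" by (rule P_monom[OF p(1) p(1) I])
    moreover have "Polynomial.degree ?q \<le> d'"
      using degree_mult_le[of "Polynomial.monom 1 (d' - d)" p] degree_monom_le[of "1::'a" "d' - d"] p(2) that
      by linarith
    moreover have "coeff ?q d' = x" using that p(3) by (simp add: coeff_monom_mult)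
    ultimately show "x \<in> L I d'" unfolding L_def by blast
  qed
  \<comment> \<open>The increasing union is finitely generated, and its generators already occur
    together at one index \<open>N\<close>.\<close>
  have "ideal_on R (\<Union>d. L I d)"
    unfolding ideal_on_def
  proof (intro conjI ballI)
    show "(\<Union>d. L I d) \<subseteq> R" "0 \<in> (\<Union>d. L I d)"
      using ideal_onD(1,2)[OF L_ideal[OF I]] by auto
  next
    fix x y assume "x \<in> (\<Union>d. L I d)" "y \<in> (\<Union>d. L I d)"
    then obtain d d' where "x \<in> L I d" "y \<in> L I d'" by auto
    then have "x \<in> L I (max d d')" "y \<in> L I (max d d')"
      using L_mono[of d "max d d'"] L_mono[of d' "max d d'"] by auto
    then show "x + y \<in> (\<Union>d. L I d)" using ideal_onD(3)[OF L_ideal[OF I]] by blast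
  next
    fix r x assume "r \<in> R" "x \<in> (\<Union>d. L I d)"
    then show "r * x \<in> (\<Union>d. L I d)" using ideal_onD(4)[OF L_ideal[OF I]] by blast
  qed
  then obtain B0 where B0: "finite B0" "B0 \<subseteq> (\<Union>d. L I d)" "\<And>J. ideal_on R J \<Longrightarrow> B0 \<subseteq> J \<Longrightarrow> (\<Union>d. L I d) \<subseteq> J"
    using noeth unfolding noetherian_on_def fin_gen_def by metis
  have "\<exists>N. B0 \<subseteq> L I N"
    using B0(1,2)
  proof (induction B0 rule: finite_induct)
    case (insert b B)
    then obtain N d where "B \<subseteq> L I N" "b \<in> L I d" by auto
    then have "insert b B \<subseteq> L I (max N d)" using L_mono[of N "max N d"] L_mono[of d "max N d"] by auto
    then show ?case by blast
  qed auto
  then obtain N where "B0 \<subseteq> L I N" by blast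
  then have LN: "L I d \<subseteq> L I N" for d using B0(3)[OF L_ideal[OF I]] by blast
  have "\<exists>B. finite B \<and> B \<subseteq> L I d \<and> (\<forall>J. ideal_on R J \<longrightarrow> B \<subseteq> J \<longrightarrow> L I d \<subseteq> J)" for d
    using noeth L_ideal[OF I] unfolding noetherian_on_def fin_gen_def by blast
  then obtain B where B: "\<And>d. finite (B d)" "\<And>d. B d \<subseteq> L I d"
    "\<And>d J. ideal_on R J \<Longrightarrow> B d \<subseteq> J \<Longrightarrow> L I d \<subseteq> J" by metis
  have "\<forall>d b. \<exists>p. b \<in> B d \<longrightarrow> p \<in> P I \<and> Polynomial.degree p \<le> d \<and> coeff p d = b"
    using B(2) unfolding L_def by blast
  then obtain f where f: "\<And>d b. b \<in> B d \<Longrightarrow> f d b \<in> P I"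
    "\<And>d b. b \<in> B d \<Longrightarrow> Polynomial.degree (f d b) \<le> d" "\<And>d b. b \<in> B d \<Longrightarrow> coeff (f d b) d = b"
    by metis
  define G where "G = (\<Union>d\<le>N. (\<lambda>b. poly (f d b) a) ` B d)"
  show "fin_gen (adjoin R a) I"
    unfolding fin_gen_def
  proof (intro exI[of _ G] conjI allI impI)
    show "finite G" unfolding G_def using B(1) by auto
    show "G \<subseteq> I" using f(1) by (auto simp: G_def P_def)
    fix J0 assume "ideal_on (adjoin R a) J0" and "G \<subseteq> J0"
    \<comment> \<open>Intersecting with \<open>I\<close> keeps the correction \<open>q'\<close>
      inside \<open>P I\<close>, so that the induction on the degree applies to
      \<open>p - q'\<close>.\<close>
    define J where "J = I \<inter> J0"
    have J: "ideal_on (adjoin R a) J" and GJ: "G \<subseteq> J"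
      using I \<open>ideal_on (adjoin R a) J0\<close> \<open>G \<subseteq> J0\<close> \<open>G \<subseteq> I\<close> by (auto simp: J_def ideal_on_def)
    have LJ: "L I d \<subseteq> L J d" if "d \<le> N" for d
    proof (rule B(3)[OF L_ideal[OF J]])
      show "B d \<subseteq> L J d"
      proof
        fix b assume b: "b \<in> B d"
        then have "f d b \<in> P J" using f(1)[OF b] GJ that by (auto simp: P_def G_def)
        then show "b \<in> L J d" using f(2,3)[OF b] by (auto simp: L_def intro!: exI[of _ "f d b"])
      qed
    qed
    have "poly p a \<in> J" if "p \<in> P I" for p
      using that
    proof (induction "Polynomial.degree p" arbitrary: p rule: less_induct)
      case less
      let ?d = "Polynomial.degree p"
      \<comment> \<open>Beyond \<open>N\<close> no new leading coefficients arise: a match is found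
        in degree \<open>N\<close> and shifted up to degree \<open>?d\<close> by a monomial.\<close>
      define e where "e = min ?d N"
      have "lead_coeff p \<in> L I ?d" unfolding L_def using less.prems by blast
      then have "lead_coeff p \<in> L I e" using LN[of ?d] by (auto simp: e_def min_def)
      then have "lead_coeff p \<in> L J e" using LJ[of e] by (auto simp: e_def)
      then obtain q where q: "q \<in> P J" "Polynomial.degree q \<le> e" "coeff q e = lead_coeff p"
        by (auto simp: L_def)
      define q' where "q' = Polynomial.monom 1 (?d - e) * q"
      have q': "q' \<in> P J" unfolding q'_def by (rule P_monom[OF q(1) q(1) J])
      have "Polynomial.degree q' \<le> ?d"
        using degree_mult_le[of "Polynomial.monom 1 (?d - e)" q] degree_monom_le[of "1::'a" "?d - e"] q(2)
        unfolding q'_def e_def by linarith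
      then have "Polynomial.degree (p - q') \<le> ?d" by (intro degree_diff_le) auto
      moreover have "coeff (p - q') ?d = 0"
        using q(3) by (simp add: q'_def coeff_monom_mult e_def)
      ultimately have cases: "p - q' = 0 \<or> Polynomial.degree (p - q') < ?d"
        by (metis leading_coeff_0_iff nat_less_le)
      have "p - q' \<in> P I"
        using less.prems q' ideal_on_diff[OF I T] by (auto simp: P_def J_def po)
      with cases have "poly (p - q') a \<in> J"
        using less.hyps[of "p - q'"] ideal_onD(2)[OF J] by (auto simp del: poly_diff)
      then have "poly (p - q') a + poly q' a \<in> J"
        using q' by (intro ideal_onD(3)[OF J]) (auto simp: P_def)
      then show ?case by simp
    qed
    moreover have "x \<in> I \<Longrightarrow> \<exists>p\<in>P I. x = poly p a" for x
      using ideal_onD(1)[OF I] by (auto simp: P_def elim!: adjoinE[OF R])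
    ultimately show "I \<subseteq> J0" unfolding J_def by blast
  qed
qed

lemma noetherian_on_adjoin_list:
  "subring_on R \<Longrightarrow> noetherian_on R \<Longrightarrow> noetherian_on (adjoin_list R as)"
  by (induction as) (auto intro: noetherian_on_adjoin subring_on_adjoin_list)


section \<open>The weak Nullstellensatz\<close>

definition poly_zero_mod :: "'a::comm_ring_1 set \<Rightarrow> 'a poly \<Rightarrow> bool" where
  "poly_zero_mod Q p \<longleftrightarrow> (\<forall>i. coeff p i \<in> Q)"

text \<open>For prime \<open>Q\<close> the image of \<open>a\<close> is algebraic over the image of
  \<open>R\<close>. The negation is used for arbitrary ideals, where it says that \<open>a\<close>
  behaves modulo \<open>Q\<close> like a free variable over \<open>R\<close>.\<close>

definition algebraic_mod :: "'a::comm_ring_1 set \<Rightarrow> 'a set \<Rightarrow> 'a \<Rightarrow> bool" where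
  "algebraic_mod Q R a \<longleftrightarrow> (\<exists>p\<in>polys_over R. poly p a \<in> Q \<and> \<not> poly_zero_mod Q p)"

text \<open>For a prime ideal \<open>Q\<close> this says that the image \<open>R'\<close> of \<open>R\<close> modulo \<open>Q\<close> is a Goldman domain:
  its fraction field is \<open>R'[1/t]\<close> for some \<open>t\<close>.\<close>

definition goldman_mod :: "'a::comm_ring_1 set \<Rightarrow> 'a set \<Rightarrow> bool" where
  "goldman_mod Q R \<longleftrightarrow>
     (\<exists>t\<in>R - Q. \<forall>s\<in>R - Q. \<exists>N. \<exists>u\<in>R. s * u - t ^ N \<in> Q)"

text \<open>Discarding the coefficients in \<open>Q\<close> replaces polynomials over the quotient
  ring: the degree of the result is the degree modulo \<open>Q\<close>.\<close>

definition reduce_mod :: "'a::comm_ring_1 set \<Rightarrow> 'a poly \<Rightarrow> 'a poly" where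
  "reduce_mod Q p = map_poly (\<lambda>c. if c \<in> Q then 0 else c) p"

context
  fixes Q :: "'a::comm_ring_1 set"
  assumes idealQ: "is_ideal Q"
begin

lemma poly_zero_mod_imp_poly: "poly_zero_mod Q p \<Longrightarrow> poly p a \<in> Q"
  unfolding poly_altdef poly_zero_mod_def
  by (intro is_ideal_sum[OF idealQ] is_idealD(4)[OF idealQ]) auto

lemma poly_zero_mod_add: "poly_zero_mod Q p \<Longrightarrow> poly_zero_mod Q q \<Longrightarrow> poly_zero_mod Q (p + q)"
  by (simp add: poly_zero_mod_def is_idealD idealQ)

lemma poly_zero_mod_diff: "poly_zero_mod Q p \<Longrightarrow> poly_zero_mod Q q \<Longrightarrow> poly_zero_mod Q (p - q)"
  by (simp add: poly_zero_mod_def is_idealD idealQ)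

lemma poly_zero_mod_mult: "poly_zero_mod Q p \<Longrightarrow> poly_zero_mod Q (p * q)"
  by (auto simp: poly_zero_mod_def coeff_mult intro!: is_ideal_sum[OF idealQ] is_idealD(4)[OF idealQ])

lemma coeff_reduce_mod: "coeff (reduce_mod Q p) i = (if coeff p i \<in> Q then 0 else coeff p i)"
  by (simp add: reduce_mod_def coeff_map_poly is_idealD idealQ)

lemma poly_zero_mod_reduce: "poly_zero_mod Q (p - reduce_mod Q p)"
  by (auto simp: poly_zero_mod_def coeff_reduce_mod is_idealD idealQ)

lemma degree_reduce_mod: "Polynomial.degree (reduce_mod Q p) \<le> Polynomial.degree p"
  by (rule degree_le) (auto simp: coeff_reduce_mod coeff_eq_0)

lemma reduce_mod_over: "subring_on R \<Longrightarrow> p \<in> polys_over R \<Longrightarrow> reduce_mod Q p \<in> polys_over R"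
  by (auto simp: polys_over_def coeff_reduce_mod subring_onD)

lemma lead_coeff_reduce_mod:
  assumes "\<not> poly_zero_mod Q p"
  shows "lead_coeff (reduce_mod Q p) \<notin> Q"
proof -
  obtain i where "coeff p i \<notin> Q" using assms by (auto simp: poly_zero_mod_def)
  then have "coeff (reduce_mod Q p) i \<noteq> 0"
    using is_idealD(1)[OF idealQ] by (auto simp: coeff_reduce_mod)
  then have "lead_coeff (reduce_mod Q p) \<noteq> 0" by auto
  then show ?thesis by (auto simp: coeff_reduce_mod split: if_splits)
qed

lemma poly_reduce_mod: "poly (reduce_mod Q p) a \<in> Q \<longleftrightarrow> poly p a \<in> Q"
  using is_ideal_cong[OF idealQ, of "poly p a" "poly (reduce_mod Q p) a"]
    poly_zero_mod_imp_poly[OF poly_zero_mod_reduce, of p a] by simp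

lemma poly_zero_mod_cong:
  assumes "poly_zero_mod Q (p - q)"
  shows "poly_zero_mod Q p \<longleftrightarrow> poly_zero_mod Q q"
  using poly_zero_mod_add[OF assms, of q] poly_zero_mod_diff[OF _ assms, of p] by auto

text \<open>The top coefficient of \<open>q\<close> times the reduced \<open>p\<close> is the
  product of the two leading coefficients. Modulo a non-prime \<open>Q\<close> such a product could
  vanish; the unit prevents this.\<close>

lemma poly_zero_mod_mult_unit:
  assumes "poly_zero_mod Q (q * p)" "u * lead_coeff q = 1"
  shows "poly_zero_mod Q p"
proof (rule ccontr)
  assume not: "\<not> poly_zero_mod Q p"
  let ?p = "reduce_mod Q p"
  have "poly_zero_mod Q ((p - ?p) * q)" by (intro poly_zero_mod_mult poly_zero_mod_reduce)
  then have "poly_zero_mod Q (q * p - q * ?p)" by (simp add: algebra_simps)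
  with assms(1) have "poly_zero_mod Q (q * ?p)" using poly_zero_mod_cong by blast
  then have "coeff (q * ?p) (Polynomial.degree q + Polynomial.degree ?p) \<in> Q"
    unfolding poly_zero_mod_def by blast
  then have "u * (lead_coeff q * lead_coeff ?p) \<in> Q"
    unfolding coeff_mult_degree_sum by (rule is_idealD(3)[OF idealQ])
  then have "lead_coeff ?p \<in> Q" using assms(2) by (simp flip: mult.assoc)
  then show False using lead_coeff_reduce_mod[OF not] by blast
qed

end

context
  fixes Q :: "'a::comm_ring_1 set"
  assumes Q: "is_prime Q"
begin

private lemmas idealQ = is_primeD(1)[OF Q]


text \<open>Degrees add modulo a prime ideal; the index is the degree of the product modulo
  \<open>Q\<close>.\<close>

lemma coeff_mult_top:
  assumes "\<not> poly_zero_mod Q f" "\<not> poly_zero_mod Q g"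
  shows "coeff (f * g) (Polynomial.degree (reduce_mod Q f) + Polynomial.degree (reduce_mod Q g)) \<notin> Q"
    (is "coeff _ ?n \<notin> Q")
proof -
  let ?f = "reduce_mod Q f" and ?g = "reduce_mod Q g"
  have "poly_zero_mod Q ((f - ?f) * g + (g - ?g) * ?f)"
    by (intro poly_zero_mod_add[OF idealQ] poly_zero_mod_mult[OF idealQ] poly_zero_mod_reduce[OF idealQ])
  also have "(f - ?f) * g + (g - ?g) * ?f = f * g - ?f * ?g" by (simp add: algebra_simps)
  finally have "coeff (f * g) ?n - coeff (?f * ?g) ?n \<in> Q" by (auto simp: poly_zero_mod_def)
  moreover have "coeff (?f * ?g) ?n \<notin> Q"
    using is_primeD(3)[OF Q] lead_coeff_reduce_mod[OF idealQ, OF assms(1)] lead_coeff_reduce_mod[OF idealQ, OF assms(2)]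
    unfolding coeff_mult_degree_sum by blast
  ultimately show ?thesis using is_ideal_cong[OF idealQ] by blast
qed

text \<open>Suppose that \<open>a\<close> is free modulo \<open>Q\<close>, let t = q(a), and put f =
  1 + X q. By the Goldman property f divides a power q^N modulo \<open>Q\<close>, yet X^N q^N = (f -
  1)^N is congruent to (-1)^N modulo f. So f is a unit modulo \<open>Q\<close>, although its degree
  there is positive.\<close>

lemma goldman_adjoin_imp_algebraic:
  assumes R: "subring_on R" and G: "goldman_mod Q (adjoin R a)"
  shows "algebraic_mod Q R a"
proof (rule ccontr)
  assume not: "\<not> algebraic_mod Q R a"
  have trans: "poly_zero_mod Q p" if "p \<in> polys_over R" "poly p a \<in> Q" for p
    using not that by (auto simp: algebraic_mod_def)
  note po = polys_over_intros[OF R] polys_over_power[OF R] subring_onD[OF R]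
  obtain t where t: "t \<in> adjoin R a" "t \<notin> Q"
    "\<And>s. s \<in> adjoin R a \<Longrightarrow> s \<notin> Q \<Longrightarrow> \<exists>N. \<exists>u\<in>adjoin R a. s * u - t ^ N \<in> Q"
    using G unfolding goldman_mod_def by blast
  obtain q where q: "q \<in> polys_over R" "t = poly q a" using t(1) by (rule adjoinE[OF R])
  define f where "f = pCons 1 q"
  have f: "f \<in> polys_over R" unfolding f_def using q by (intro po)
  have "coeff f 0 \<notin> Q" using is_primeD(2)[OF Q] by (simp add: f_def)
  then have nzf: "\<not> poly_zero_mod Q f" by (auto simp: poly_zero_mod_def)
  then have "poly f a \<notin> Q" using trans[OF f] by blast
  then obtain N u where u: "u \<in> adjoin R a" "poly f a * u - t ^ N \<in> Q"
    using t(3) poly_in_adjoin[OF R f] by blast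
  obtain w where w: "w \<in> polys_over R" "u = poly w a" using u(1) by (rule adjoinE[OF R])
  have "poly_zero_mod Q (f * w - q ^ N)"
    using u(2) by (intro trans po f w q) (simp add: w q poly_power)
  then have 1: "poly_zero_mod Q ((f * w - q ^ N) * [:0, 1:] ^ N)" by (rule poly_zero_mod_mult[OF idealQ])
  have "f - 1 = [:0, 1:] * q" by (simp add: f_def one_pCons)
  then have "(f * w - q ^ N) * [:0, 1:] ^ N = f * (w * [:0, 1:] ^ N) - (f - 1) ^ N"
    by (simp only: left_diff_distrib power_mult_distrib) (simp add: mult.assoc mult.commute mult.left_commute)
  moreover have "f dvd (f - 1) ^ N - (- 1) ^ N"
  proof -
    have "(f - 1) - (- 1) dvd (f - 1) ^ N - (- 1) ^ N"
      unfolding power_diff_sumr2 by (rule dvd_triv_left)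
    then show ?thesis by simp
  qed
  then obtain g where "(f - 1) ^ N - (- 1) ^ N = f * g" by (rule dvdE)
  ultimately have "(f * w - q ^ N) * [:0, 1:] ^ N = f * (w * [:0, 1:] ^ N - g) - (- 1) ^ N"
    by (simp add: algebra_simps)
  with 1 have "poly_zero_mod Q (((f * (w * [:0, 1:] ^ N - g)) - (- 1) ^ N) * (- 1) ^ N)"
    using poly_zero_mod_mult[OF idealQ] by metis
  \<comment> \<open>\<open>z\<close> is the inverse of \<open>f\<close> modulo
    \<open>Q\<close>.\<close>
  moreover define z where "z = (w * [:0, 1:] ^ N - g) * (- 1) ^ N"
  moreover have "(f * y - (- 1) ^ N) * (- 1) ^ N = f * (y * (- 1) ^ N) - 1" for y
    by (simp only: left_diff_distrib mult.assoc power_mult_distrib[symmetric]) simp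
  ultimately have 2: "poly_zero_mod Q (f * z - 1)" by simp
  have nzz: "\<not> poly_zero_mod Q z"
  proof
    assume "poly_zero_mod Q z"
    then have "poly_zero_mod Q (z * f - (f * z - 1))"
      by (intro poly_zero_mod_diff[OF idealQ] poly_zero_mod_mult[OF idealQ] 2)
    then have "poly_zero_mod Q 1" by (simp add: mult.commute)
    then have "coeff 1 0 \<in> Q" unfolding poly_zero_mod_def by blast
    then show False using is_primeD(2)[OF Q] by simp
  qed
  define n where "n = Polynomial.degree (reduce_mod Q f) + Polynomial.degree (reduce_mod Q z)"
  \<comment> \<open>As t = q(a) is outside \<open>Q\<close>, the term X q of \<open>f\<close> is
    nonzero modulo \<open>Q\<close>, so the degree of \<open>f\<close> is positive.\<close>
  have "\<not> poly_zero_mod Q q" using poly_zero_mod_imp_poly[OF idealQ] t(2) q(2) by blast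
  then obtain i where "coeff q i \<notin> Q" by (auto simp: poly_zero_mod_def)
  then have "coeff (reduce_mod Q f) (Suc i) \<noteq> 0"
    using is_idealD(1)[OF idealQ] by (auto simp: coeff_reduce_mod[OF idealQ] f_def)
  then have "Suc i \<le> Polynomial.degree (reduce_mod Q f)" by (rule le_degree)
  then have "n \<noteq> 0" by (simp add: n_def)
  then have "coeff (f * z) n \<in> Q"
    using 2[unfolded poly_zero_mod_def, rule_format, of n] by simp
  moreover have "coeff (f * z) n \<notin> Q"
    unfolding n_def by (rule coeff_mult_top[OF nzf nzz])
  ultimately show False by blast
qed

text \<open>Take a relation \<open>f\<close> for \<open>a\<close> of least degree \<open>M\<close>,
  with leading coefficient \<open>c\<close>. Up to powers of \<open>c\<close>, every element of the
  adjoined ring is congruent to a polynomial in \<open>a\<close> of degree below \<open>M\<close>,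
  where coefficients can be compared. Some multiple of \<open>t\<close> is congruent to an element
  \<open>r0\<close> of \<open>R\<close>, a substitute for a norm, and \<open>c * r0\<close>
  witnesses the Goldman property of \<open>R\<close>.\<close>

lemma goldman_adjoin_imp_goldman:
  assumes R: "subring_on R" and G: "goldman_mod Q (adjoin R a)"
  shows "goldman_mod Q R"
proof -
  note po = polys_over_intros[OF R] polys_over_power[OF R]
  have RT: "r \<in> R \<Longrightarrow> r \<in> adjoin R a" for r using adjoin_superset[OF R] by blast
  note T = subring_on_adjoin[OF R, of a]
  obtain t where t: "t \<in> adjoin R a" "t \<notin> Q"
    "\<And>s. s \<in> adjoin R a \<Longrightarrow> s \<notin> Q \<Longrightarrow> \<exists>N. \<exists>u\<in>adjoin R a. s * u - t ^ N \<in> Q"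
    using G unfolding goldman_mod_def by blast
  define A where "A = {p \<in> polys_over R. poly p a \<in> Q \<and> lead_coeff p \<notin> Q}"
  have "A \<noteq> {}"
    using goldman_adjoin_imp_algebraic[OF R G] unfolding A_def algebraic_mod_def
    using reduce_mod_over[OF idealQ, OF R] poly_reduce_mod[OF idealQ] lead_coeff_reduce_mod[OF idealQ] by blast
  then obtain f where f: "f \<in> A" "\<And>p. p \<in> A \<Longrightarrow> Polynomial.degree f \<le> Polynomial.degree p"
    using arg_min_nat_lemma[of "\<lambda>p. p \<in> A" _ Polynomial.degree] by auto
  define M where "M = Polynomial.degree f"
  define c where "c = lead_coeff f"
  have fA: "f \<in> polys_over R" "poly f a \<in> Q" "c \<notin> Q" "c \<in> R"
    using f(1) by (auto simp: A_def c_def polys_over_def)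
  \<comment> \<open>By minimality of \<open>M\<close>, a polynomial of degree below \<open>M\<close>
    is determined modulo \<open>Q\<close> by its value at \<open>a\<close>.\<close>
  have indep: "poly_zero_mod Q p" if "p \<in> polys_over R" "poly p a \<in> Q" "Polynomial.degree p < M" for p
  proof (rule ccontr)
    assume "\<not> poly_zero_mod Q p"
    then have "reduce_mod Q p \<in> A"
      using that by (auto simp: A_def reduce_mod_over[OF idealQ, OF R] poly_reduce_mod[OF idealQ] lead_coeff_reduce_mod[OF idealQ])
    then show False using f(2) degree_reduce_mod[OF idealQ, of p] that(3) unfolding M_def by fastforce
  qed
  have M: "0 < M"
  proof (rule ccontr)
    assume "\<not> 0 < M"
    then have "f = [:c:]" by (auto simp: M_def c_def elim: degree_eq_zeroE)
    then have "poly f a = c" by simp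
    then show False using fA by simp
  qed
  have divf: "\<exists>k. \<exists>r\<in>polys_over R. c ^ k * x - poly r a \<in> Q \<and> Polynomial.degree r < M"
    if x: "x \<in> adjoin R a" for x
  proof -
    obtain q where q: "q \<in> polys_over R" "x = poly q a" using x by (rule adjoinE[OF R])
    obtain k q' r where *: "smult (c ^ k) q = f * q' + r" "r \<in> polys_over R" "Polynomial.degree r < M"
      using pseudo_division[OF R fA(1) _ q(1)] M unfolding c_def M_def by blast
    have "c ^ k * x - poly r a = poly f a * poly q' a"
      using arg_cong[OF *(1), of "\<lambda>p. poly p a"] by (simp add: q)
    then show ?thesis using * fA(2) is_idealD(4)[OF idealQ] by metis
  qed
  \<comment> \<open>some multiple of \<open>t\<close> is congruent to an element of \<open>R\<close>\<close>
  define B where "B = {h \<in> polys_over R. Polynomial.degree h < M \<and> lead_coeff h \<notin> Q \<and>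
    (\<exists>v\<in>adjoin R a. v * t - poly h a \<in> Q)}"
  have inB: "reduce_mod Q h \<in> B" if h: "h \<in> polys_over R" "Polynomial.degree h < M"
      "v \<in> adjoin R a" "v * t - poly h a \<in> Q" "\<not> poly_zero_mod Q h" for h v
  proof -
    have "poly h a - poly (reduce_mod Q h) a \<in> Q"
      using poly_zero_mod_imp_poly[OF idealQ, OF poly_zero_mod_reduce[OF idealQ], of h a] by simp
    from is_idealD(2)[OF idealQ h(4) this] have "v * t - poly (reduce_mod Q h) a \<in> Q" by simp
    then show ?thesis
      using h degree_reduce_mod[OF idealQ, of h] unfolding B_def
      by (auto simp: reduce_mod_over[OF idealQ, OF R] lead_coeff_reduce_mod[OF idealQ] intro: le_less_trans)
  qed
  have "B \<noteq> {}"
  proof -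
    obtain k r where *: "r \<in> polys_over R" "c ^ k * t - poly r a \<in> Q" "Polynomial.degree r < M"
      using divf[OF t(1)] by blast
    have "c ^ k * t \<notin> Q" using fA(3) t(2) is_prime_power[OF Q] is_primeD(3)[OF Q] by blast
    then have "poly r a \<notin> Q" using is_ideal_cong[OF idealQ *(2)] by blast
    then have "\<not> poly_zero_mod Q r" using poly_zero_mod_imp_poly[OF idealQ] by blast
    then show ?thesis
      using inB[OF *(1,3) _ *(2)] RT[OF subring_on_power[OF R fA(4)]] by blast
  qed
  then obtain h where h: "h \<in> B" "\<And>p. p \<in> B \<Longrightarrow> Polynomial.degree h \<le> Polynomial.degree p"
    using arg_min_nat_lemma[of "\<lambda>p. p \<in> B" _ Polynomial.degree] by auto
  obtain v where v: "v \<in> adjoin R a" "v * t - poly h a \<in> Q" using h(1) by (auto simp: B_def)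
  have hB: "h \<in> polys_over R" "Polynomial.degree h < M" "lead_coeff h \<notin> Q" using h(1) by (auto simp: B_def)
  have nzh: "\<not> poly_zero_mod Q h" using hB(3) by (auto simp: poly_zero_mod_def)
  \<comment> \<open>Divide \<open>f\<close> by \<open>h\<close>. A remainder nonzero modulo
    \<open>Q\<close> would, once reduced, be an element of \<open>B\<close> of smaller degree.
    Otherwise h(a) q(a) lies in \<open>Q\<close>, minimality of \<open>M\<close> makes the quotient
    q zero modulo \<open>Q\<close>, and then \<open>smult (lead_coeff h ^ k) f\<close> would be zero
    modulo \<open>Q\<close> too.\<close>
  have deg0: "Polynomial.degree h = 0"
  proof (rule ccontr)
    assume "Polynomial.degree h \<noteq> 0"
    then have "0 < Polynomial.degree h" by simp
    from pseudo_division[OF R hB(1) this fA(1)] obtain k q r where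
      *: "smult (lead_coeff h ^ k) f = h * q + r" "q \<in> polys_over R" "r \<in> polys_over R"
        "Polynomial.degree r < Polynomial.degree h" "Polynomial.degree q \<le> Polynomial.degree f - Polynomial.degree h"
      by blast
    have "lead_coeff h ^ k * c \<notin> Q"
      using hB(3) fA(3) is_prime_power[OF Q] is_primeD(3)[OF Q] by blast
    moreover have "coeff (smult (lead_coeff h ^ k) f) M = lead_coeff h ^ k * c"
      by (simp add: M_def c_def)
    ultimately have nz: "\<not> poly_zero_mod Q (h * q + r)"
      unfolding *(1)[symmetric] poly_zero_mod_def by metis
    have val: "poly h a * poly q a + poly r a \<in> Q"
      using arg_cong[OF *(1), of "\<lambda>p. poly p a"] is_idealD(3)[OF idealQ fA(2), of "lead_coeff h ^ k"]
      by simp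
    have "poly_zero_mod Q r"
    proof (rule ccontr)
      assume nzr: "\<not> poly_zero_mod Q r"
      have "(- v * poly q a) * t - poly r a = - poly q a * (v * t - poly h a) - (poly h a * poly q a + poly r a)"
        by (simp add: algebra_simps)
      also have "\<dots> \<in> Q"
        by (rule is_idealD(5)[OF idealQ is_idealD(3)[OF idealQ v(2)] val])
      finally have "reduce_mod Q r \<in> B"
        using *(3,4) hB(2) nzr v(1) poly_in_adjoin[OF R *(2)] subring_onD[OF T]
        by (intro inB[of r "- v * poly q a"]) auto
      then show False using h(2) degree_reduce_mod[OF idealQ, of r] *(4) by fastforce
    qed
    moreover from this have "poly h a * poly q a \<in> Q"
      using val poly_zero_mod_imp_poly[OF idealQ] is_ideal_add_left[OF idealQ] by blast
    then have "poly q a \<in> Q"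
      using is_primeD(3)[OF Q] indep[OF hB(1)] hB(2) nzh by blast
    then have "poly_zero_mod Q q"
      using *(5) \<open>Polynomial.degree h \<noteq> 0\<close> hB(2) by (intro indep[OF *(2)]) (auto simp: M_def)
    then have "poly_zero_mod Q (h * q)" using poly_zero_mod_mult[OF idealQ, of q h] by (simp add: mult.commute)
    ultimately show False using nz poly_zero_mod_add[OF idealQ] by blast
  qed
  define r0 where "r0 = coeff h 0"
  have r0: "r0 \<in> R" "r0 \<notin> Q" "v * t - r0 \<in> Q"
  proof -
    have "h = [:r0:]" using deg0 by (auto simp: r0_def elim: degree_eq_zeroE)
    then show "v * t - r0 \<in> Q" using v(2) by simp
  qed (use hB deg0 in \<open>auto simp: r0_def polys_over_def\<close>)
  have cr: "c * r0 \<in> R - Q"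
    using r0 fA(3,4) is_primeD(3)[OF Q] subring_onD(5)[OF R] by auto
  have "\<exists>N. \<exists>u\<in>R. s * u - (c * r0) ^ N \<in> Q" if s: "s \<in> R" "s \<notin> Q" for s
  proof -
    obtain N u where u: "u \<in> adjoin R a" "s * u - t ^ N \<in> Q" using t(3)[OF RT[OF s(1)] s(2)] by blast
    have "u * v ^ N \<in> adjoin R a" using u v subring_onD(5)[OF T] subring_on_power[OF T] by blast
    from divf[OF this] obtain k r where r: "r \<in> polys_over R" "c ^ k * (u * v ^ N) - poly r a \<in> Q"
      "Polynomial.degree r < M" by blast
    have 1: "(v * t) ^ N - r0 ^ N \<in> Q" by (rule is_ideal_cong_power[OF idealQ r0(3)])
    \<comment> \<open>Its degree is below \<open>M\<close> and its value at \<open>a\<close> lies in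
      \<open>Q\<close>, hence so does its constant coefficient: this brings the relation for
      \<open>s\<close> down to \<open>R\<close>.\<close>
    let ?p = "smult s r - [:c ^ k * r0 ^ N:]"
    have "poly ?p a = c ^ k * ((v * t) ^ N - r0 ^ N) + (c ^ k * v ^ N) * (s * u - t ^ N)
        - s * (c ^ k * (u * v ^ N) - poly r a)"
      by (simp add: algebra_simps)
    also have "\<dots> \<in> Q"
      by (rule is_idealD(5)[OF idealQ is_idealD(2)[OF idealQ is_idealD(3)[OF idealQ 1]
        is_idealD(3)[OF idealQ u(2)]] is_idealD(3)[OF idealQ r(2)]])
    finally have "poly_zero_mod Q ?p"
      using r s fA(4) r0(1) M
      by (intro indep) (auto intro!: po subring_onD[OF R] subring_on_power[OF R]
          intro: degree_diff_less le_less_trans[OF degree_smult_le])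
    then have "coeff ?p 0 \<in> Q" unfolding poly_zero_mod_def by blast
    then have 2: "s * coeff r 0 - c ^ k * r0 ^ N \<in> Q" by simp
    \<comment> \<open>The factor \<open>c ^ N * r0 ^ k\<close> balances the exponents, so that a
      power of \<open>c * r0\<close> appears.\<close>
    have "s * (coeff r 0 * (c ^ N * r0 ^ k)) - (c * r0) ^ (k + N) =
        (s * coeff r 0 - c ^ k * r0 ^ N) * (c ^ N * r0 ^ k)"
      by (simp add: algebra_simps power_add power_mult_distrib)
    also have "\<dots> \<in> Q" by (rule is_idealD(4)[OF idealQ 2])
    finally have "s * (coeff r 0 * (c ^ N * r0 ^ k)) - (c * r0) ^ (k + N) \<in> Q" .
    moreover have "coeff r 0 * (c ^ N * r0 ^ k) \<in> R"
      using r(1) fA(4) r0(1) by (intro subring_onD(5)[OF R] subring_on_power[OF R]) (auto simp: polys_over_def)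
    ultimately show ?thesis by blast
  qed
  then show ?thesis unfolding goldman_mod_def using cr by blast
qed

lemma goldman_adjoin_list:
  "subring_on R \<Longrightarrow> goldman_mod Q (adjoin_list R as) \<Longrightarrow> goldman_mod Q R"
  by (induction as) (auto dest: goldman_adjoin_imp_goldman[OF subring_on_adjoin_list])

text \<open>Since \<open>a\<close> is adjoined first, descent strips the other generators and leaves
  the Goldman property for \<open>adjoin R a\<close>.\<close>

lemma goldman_imp_algebraic:
  assumes "subring_on R" "goldman_mod Q (adjoin_list R (as @ [a]))"
  shows "algebraic_mod Q R a"
  using goldman_adjoin_imp_algebraic[OF assms(1)] goldman_adjoin_list[OF subring_on_adjoin[OF assms(1)]]
    assms(2) by (simp add: adjoin_list_append)

end

section \<open>Monomials and the face ideal\<close>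

abbreviation (input) mkeys :: "'k::field mpoly \<Rightarrow> (nat \<Rightarrow>\<^sub>0 nat) set" where
  "mkeys \<equiv> Poly_Mapping.keys"

abbreviation (input) vars :: "(nat \<Rightarrow>\<^sub>0 nat) \<Rightarrow> nat set" where
  "vars \<equiv> Poly_Mapping.keys"

abbreviation (input) term_of :: "(nat \<Rightarrow>\<^sub>0 nat) \<Rightarrow> 'k \<Rightarrow> 'k::field mpoly" where
  "term_of \<equiv> Poly_Mapping.single"

text \<open>All variables outside the vertex set are killed as well, so that the quotient of the full
  polynomial ring by this ideal is the Stanley--Reisner ring.\<close>

definition face_ideal :: "nat set set \<Rightarrow> 'k::field mpoly set" where
  "face_ideal \<Delta> = {f. \<forall>m\<in>Poly_Mapping.keys f. Poly_Mapping.keys m \<notin> \<Delta>}"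

text \<open>No vertex is required to be a face: stars and deletions lose vertices.\<close>

definition down_closed :: "nat set set \<Rightarrow> bool" where
  "down_closed \<Delta> \<longleftrightarrow> (\<forall>F\<in>\<Delta>. \<forall>G. G \<subseteq> F \<longrightarrow> G \<in> \<Delta>)"

lemma vars_add: "vars (m + m') = vars m \<union> vars m'"
  by (auto simp: in_keys_iff lookup_add)

lemma mpoly_sum_monomials: "f = (\<Sum>m\<in>mkeys f. term_of m (Poly_Mapping.lookup f m))"
  by (rule poly_mapping_eqI)
    (auto simp: lookup_sum lookup_single when_def in_keys_iff)

lemma mpoly_induct [case_names zero add single]:
  fixes f :: "'k::field mpoly"
  assumes "P 0" "\<And>f g. P f \<Longrightarrow> P g \<Longrightarrow> P (f + g)" "\<And>m c. m \<in> mkeys f \<Longrightarrow> P (term_of m c)"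
  shows "P f"
proof -
  have "P (\<Sum>m\<in>A. term_of m (Poly_Mapping.lookup f m))" if "finite A" "A \<subseteq> mkeys f" for A
    using that by (induction A rule: finite_induct) (auto intro: assms)
  from this[of "mkeys f"] show ?thesis using mpoly_sum_monomials[of f] by simp
qed

lemma is_ideal_mem_monomials:
  assumes "is_ideal L" "\<And>m c. m \<in> mkeys f \<Longrightarrow> term_of m c \<in> L"
  shows "f \<in> L"
  by (induction f rule: mpoly_induct) (use assms in \<open>auto simp: is_idealD\<close>)

lemma mkeys_multE:
  fixes f g :: "'k::field mpoly"
  assumes "m \<in> mkeys (f * g)"
  obtains a b where "m = a + b" "a \<in> mkeys f" "b \<in> mkeys g"
  using assms keys_mult[of f g] by auto

lemma mkeys_plusE:
  fixes f g :: "'k::field mpoly"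
  assumes "m \<in> mkeys (f + g)"
  shows "m \<in> mkeys f \<or> m \<in> mkeys g"
  using assms Poly_Mapping.keys_add[of f g] by auto

lemma is_ideal_face_ideal:
  assumes "down_closed \<Delta>"
  shows "is_ideal (face_ideal \<Delta> :: 'k::field mpoly set)"
  unfolding ideal_on_def
proof (intro conjI ballI subset_UNIV)
  show "(0 :: 'k mpoly) \<in> face_ideal \<Delta>" by (simp add: face_ideal_def)
next
  fix f g :: "'k mpoly" assume "f \<in> face_ideal \<Delta>" "g \<in> face_ideal \<Delta>"
  then show "f + g \<in> face_ideal \<Delta>" unfolding face_ideal_def using mkeys_plusE by blast
next
  fix f g :: "'k mpoly" assume g: "g \<in> face_ideal \<Delta>"
  show "f * g \<in> face_ideal \<Delta>"
    unfolding face_ideal_def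
  proof (safe elim!: mkeys_multE)
    fix a b assume "b \<in> mkeys g" "vars (a + b) \<in> \<Delta>"
    then have "vars b \<in> \<Delta>" using assms unfolding down_closed_def vars_add by blast
    then show False using g \<open>b \<in> mkeys g\<close> by (auto simp: face_ideal_def)
  qed
qed

lemma lookup_mult_term:
  "Poly_Mapping.lookup (f * term_of e c) (m + e) = Poly_Mapping.lookup f m * (c :: 'k::field)"
proof (induction f rule: mpoly_induct)
  case (add f g)
  then show ?case by (simp add: distrib_right lookup_add)
next
  case (single m' c')
  show ?case by (auto simp: mult_single lookup_single when_def)
qed auto

lemma term_add_mult: "term_of (m + m') (c :: 'k::field) = term_of m c * term_of m' 1"
  by (simp add: mult_single)

lemma term_power: "term_of m (c :: 'k::field) ^ i = term_of (of_nat i * m) (c ^ i)"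
  by (induction i) (auto simp: mult_single algebra_simps)

text \<open>Multiplication by the variable shifts monomials injectively and adds \<open>v\<close> to
  their support. The resulting complex is the star of \<open>v\<close>, the cone with apex
  \<open>v\<close> over its link.\<close>

lemma colon_face_ideal:
  "colon (face_ideal \<Delta>) (Var v :: 'k::field mpoly) = face_ideal {F. insert v F \<in> \<Delta>}"
proof -
  define e where "e = Poly_Mapping.single v (1::nat)"
  have ve: "vars (m + e) = insert v (vars m)" for m by (simp add: vars_add e_def)
  have "f * term_of e 1 \<in> face_ideal \<Delta> \<longleftrightarrow> f \<in> face_ideal {F. insert v F \<in> \<Delta>}" for f :: "'k mpoly"
  proof -
    have "m + e \<in> mkeys (f * term_of e 1) \<longleftrightarrow> m \<in> mkeys f" for m
      by (simp add: in_keys_iff lookup_mult_term)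
    moreover have "\<exists>m'\<in>mkeys f. m = m' + e" if "m \<in> mkeys (f * term_of e 1)" for m
      using that by (auto elim!: mkeys_multE split: if_splits)
    ultimately have "mkeys (f * term_of e 1) = (\<lambda>m. m + e) ` mkeys f" by blast
    then show ?thesis by (simp add: face_ideal_def ve)
  qed
  then show ?thesis by (auto simp: colon_def Var_def e_def mult.commute)
qed

lemma face_ideal_mono: "\<Delta>' \<subseteq> \<Delta> \<Longrightarrow> face_ideal \<Delta> \<subseteq> face_ideal \<Delta>'"
  by (auto simp: face_ideal_def)

lemma Var_in_face_ideal: "{v} \<notin> \<Delta> \<Longrightarrow> (Var v :: 'k::field mpoly) \<in> face_ideal \<Delta>"
  by (simp add: face_ideal_def Var_def)

lemma term_in_ideal_Var:
  assumes "is_ideal L" "Var v \<in> L" "v \<in> vars m"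
  shows "term_of m (c :: 'k::field) \<in> L"
proof -
  have "m = (m - Poly_Mapping.single v 1) + Poly_Mapping.single v 1"
    using assms(3) by (intro poly_mapping_eqI)
      (auto simp: lookup_add lookup_minus lookup_single when_def in_keys_iff)
  then have "term_of m c = term_of (m - Poly_Mapping.single v 1) c * Var v"
    unfolding Var_def by (metis term_add_mult)
  then show ?thesis using is_idealD(3)[OF assms(1,2)] by simp
qed

text \<open>Once the variable is killed, a monomial survives only if its support is a face without
  \<open>v\<close>, that is, a face of the deletion.\<close>

lemma ideal_plus_face_ideal:
  assumes "down_closed \<Delta>"
  shows "ideal_plus (face_ideal \<Delta>) (Var v :: 'k::field mpoly) = face_ideal {F \<in> \<Delta>. v \<notin> F}"
proof
  have "down_closed {F \<in> \<Delta>. v \<notin> F}" using assms unfolding down_closed_def by blast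
  then show "ideal_plus (face_ideal \<Delta>) (Var v :: 'k mpoly) \<subseteq> face_ideal {F \<in> \<Delta>. v \<notin> F}"
    by (intro ideal_plus_least is_ideal_face_ideal face_ideal_mono Var_in_face_ideal) auto
  note L = is_ideal_ideal_plus[OF is_ideal_face_ideal[OF assms], of "Var v :: 'k mpoly"]
  show "face_ideal {F \<in> \<Delta>. v \<notin> F} \<subseteq> ideal_plus (face_ideal \<Delta>) (Var v :: 'k mpoly)"
  proof
    fix f :: "'k mpoly" assume f: "f \<in> face_ideal {F \<in> \<Delta>. v \<notin> F}"
    show "f \<in> ideal_plus (face_ideal \<Delta>) (Var v)"
    proof (rule is_ideal_mem_monomials[OF L])
      fix m and c :: 'k assume "m \<in> mkeys f"
      then consider "vars m \<notin> \<Delta>" | "v \<in> vars m" using f by (auto simp: face_ideal_def)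
      then show "term_of m c \<in> ideal_plus (face_ideal \<Delta>) (Var v)"
      proof cases
        case 1
        then have "term_of m c \<in> face_ideal \<Delta>" by (simp add: face_ideal_def)
        then show ?thesis using ideal_plus_superset by blast
      next
        case 2
        then show ?thesis
          by (rule term_in_ideal_Var[OF L ideal_plus_self[OF is_ideal_face_ideal[OF assms]]])
      qed
    qed
  qed
qed

section \<open>The coefficient field and polynomials in one distinguished variable\<close>

abbreviation scalars :: "'k::field mpoly set" where
  "scalars \<equiv> range Const"

lemma Const_simps: "Const 0 = 0" "Const 1 = 1" "Const (a + b) = Const a + Const b"
  "Const (a * b) = Const a * Const b" "Const (- a) = - Const a"
  by (simp_all add: Const_def single_add mult_single single_uminus)

lemma lookup_Const_mult: "Poly_Mapping.lookup (Const k * g) m = k * Poly_Mapping.lookup g m"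
  using lookup_mult_term[of g 0 k m] by (simp add: Const_def mult.commute)

lemma Const_eq_0_iff: "Const a = 0 \<longleftrightarrow> a = 0"
  unfolding Const_def by (metis single_zero inj_single injD)

lemma Const_inverse: "a \<noteq> 0 \<Longrightarrow> Const (inverse a) * Const a = 1"
  by (simp flip: Const_simps)

lemma subring_on_scalars: "subring_on scalars"
  unfolding subring_on_def by (auto simp flip: Const_simps)

lemma ideal_on_scalars:
  assumes "ideal_on scalars I" "Const a \<in> I" "a \<noteq> 0"
  shows "I = (scalars :: 'k::field mpoly set)"
proof
  show "I \<subseteq> scalars" by (rule ideal_onD[OF assms(1)])
  show "(scalars :: 'k mpoly set) \<subseteq> I"
  proof safe
    fix b :: 'k
    have "Const (b * inverse a) * Const a \<in> I" by (intro ideal_onD[OF assms(1)] assms) auto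
    then show "Const b \<in> I" using assms(3) by (simp add: mult.assoc flip: Const_simps)
  qed
qed

lemma noetherian_on_scalars: "noetherian_on (scalars :: 'k::field mpoly set)"
  unfolding noetherian_on_def fin_gen_def
proof (intro allI impI)
  fix I :: "'k mpoly set" assume I: "ideal_on scalars I"
  show "\<exists>B. finite B \<and> B \<subseteq> I \<and> (\<forall>I'. ideal_on scalars I' \<longrightarrow> B \<subseteq> I' \<longrightarrow> I \<subseteq> I')"
  proof (cases "I \<subseteq> {0}")
    case True
    then show ?thesis by (intro exI[of _ "{}"]) (auto dest: ideal_onD(2))
  next
    case False
    then obtain x where x: "x \<in> I" "x \<noteq> 0" by auto
    then obtain a where "x = Const a" using ideal_onD(1)[OF I] by auto
    with x have a: "Const a \<in> I" "a \<noteq> 0" by (auto simp: Const_eq_0_iff)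
    show ?thesis
    proof (intro exI[of _ "{Const a}"] conjI allI impI)
      fix I' :: "'k mpoly set" assume I': "ideal_on scalars I'" "{Const a} \<subseteq> I'"
      then have "I' = scalars" using ideal_on_scalars[OF I'(1), of a] a(2) by auto
      then show "I \<subseteq> I'" using ideal_onD(1)[OF I] by simp
    qed (use a in auto)
  qed
qed

definition free_of :: "nat \<Rightarrow> 'k::field mpoly set" where
  "free_of b = {f. \<forall>m\<in>Poly_Mapping.keys f. b \<notin> Poly_Mapping.keys m}"

lemma subring_on_free_of: "subring_on (free_of b :: 'k::field mpoly set)"
  unfolding subring_on_def
proof (intro conjI ballI)
  fix f g :: "'k mpoly" assume fg: "f \<in> free_of b" "g \<in> free_of b"
  then show "f + g \<in> free_of b" unfolding free_of_def using mkeys_plusE by blast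
  show "f * g \<in> free_of b"
    using fg unfolding free_of_def by (auto elim!: mkeys_multE simp: vars_add)
qed (auto simp: free_of_def in_keys_iff)

lemma adjoin_free_of: "adjoin (free_of b) (Var b) = (UNIV :: 'k::field mpoly set)"
proof -
  note T = subring_on_adjoin[OF subring_on_free_of, of b "Var b :: 'k mpoly"]
  have "f \<in> adjoin (free_of b) (Var b)" for f :: "'k mpoly"
  proof (induction f rule: mpoly_induct)
    case (single m c)
    let ?i = "Poly_Mapping.lookup m b"
    let ?m = "m - Poly_Mapping.single b ?i"
    have "m = ?m + Poly_Mapping.single b ?i"
      by (intro poly_mapping_eqI) (auto simp: lookup_add lookup_minus lookup_single when_def)
    moreover have "term_of (Poly_Mapping.single b ?i) (1::'k) = Var b ^ ?i"
      by (simp add: Var_def term_power mult_single flip: single_of_nat)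
    ultimately have "term_of m c = term_of ?m c * Var b ^ ?i"
      by (metis term_add_mult)
    moreover have "term_of ?m c \<in> free_of b"
      by (auto simp: free_of_def in_keys_iff lookup_minus)
    ultimately show ?case
      using adjoin_superset[OF subring_on_free_of, of b "Var b :: 'k mpoly"]
      by (auto intro!: subring_onD[OF T] subring_on_power[OF T] adjoin_self subring_on_free_of)
  qed (auto intro: subring_onD[OF T])
  then show ?thesis by blast
qed


lemma lookup_free_of_times_power:
  assumes "g \<in> free_of b" "b \<notin> vars m"
  shows "Poly_Mapping.lookup (g * Var b ^ j) (m + Poly_Mapping.single b i) =
    (if j = i then Poly_Mapping.lookup g m else (0::'k::field))"
proof -
  have V: "Var b ^ j = term_of (Poly_Mapping.single b j) (1::'k)"
    by (simp add: Var_def term_power mult_single flip: single_of_nat)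
  show ?thesis
  proof (cases "j = i")
    case True
    then show ?thesis unfolding V by (simp only: lookup_mult_term) simp
  next
    case False
    have "m + Poly_Mapping.single b i \<notin> mkeys (g * Var b ^ j)"
    proof
      assume "m + Poly_Mapping.single b i \<in> mkeys (g * Var b ^ j)"
      then obtain a where a: "a \<in> mkeys g" "m + Poly_Mapping.single b i = a + Poly_Mapping.single b j"
        by (auto simp: V elim!: mkeys_multE split: if_splits)
      have "b \<notin> vars a" using a(1) assms(1) by (auto simp: free_of_def)
      then show False
        using arg_cong[OF a(2), of "\<lambda>m. Poly_Mapping.lookup m b"] assms(2) False
        by (simp add: lookup_add in_keys_iff)
    qed
    then show ?thesis using False by (simp add: in_keys_iff)
  qed
qed

text \<open>Multiplying by a power of x_b does not affect whether a support lies in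
  \<open>F\<close>, and distinct powers do not overlap on monomials free of \<open>b\<close>. So
  every coefficient of \<open>p\<close> is visible in p(x_b).\<close>

lemma not_algebraic_face_ideal:
  assumes "b \<in> F"
  shows "\<not> algebraic_mod (face_ideal (Pow F)) (free_of b) (Var b :: 'k::field mpoly)"
  unfolding algebraic_mod_def poly_zero_mod_def
proof (simp, intro ballI impI allI)
  fix p :: "'k mpoly poly" and i
  assume p: "p \<in> polys_over (free_of b)" and f: "poly p (Var b) \<in> face_ideal (Pow F)"
  show "coeff p i \<in> face_ideal (Pow F)"
    unfolding face_ideal_def
  proof (intro CollectI ballI)
    fix m assume m: "m \<in> mkeys (coeff p i)"
    have pf: "coeff p j \<in> free_of b" for j using p by (auto simp: polys_over_def)
    have bm: "b \<notin> vars m" using m pf[of i] by (auto simp: free_of_def)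
    have "Poly_Mapping.lookup (poly p (Var b)) (m + Poly_Mapping.single b i) =
        (\<Sum>j\<le>Polynomial.degree p. if j = i then Poly_Mapping.lookup (coeff p j) m else 0)"
      unfolding poly_altdef lookup_sum using lookup_free_of_times_power[OF pf bm] by simp
    also have "\<dots> = Poly_Mapping.lookup (coeff p i) m"
      using coeff_eq_0[of p i] by (auto simp: not_le)
    finally have "m + Poly_Mapping.single b i \<in> mkeys (poly p (Var b))"
      using m by (simp add: in_keys_iff)
    then have "vars (m + Poly_Mapping.single b i) \<notin> Pow F" using f by (auto simp: face_ideal_def)
    then show "vars m \<notin> Pow F" using assms by (auto simp: vars_add split: if_splits)
  qed
qed

text \<open>Write p(x_b) = a + z q(x_b) with the coefficients of q free of \<open>b\<close>. Then p
  - z q is a relation modulo \<open>L\<close>, so all its coefficients lie in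
  \<open>L\<close>.\<close>

lemma not_algebraic_ideal_plus:
  fixes z :: "'k::field mpoly"
  assumes L: "is_ideal L" and z: "z \<in> free_of b" and not: "\<not> algebraic_mod L (free_of b) (Var b)"
  shows "\<not> algebraic_mod (ideal_plus L z) (free_of b) (Var b)"
  unfolding algebraic_mod_def poly_zero_mod_def
proof (simp, intro ballI impI allI)
  fix p :: "'k mpoly poly" and i
  assume p: "p \<in> polys_over (free_of b)" and "poly p (Var b) \<in> ideal_plus L z"
  then obtain a c where ac: "poly p (Var b) = a + z * c" "a \<in> L" by (auto elim: ideal_plusE)
  have "c \<in> adjoin (free_of b) (Var b)" by (simp add: adjoin_free_of)
  then obtain q where q: "q \<in> polys_over (free_of b)" "c = poly q (Var b)"
    by (rule adjoinE[OF subring_on_free_of])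
  have "poly (p - smult z q) (Var b) \<in> L" using ac q(2) by simp
  moreover have "p - smult z q \<in> polys_over (free_of b)"
    by (intro polys_over_intros subring_on_free_of p q z)
  ultimately have "poly_zero_mod L (p - smult z q)" using not by (auto simp: algebraic_mod_def)
  then have "coeff p i - z * coeff q i \<in> L" by (simp add: poly_zero_mod_def)
  then show "coeff p i \<in> ideal_plus L z" by (rule ideal_plusI)
qed

lemma scalars_free_of: "scalars \<subseteq> (free_of b :: 'k::field mpoly set)"
  by (auto simp: free_of_def Const_def split: if_splits)

lemma polys_over_mono: "R \<subseteq> S \<Longrightarrow> polys_over R \<subseteq> polys_over S"
  by (auto simp: polys_over_def)

text \<open>Every element is a polynomial in x_b over \<open>free_of b\<close>. As x_b is free
  modulo \<open>L\<close>, the product can be compared coefficientwise, where a unit leading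
  coefficient cannot annihilate anything.\<close>

lemma nzd_poly_Var:
  fixes q :: "'k::field mpoly poly"
  assumes L: "is_ideal L" and not: "\<not> algebraic_mod L (free_of b) (Var b)"
    and q: "q \<in> polys_over scalars" "u * lead_coeff q = 1"
  shows "nzd L (poly q (Var b))"
  unfolding nzd_def
proof (intro allI impI)
  fix f assume f: "poly q (Var b) * f \<in> L"
  have "f \<in> adjoin (free_of b) (Var b)" by (simp add: adjoin_free_of)
  then obtain p where p: "p \<in> polys_over (free_of b)" "f = poly p (Var b)"
    by (rule adjoinE[OF subring_on_free_of])
  have "q \<in> polys_over (free_of b)" using q(1) polys_over_mono[OF scalars_free_of] by blast
  then have "q * p \<in> polys_over (free_of b)" by (intro polys_over_intros subring_on_free_of p)
  then have "poly_zero_mod L (q * p)" using not f p(2) by (auto simp: algebraic_mod_def)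
  then have "poly_zero_mod L p" using poly_zero_mod_mult_unit[OF L] q(2) by blast
  then show "f \<in> L" unfolding p(2) by (rule poly_zero_mod_imp_poly[OF L])
qed

lemma poly_Var_free_of:
  assumes "q \<in> polys_over scalars" "v \<noteq> b"
  shows "poly q (Var v :: 'k::field mpoly) \<in> free_of b"
proof -
  have "(Var v :: 'k mpoly) \<in> free_of b" using assms(2) by (simp add: free_of_def Var_def)
  moreover have "coeff q i \<in> free_of b" for i
    using assms(1) scalars_free_of by (auto simp: polys_over_def)
  ultimately show ?thesis
    unfolding poly_altdef
    by (intro subring_on_sum subring_onD subring_on_power) (auto intro: subring_on_free_of)
qed

section \<open>Vertex decomposition\<close>

text \<open>The star of \<open>v\<close> is used in place of its link, so that the dimension does not drop.\<close>

inductive vertex_decomposable :: "nat \<Rightarrow> nat set set \<Rightarrow> bool" for d where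
  simplex: "finite F \<Longrightarrow> card F = d \<Longrightarrow> vertex_decomposable d (Pow F)"
| decompose: "down_closed \<Delta> \<Longrightarrow> vertex_decomposable d {F. insert v F \<in> \<Delta>} \<Longrightarrow>
    vertex_decomposable d {F \<in> \<Delta>. v \<notin> F} \<Longrightarrow> vertex_decomposable d \<Delta>"

text \<open>Cutting by a polynomial in one variable leaves the other variables free, so the freeness
  hypothesis is inherited along the list.\<close>

lemma weakly_regular_poly_Vars:
  fixes q :: "nat \<Rightarrow> 'k::field mpoly poly"
  assumes q: "\<And>v. q v \<in> polys_over scalars" "\<And>v. u v * lead_coeff (q v) = 1"
  shows "is_ideal L \<Longrightarrow> distinct xs \<Longrightarrow> (\<And>b. b \<in> set xs \<Longrightarrow> \<not> algebraic_mod L (free_of b) (Var b)) \<Longrightarrow>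
    weakly_regular L (map (\<lambda>v. poly (q v) (Var v)) xs)"
proof (induction xs arbitrary: L)
  case (Cons v xs)
  let ?y = "poly (q v) (Var v)"
  have "nzd L ?y" using Cons.prems by (intro nzd_poly_Var[OF _ _ q]) auto
  moreover have "weakly_regular (ideal_plus L ?y) (map (\<lambda>v. poly (q v) (Var v)) xs)"
  proof (rule Cons.IH)
    fix b assume "b \<in> set xs"
    then show "\<not> algebraic_mod (ideal_plus L ?y) (free_of b) (Var b)"
      using Cons.prems by (intro not_algebraic_ideal_plus poly_Var_free_of q(1)) auto
  qed (use Cons.prems in \<open>auto intro: is_ideal_ideal_plus\<close>)
  ultimately show ?case by simp
qed simp

lemma down_closed_Pow: "down_closed (Pow F)"
  by (auto simp: down_closed_def)

text \<open>\<open>V\<close> stays fixed while the complex shrinks, so one sequence serves all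
  stages. The condition \<open>q0\<close> makes each y_v divisible by x_v, which is zero on a
  simplex without \<open>v\<close>.\<close>

theorem weakly_regular_vertex_decomposable:
  fixes q :: "nat \<Rightarrow> 'k::field mpoly poly"
  assumes q: "\<And>v. q v \<in> polys_over scalars" "\<And>v. u v * lead_coeff (q v) = 1"
    and q0: "\<And>v. coeff (q v) 0 = 0" and V: "finite V"
  shows "vertex_decomposable d \<Delta> \<Longrightarrow> \<Union>\<Delta> \<subseteq> V \<Longrightarrow>
    weakly_regular (face_ideal \<Delta>) (map (esym (\<lambda>v. poly (q v) (Var v)) V) (rev [1..<Suc d]))"
proof (induction rule: vertex_decomposable.induct)
  case (simplex F)
  let ?y = "\<lambda>v. poly (q v) (Var v)" and ?L = "face_ideal (Pow F) :: 'k mpoly set"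
  have L: "is_ideal ?L" by (intro is_ideal_face_ideal down_closed_Pow)
  have "permutably_regular ?L ?y F"
    unfolding permutably_regular_def
    by (intro allI impI weakly_regular_poly_Vars[OF q] L not_algebraic_face_ideal) auto
  from weakly_regular_esym[OF simplex(1) L this]
  have "weakly_regular ?L (map (esym ?y F) (rev [1..<Suc d]))" by (simp only: simplex(2))
  moreover have "list_all2 (\<lambda>y z. y - z \<in> ?L) (map (esym ?y F) (rev [1..<Suc d])) (map (esym ?y V) (rev [1..<Suc d]))"
  proof -
    have "?y v \<in> ?L" if "v \<in> V - F" for v
    proof -
      obtain q' where "q v = pCons 0 q'" using q0[of v] by (metis coeff_pCons_0 pCons_cases)
      then have "?y v = Var v * poly q' (Var v)" by simp
      moreover have "(Var v :: 'k mpoly) \<in> ?L" using that by (intro Var_in_face_ideal) auto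
      ultimately show ?thesis by (simp add: is_idealD(4)[OF L])
    qed
    then have "esym ?y V i - esym ?y F i \<in> ?L" for i
      using simplex by (intro esym_superset_cong V L) auto
    from is_idealD(6)[OF L this] show ?thesis
      by (auto simp: list_all2_conv_all_nth simp del: upt_Suc)
  qed
  ultimately show ?case using weakly_regular_cong[OF L] by blast
next
  case (decompose \<Delta> v)
  show ?case
  proof (rule weakly_regular_extension[of _ "Var v"])
    show "is_ideal (face_ideal \<Delta> :: 'k mpoly set)" by (rule is_ideal_face_ideal[OF decompose(1)])
  next
    show "weakly_regular (ideal_plus (face_ideal \<Delta>) (Var v))
        (map (esym (\<lambda>v. poly (q v) (Var v)) V) (rev [1..<Suc d]))"
      unfolding ideal_plus_face_ideal[OF decompose(1)] using decompose.prems by (intro decompose.IH) auto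
    show "weakly_regular (colon (face_ideal \<Delta>) (Var v))
        (map (esym (\<lambda>v. poly (q v) (Var v)) V) (rev [1..<Suc d]))"
      unfolding colon_face_ideal using decompose.prems by (intro decompose.IH) auto
  qed
qed

section \<open>Pure skeletons with few missing facets\<close>

text \<open>The join of the full simplex on \<open>U\<close> with the (e - 1)-dimensional skeleton
  of the simplex on \<open>V\<close> from which the facets in \<open>\<M>\<close> are removed.
  \<open>U\<close> collects the vertices whose star has been taken.\<close>

definition punctured_skeleton :: "nat set \<Rightarrow> nat set \<Rightarrow> nat \<Rightarrow> nat set set \<Rightarrow> nat set set" where
  "punctured_skeleton U V e \<M> = {F. F \<subseteq> U \<union> V \<and> card (F \<inter> V) \<le> e \<and> F \<inter> V \<notin> \<M>}"

lemma down_closed_punctured_skeleton: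
  assumes "finite V" "\<forall>G\<in>\<M>. card G = e"
  shows "down_closed (punctured_skeleton U V e \<M>)"
  unfolding down_closed_def punctured_skeleton_def
proof (intro ballI allI impI CollectI, elim CollectE conjE, intro conjI)
  fix F G assume *: "F \<subseteq> U \<union> V" "card (F \<inter> V) \<le> e" "F \<inter> V \<notin> \<M>" "G \<subseteq> F"
  show "G \<subseteq> U \<union> V" using * by blast
  have le: "card (G \<inter> V) \<le> card (F \<inter> V)" using * assms by (intro card_mono) auto
  then show "card (G \<inter> V) \<le> e" using * by linarith
  show "G \<inter> V \<notin> \<M>"
  proof
    assume "G \<inter> V \<in> \<M>"
    then have "card (G \<inter> V) = card (F \<inter> V)" using assms le * by fastforce
    then have "G \<inter> V = F \<inter> V" using * assms by (intro card_subset_eq) auto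
    then show False using * \<open>G \<inter> V \<in> \<M>\<close> by simp
  qed
qed

text \<open>Moving \<open>v\<close> from \<open>V\<close> to \<open>U\<close> in the star keeps
  \<open>card U + e = d\<close>. The condition for \<open>e = 0\<close> excludes
  \<open>\<M> = {{}}\<close>, which would leave the empty family.\<close>

theorem vertex_decomposable_punctured_skeleton:
  "finite V \<Longrightarrow> finite U \<Longrightarrow> U \<inter> V = {} \<Longrightarrow> \<M> \<subseteq> {G. G \<subseteq> V \<and> card G = e} \<Longrightarrow>
    e + card \<M> \<le> card V \<Longrightarrow> (e = 0 \<Longrightarrow> \<M> = {}) \<Longrightarrow> card U + e = d \<Longrightarrow>
    vertex_decomposable d (punctured_skeleton U V e \<M>)"
proof (induction "card V" arbitrary: U V e \<M> rule: less_induct)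
  case less
  note V = less.prems
  have finM: "finite \<M>" by (rule finite_subset[OF V(4)]) (use V(1) in auto)
  \<comment> \<open>For \<open>e = 1\<close> a missing set is a single point \<open>w\<close> that
    lies in no face; its star would be empty, so it is dropped from \<open>V\<close> instead. In the
    last case \<open>v\<close> is taken from a missing set whenever there is one.\<close>
  consider (zero) "e = 0" | (simplex) "card V = e" | (missing) w where "e = 1" "{w} \<in> \<M>"
    | (split) v where "e > 0" "v \<in> V" "e = 1 \<Longrightarrow> \<M> = {}" "\<M> = {} \<Longrightarrow> e < card V" "\<M> \<noteq> {} \<Longrightarrow> \<exists>G\<in>\<M>. v \<in> G"
  proof -
    consider "e = 0" | "card V = e" | "e = 1" "\<M> \<noteq> {}" | "e > 0" "e < card V" "\<M> = {}" | "e > 1" "\<M> \<noteq> {}"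
      using V(5) by linarith
    then show thesis
    proof cases
      case 3
      then obtain G where "G \<in> \<M>" "card G = 1" using V(4) by auto
      then show thesis using 3 missing by (auto simp: card_1_singleton_iff)
    next
      case 4
      then obtain v where "v \<in> V" by fastforce
      then show thesis using 4 split by blast
    next
      case 5
      then obtain G where G: "G \<in> \<M>" "G \<subseteq> V" "card G = e" using V(4) by auto
      then obtain v where "v \<in> G" using 5 by fastforce
      then show thesis using 5 G split[of v] by auto
    qed (use zero simplex in auto)
  qed
  then show ?case
  proof cases
    case zero
    then have "punctured_skeleton U V e \<M> = Pow U"
      using V by (auto simp: punctured_skeleton_def)
    then show ?thesis using V zero by (auto intro: vertex_decomposable.simplex)
  next
    case simplex
    then have "\<M> = {}" using V(5) finM by auto
    moreover have "card (F \<inter> V) \<le> e" for F using simplex V(1) by (metis card_mono inf_le2)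
    ultimately have "punctured_skeleton U V e \<M> = Pow (U \<union> V)"
      by (auto simp: punctured_skeleton_def)
    then show ?thesis using V simplex by (auto intro!: vertex_decomposable.simplex simp: card_Un_disjoint)
  next
    case (missing w)
    then have w: "w \<in> V" using V(4) by auto
    have "punctured_skeleton U V e \<M> = punctured_skeleton U (V - {w}) e (\<M> - {{w}})"
    proof -
      have *: "w \<notin> F" if "card (F \<inter> V) \<le> 1" "F \<inter> V \<notin> \<M>" for F
      proof
        assume "w \<in> F"
        then have "{w} = F \<inter> V" using that(1) w V(1) by (intro card_seteq) auto
        then show False using that(2) missing(2) by simp
      qed
      have wU: "w \<notin> U" using w V(3) by auto
      show ?thesis
      proof (rule Set.set_eqI)
        fix F
        show "F \<in> punctured_skeleton U V e \<M> \<longleftrightarrow> F \<in> punctured_skeleton U (V - {w}) e (\<M> - {{w}})"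
        proof (cases "w \<in> F")
          case True
          then show ?thesis using *[of F] wU missing(1) by (auto simp: punctured_skeleton_def)
        next
          case False
          then have "F \<inter> (V - {w}) = F \<inter> V" "F \<inter> V \<noteq> {w}" "F \<subseteq> U \<union> (V - {w}) \<longleftrightarrow> F \<subseteq> U \<union> V"
            by auto
          then show ?thesis by (simp add: punctured_skeleton_def)
        qed
      qed
    qed
    moreover have "vertex_decomposable d (punctured_skeleton U (V - {w}) e (\<M> - {{w}}))"
    proof (rule less.hyps)
      show "card (V - {w}) < card V" using w V(1) by (intro card_Diff1_less) auto
      have "card \<M> > 0" using missing(2) finM by (auto simp: card_gt_0_iff)
      then show "e + card (\<M> - {{w}}) \<le> card (V - {w})"
        using V(1,5) missing(2) finM w by simp
      show "\<M> - {{w}} \<subseteq> {G. G \<subseteq> V - {w} \<and> card G = e}"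
        using V(4) missing(1) by (auto simp: card_1_singleton_iff)
    qed (use V missing in auto)
    ultimately show ?thesis by simp
  next
    case (split v)
    let ?K = "punctured_skeleton U V e \<M>"
    \<comment> \<open>The missing facets of the link of \<open>v\<close>.\<close>
    define \<L> where "\<L> = {G. v \<notin> G \<and> insert v G \<in> \<M>}"
    have vU: "v \<notin> U" using split(2) V(3) by auto
    have cV: "card (V - {v}) = card V - 1" "card V > 0"
      using split(2) V(1) by (auto simp: card_gt_0_iff)
    have "{F. insert v F \<in> ?K} = punctured_skeleton (insert v U) (V - {v}) (e - 1) \<L>"
    proof (rule Set.set_eqI)
      fix F
      have 1: "insert v F \<inter> V = insert v (F \<inter> (V - {v}))" using split(2) by auto
      have 2: "card (insert v F \<inter> V) = Suc (card (F \<inter> (V - {v})))"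
        unfolding 1 using V(1) by (subst card_insert_disjoint) auto
      have 3: "insert v F \<inter> V \<in> \<M> \<longleftrightarrow> F \<inter> (V - {v}) \<in> \<L>" unfolding 1 \<L>_def by auto
      have 4: "insert v F \<subseteq> U \<union> V \<longleftrightarrow> F \<subseteq> insert v U \<union> (V - {v})" using split(2) by auto
      show "F \<in> {F. insert v F \<in> ?K} \<longleftrightarrow> F \<in> punctured_skeleton (insert v U) (V - {v}) (e - 1) \<L>"
        unfolding punctured_skeleton_def mem_Collect_eq 2 3 4 using split(1) by auto
    qed
    moreover have "vertex_decomposable d (punctured_skeleton (insert v U) (V - {v}) (e - 1) \<L>)"
    proof (rule less.hyps)
      show "\<L> \<subseteq> {G. G \<subseteq> V - {v} \<and> card G = e - 1}"
      proof
        fix G assume G: "G \<in> \<L>"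
        then have "insert v G \<subseteq> V" "card (insert v G) = e" using V(4) by (auto simp: \<L>_def)
        moreover from this have "finite G" using V(1) by (auto intro: finite_subset)
        ultimately show "G \<in> {G. G \<subseteq> V - {v} \<and> card G = e - 1}" using G by (auto simp: \<L>_def)
      qed
      have "card \<L> \<le> card \<M>"
      proof (rule card_inj_on_le[OF _ _ finM])
        show "inj_on (insert v) \<L>" by (auto simp: inj_on_def \<L>_def)
      qed (auto simp: \<L>_def)
      then show "e - 1 + card \<L> \<le> card (V - {v})" using V(5) cV split(1) by linarith
      show "\<L> = {}" if "e - 1 = 0" using that split(1,3) by (auto simp: \<L>_def)
      show "card (insert v U) + (e - 1) = d" using V(2,7) vU split(1) by simp
    qed (use cV V in auto)
    moreover have "{F \<in> ?K. v \<notin> F} = punctured_skeleton U (V - {v}) e {G \<in> \<M>. v \<notin> G}"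
    proof (rule Set.set_eqI)
      fix F
      have "F \<inter> (V - {v}) = F \<inter> V" if "v \<notin> F" using that by auto
      moreover have "v \<notin> F" if "F \<subseteq> U \<union> (V - {v})" using that vU by auto
      ultimately show "F \<in> {F \<in> ?K. v \<notin> F} \<longleftrightarrow> F \<in> punctured_skeleton U (V - {v}) e {G \<in> \<M>. v \<notin> G}"
        unfolding punctured_skeleton_def mem_Collect_eq by (cases "v \<in> F") auto
    qed
    moreover have "vertex_decomposable d (punctured_skeleton U (V - {v}) e {G \<in> \<M>. v \<notin> G})"
    proof (rule less.hyps)
      show "e + card {G \<in> \<M>. v \<notin> G} \<le> card (V - {v})"
      \<comment> \<open>If no facet is missing, \<open>e < card V\<close> gives the slack; otherwise
        \<open>v\<close> lies in a missing facet and their number drops.\<close>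
      proof (cases "\<M> = {}")
        case True
        then show ?thesis using split(4) cV by auto
      next
        case False
        then have "{G \<in> \<M>. v \<notin> G} \<subset> \<M>" using split(5) by auto
        then have "card {G \<in> \<M>. v \<notin> G} < card \<M>" by (intro psubset_card_mono finM)
        then show ?thesis using V(5) cV by linarith
      qed
    qed (use cV V split in auto)
    moreover have "down_closed ?K" using V by (intro down_closed_punctured_skeleton) auto
    ultimately show ?thesis using vertex_decomposable.decompose[of ?K d v] by simp
  qed
qed

section \<open>The Stanley--Reisner ring as a quotient\<close>

lemma mpoly_ring_simps [simp]:
  "monoid.mult (mpoly_ring n) = (*)" "one (mpoly_ring n) = 1" "ring.zero (mpoly_ring n) = 0" "ring.add (mpoly_ring n) = (+)"
  by (simp_all add: mpoly_ring_def)

lemma carrier_mpoly_ring: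
  "f \<in> carrier (mpoly_ring n) \<longleftrightarrow> (\<forall>m\<in>mkeys f. vars m \<subseteq> {1..n})"
  by (simp add: mpoly_ring_def)

lemma subring_on_carrier: "subring_on (carrier (mpoly_ring n) :: 'k::field mpoly set)"
  unfolding subring_on_def
proof (intro conjI ballI)
  fix f g :: "'k mpoly" assume fg: "f \<in> carrier (mpoly_ring n)" "g \<in> carrier (mpoly_ring n)"
  then show "f + g \<in> carrier (mpoly_ring n)" unfolding carrier_mpoly_ring using mkeys_plusE by blast
  show "f * g \<in> carrier (mpoly_ring n)"
    using fg unfolding carrier_mpoly_ring by (fastforce elim!: mkeys_multE simp: vars_add)
qed (auto simp: carrier_mpoly_ring in_keys_iff)

lemma cring_mpoly_ring: "cring (mpoly_ring n :: 'k::field mpoly ring)"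
proof (rule cringI)
  note C = subring_onD[OF subring_on_carrier[where 'k='k and n=n]]
  show "abelian_group (mpoly_ring n :: 'k mpoly ring)"
  proof (rule abelian_groupI)
    fix x :: "'k mpoly" assume "x \<in> carrier (mpoly_ring n)"
    then show "\<exists>y\<in>carrier (mpoly_ring n). y \<oplus>\<^bsub>mpoly_ring n\<^esub> x = \<zero>\<^bsub>mpoly_ring n\<^esub>"
      using C(3) by (auto intro!: bexI[of _ "- x"])
  qed (auto simp: C algebra_simps)
  show "comm_monoid (mpoly_ring n :: 'k mpoly ring)"
    by (rule comm_monoidI) (auto simp: C algebra_simps)
qed (auto simp: algebra_simps)

lemma ideal_mpoly_ring_iff:
  "ideal I (mpoly_ring n :: 'k::field mpoly ring) \<longleftrightarrow> ideal_on (carrier (mpoly_ring n)) I"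
proof
  interpret cring "mpoly_ring n :: 'k mpoly ring" by (rule cring_mpoly_ring)
  note C = subring_onD[OF subring_on_carrier[where 'k='k and n=n]]
  show "ideal_on (carrier (mpoly_ring n)) I" if "ideal I (mpoly_ring n)"
  proof -
    interpret I: ideal I "mpoly_ring n :: 'k mpoly ring" by fact
    show ?thesis
      unfolding ideal_on_def using I.a_subset I.zero_closed I.a_closed I.I_l_closed by auto
  qed
  show "ideal I (mpoly_ring n)" if I: "ideal_on (carrier (mpoly_ring n)) I"
  proof (rule idealI)
    show "subgroup I (add_monoid (mpoly_ring n))"
    proof (rule add.subgroupI)
      show "I \<noteq> {}" "I \<subseteq> carrier (mpoly_ring n)" using ideal_onD[OF I] by auto
      fix a assume a: "a \<in> I"
      then have aC: "a \<in> carrier (mpoly_ring n)" using ideal_onD(1)[OF I] by auto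
      have "\<ominus>\<^bsub>mpoly_ring n\<^esub> a = - a"
        by (rule minus_equality) (use C(3)[OF aC] aC in auto)
      moreover have "0 - a \<in> I" by (rule ideal_on_diff[OF I subring_on_carrier ideal_onD(2)[OF I] a])
      ultimately show "\<ominus>\<^bsub>mpoly_ring n\<^esub> a \<in> I" by simp
    qed (use ideal_onD[OF I] in auto)
    fix a x assume ax: "a \<in> I" "x \<in> carrier (mpoly_ring n :: 'k mpoly ring)"
    show "x \<otimes>\<^bsub>mpoly_ring n\<^esub> a \<in> I" using ideal_onD(4)[OF I ax(2,1)] by simp
    then show "a \<otimes>\<^bsub>mpoly_ring n\<^esub> x \<in> I" by (simp add: mult.commute)
  qed (rule ring_axioms)
qed

lemma Prod_Var: "finite F \<Longrightarrow> (\<Prod>i\<in>F. Var i) = term_of (\<Sum>i\<in>F. Poly_Mapping.single i 1) (1::'k::field)"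
  by (induction F rule: finite_induct) (auto simp: Var_def mult_single)

lemma vars_sum_single: "finite F \<Longrightarrow> vars (\<Sum>i\<in>F. Poly_Mapping.single i 1) = F"
  by (induction F rule: finite_induct) (auto simp: vars_add)

text \<open>A monomial whose support is not a face is divisible by the squarefree monomial of its
  support, which is a generator.\<close>

lemma stanley_reisner_ideal_eq:
  assumes "simplicial_complex n \<Delta>"
  shows "stanley_reisner_ideal n \<Delta> = (face_ideal \<Delta> \<inter> carrier (mpoly_ring n) :: 'k::field mpoly set)"
proof
  let ?R = "mpoly_ring n :: 'k mpoly ring"
  let ?G = "{\<Prod>i\<in>F. Var i | F. F \<subseteq> {1..n} \<and> F \<notin> \<Delta>} :: 'k mpoly set"
  have dc: "down_closed \<Delta>" using assms unfolding simplicial_complex_def down_closed_def by blast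
  interpret cring ?R by (rule cring_mpoly_ring)
  have gen: "(\<Prod>i\<in>F. Var i) = term_of (\<Sum>i\<in>F. Poly_Mapping.single i 1) (1::'k)"
    "vars (\<Sum>i\<in>F. Poly_Mapping.single i 1) = F" if "F \<subseteq> {1..n}" for F
    using Prod_Var[of F] vars_sum_single[of F] finite_subset[OF that] by blast+
  have G: "?G \<subseteq> face_ideal \<Delta> \<inter> carrier ?R"
  proof safe
    fix F assume F: "F \<subseteq> {1..n}" "F \<notin> \<Delta>"
    show "(\<Prod>i\<in>F. Var i) \<in> (face_ideal \<Delta> :: 'k mpoly set)" "(\<Prod>i\<in>F. Var i) \<in> carrier ?R"
      unfolding gen(1)[OF F(1)] face_ideal_def carrier_mpoly_ring using gen(2)[OF F(1)] F
      by (simp_all only: keys_single mem_Collect_eq) simp_all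
  qed
  have "ideal (face_ideal \<Delta> \<inter> carrier ?R) ?R"
    unfolding ideal_mpoly_ring_iff ideal_on_def
    using is_idealD[OF is_ideal_face_ideal[OF dc, where 'k='k]] subring_onD[OF subring_on_carrier[where 'k='k and n=n]]
    by auto
  then show "stanley_reisner_ideal n \<Delta> \<subseteq> face_ideal \<Delta> \<inter> carrier ?R"
    unfolding stanley_reisner_ideal_def by (rule genideal_minimal[OF _ G])
  have I: "ideal_on (carrier ?R) (stanley_reisner_ideal n \<Delta> :: 'k mpoly set)"
    unfolding stanley_reisner_ideal_def ideal_mpoly_ring_iff[symmetric]
    using G by (intro genideal_ideal) auto
  have GI: "?G \<subseteq> stanley_reisner_ideal n \<Delta>"
    unfolding stanley_reisner_ideal_def using G by (intro genideal_self) auto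
  show "face_ideal \<Delta> \<inter> carrier ?R \<subseteq> stanley_reisner_ideal n \<Delta>"
  proof safe
    fix f :: "'k mpoly" assume f: "f \<in> face_ideal \<Delta>" "f \<in> carrier ?R"
    show "f \<in> stanley_reisner_ideal n \<Delta>"
    proof (induction f rule: mpoly_induct)
      case (single m c)
      let ?F = "vars m" and ?s = "\<Sum>i\<in>vars m. Poly_Mapping.single i (1::nat)"
      have F: "?F \<subseteq> {1..n}" "?F \<notin> \<Delta>" using single f by (auto simp: carrier_mpoly_ring face_ideal_def)
      have "Poly_Mapping.lookup ?s i = (if i \<in> ?F then 1 else 0)" for i
        by (simp add: lookup_sum lookup_single when_def)
      \<comment> \<open>The truncated subtraction is exact, because \<open>?s\<close> has exponent 1
        on the support of \<open>m\<close> and 0 elsewhere.\<close>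
      then have "m = (m - ?s) + ?s"
        by (intro poly_mapping_eqI) (auto simp: lookup_add lookup_minus in_keys_iff)
      then have "term_of m c = term_of (m - ?s) c * (\<Prod>i\<in>?F. Var i)"
        unfolding gen(1)[OF F(1)] by (metis term_add_mult)
      moreover have "vars (m - ?s) \<subseteq> {1..n}"
        using F(1) by (auto simp: in_keys_iff lookup_minus)
      then have "term_of (m - ?s) c \<in> carrier ?R" by (auto simp: carrier_mpoly_ring)
      moreover have "(\<Prod>i\<in>?F. Var i) \<in> (stanley_reisner_ideal n \<Delta> :: 'k mpoly set)" 
        by (rule subsetD[OF GI], rule CollectI, rule exI[of _ ?F]) (use F in simp)
      ultimately show ?case using ideal_onD(4)[OF I] by simp
    qed (use ideal_onD(2,3)[OF I] in auto)
  qed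
qed

text \<open>The substitution of 0 for all variables outside \<open>V\<close>, a ring
  homomorphism.\<close>

definition restrict_vars :: "nat set \<Rightarrow> 'k::field mpoly \<Rightarrow> 'k mpoly" where
  "restrict_vars V f = Abs_poly_mapping (\<lambda>m. Poly_Mapping.lookup f m when Poly_Mapping.keys m \<subseteq> V)"

lemma lookup_restrict_vars:
  "Poly_Mapping.lookup (restrict_vars V f) m = (Poly_Mapping.lookup f m when vars m \<subseteq> V)"
proof -
  have "finite {m. (Poly_Mapping.lookup f m when vars m \<subseteq> V) \<noteq> 0}"
    by (rule finite_subset[OF _ finite_keys[of f]]) (auto simp: in_keys_iff)
  then show ?thesis unfolding restrict_vars_def by simp
qed

lemma restrict_vars_carrier: "restrict_vars {1..n} f \<in> carrier (mpoly_ring n)"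
  unfolding carrier_mpoly_ring
proof
  fix m assume "m \<in> mkeys (restrict_vars {1..n} f)"
  then have "Poly_Mapping.lookup (restrict_vars {1..n} f) m \<noteq> 0" by (simp add: in_keys_iff)
  then show "vars m \<subseteq> {1..n}" by (rule contrapos_np) (simp add: lookup_restrict_vars)
qed

lemma restrict_vars_id: "f \<in> carrier (mpoly_ring n) \<Longrightarrow> restrict_vars {1..n} f = f"
  by (intro poly_mapping_eqI) (auto simp: lookup_restrict_vars when_def carrier_mpoly_ring in_keys_iff)

lemma restrict_vars_0: "restrict_vars V 0 = 0"
  by (intro poly_mapping_eqI) (simp add: lookup_restrict_vars)

lemma restrict_vars_add: "restrict_vars V (f + g) = restrict_vars V f + restrict_vars V g"
  by (intro poly_mapping_eqI) (auto simp: lookup_restrict_vars lookup_add when_def)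

lemma restrict_vars_term:
  "restrict_vars V (term_of m c) = (if vars m \<subseteq> V then term_of m c else 0)"
  by (intro poly_mapping_eqI) (auto simp: lookup_restrict_vars lookup_single when_def)

lemma restrict_vars_mult: "restrict_vars V (f * g) = restrict_vars V f * restrict_vars V g"
proof (induction f rule: mpoly_induct)
  case (add f f')
  then show ?case by (simp add: distrib_right restrict_vars_add)
next
  case (single m c)
  show ?case
  proof (induction g rule: mpoly_induct)
    case (add g g')
    then show ?case by (simp add: distrib_left restrict_vars_add)
  next
    case (single m' c')
    show ?case by (auto simp: restrict_vars_term mult_single vars_add)
  qed (simp add: restrict_vars_0)
qed (simp add: restrict_vars_0)

text \<open>Defined on the whole polynomial type, with the surplus variables sent to 0, so that the
  locale \<open>ring_quotient\<close> applies.\<close>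

definition sr_map :: "nat \<Rightarrow> nat set set \<Rightarrow> 'k::field mpoly \<Rightarrow> 'k mpoly set" where
  "sr_map n \<Delta> f = sr_residue n \<Delta> (restrict_vars {1..n} f)"

context
  fixes n :: nat and \<Delta> :: "nat set set"
  assumes sc: "simplicial_complex n \<Delta>"
begin

lemma simplicial_complex_down_closed: "down_closed \<Delta>"
  using sc unfolding simplicial_complex_def down_closed_def by blast

lemma ideal_stanley_reisner_ideal:
  "ideal (stanley_reisner_ideal n \<Delta>) (mpoly_ring n :: 'k::field mpoly ring)"
  unfolding ideal_mpoly_ring_iff stanley_reisner_ideal_eq[OF sc] ideal_on_def
  using is_idealD[OF is_ideal_face_ideal[OF simplicial_complex_down_closed, where 'k='k]]
    subring_onD[OF subring_on_carrier[where 'k='k and n=n]]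
  by auto

lemma ring_quotient_sr_map:
  "ring_quotient (stanley_reisner_ring n \<Delta>) (sr_map n \<Delta> :: 'k::field mpoly \<Rightarrow> _)"
proof -
  interpret ideal "stanley_reisner_ideal n \<Delta>" "mpoly_ring n :: 'k mpoly ring"
    by (rule ideal_stanley_reisner_ideal)
  interpret Q: cring "stanley_reisner_ring n \<Delta> :: 'k mpoly set ring"
    unfolding stanley_reisner_ring_def by (rule quotient_is_cring[OF cring_mpoly_ring])
  show ?thesis
  proof
    show "range (sr_map n \<Delta>) = carrier (stanley_reisner_ring n \<Delta> :: 'k mpoly set ring)"
    proof -
      have "range (restrict_vars {1..n}) = (carrier (mpoly_ring n) :: 'k mpoly set)"
      proof
        show "carrier (mpoly_ring n) \<subseteq> range (restrict_vars {1..n} :: 'k mpoly \<Rightarrow> _)"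
        proof
          fix f :: "'k mpoly" assume "f \<in> carrier (mpoly_ring n)"
          then have "f = restrict_vars {1..n} f" by (rule restrict_vars_id[symmetric])
          then show "f \<in> range (restrict_vars {1..n})" by (rule range_eqI)
        qed
      qed (use restrict_vars_carrier in blast)
      then have "range (sr_map n \<Delta>) = sr_residue n \<Delta> ` (carrier (mpoly_ring n) :: 'k mpoly set)"
        unfolding sr_map_def by (simp flip: image_image)
      then show ?thesis
        by (auto simp: stanley_reisner_ring_def FactRing_def A_RCOSETS_def' sr_residue_def)
    qed
    fix f g :: "'k mpoly"
    note h = ring_hom_add[OF rcos_ring_hom] ring_hom_mult[OF rcos_ring_hom] ring_hom_one[OF rcos_ring_hom]
    show "sr_map n \<Delta> (f + g) = sr_map n \<Delta> f \<oplus>\<^bsub>stanley_reisner_ring n \<Delta>\<^esub> sr_map n \<Delta> g"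
      "sr_map n \<Delta> (f * g) = sr_map n \<Delta> f \<otimes>\<^bsub>stanley_reisner_ring n \<Delta>\<^esub> sr_map n \<Delta> g"
      using h(1,2)[OF restrict_vars_carrier[of n f] restrict_vars_carrier[of n g]]
      by (simp_all add: sr_map_def sr_residue_def stanley_reisner_ring_def restrict_vars_add restrict_vars_mult)
    have "restrict_vars {1..n} 1 = (1 :: 'k mpoly)"
      by (rule restrict_vars_id) (rule subring_onD(2)[OF subring_on_carrier])
    then show "sr_map n \<Delta> 1 = \<one>\<^bsub>stanley_reisner_ring n \<Delta> :: 'k mpoly set ring\<^esub>"
      using h(3) by (simp add: sr_map_def sr_residue_def stanley_reisner_ring_def)
  qed
qed

text \<open>Restriction discards only monomials whose support leaves [n]. Such supports are not
  faces, so membership in \<open>face_ideal \<Delta>\<close> does not change.\<close>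

lemma ker_sr_map:
  "ring_quotient.ker (stanley_reisner_ring n \<Delta>) (sr_map n \<Delta>) = (face_ideal \<Delta> :: 'k::field mpoly set)"
proof -
  interpret ring_quotient "stanley_reisner_ring n \<Delta>" "sr_map n \<Delta> :: 'k mpoly \<Rightarrow> _"
    by (rule ring_quotient_sr_map)
  interpret I: ideal "stanley_reisner_ideal n \<Delta>" "mpoly_ring n :: 'k mpoly ring"
    by (rule ideal_stanley_reisner_ideal)
  have z: "\<zero>\<^bsub>stanley_reisner_ring n \<Delta>\<^esub> = (stanley_reisner_ideal n \<Delta> :: 'k mpoly set)"
    by (simp add: stanley_reisner_ring_def FactRing_def)
  have "sr_map n \<Delta> f = stanley_reisner_ideal n \<Delta> \<longleftrightarrow> f \<in> face_ideal \<Delta>" for f :: "'k mpoly"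
  proof -
    have "sr_map n \<Delta> f = stanley_reisner_ideal n \<Delta> \<longleftrightarrow> restrict_vars {1..n} f \<in> stanley_reisner_ideal n \<Delta>"
      unfolding sr_map_def sr_residue_def
      using I.rcos_const_imp_mem[of "restrict_vars {1..n} f"] I.a_rcos_const restrict_vars_carrier by blast
    also have "\<dots> \<longleftrightarrow> restrict_vars {1..n} f \<in> face_ideal \<Delta>"
      using restrict_vars_carrier[of n f] by (simp add: stanley_reisner_ideal_eq[OF sc])
    also have "\<dots> \<longleftrightarrow> f \<in> face_ideal \<Delta>"
    proof -
      have "m \<in> mkeys (restrict_vars {1..n} f) \<longleftrightarrow> m \<in> mkeys f" if "vars m \<in> \<Delta>" for m
      proof -
        have "vars m \<subseteq> {1..n}" using that sc by (auto simp: simplicial_complex_def)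
        then show ?thesis by (simp only: in_keys_iff lookup_restrict_vars when_simps)
      qed
      then show ?thesis unfolding face_ideal_def by blast
    qed
    finally show ?thesis .
  qed
  then show ?thesis unfolding ker_def z by auto
qed

end


section \<open>Depth of the Stanley--Reisner ring\<close>

lemma exponent_sum_single:
  "m = (\<Sum>v\<in>vars m. Poly_Mapping.single v (Poly_Mapping.lookup m v))"
  by (rule poly_mapping_eqI) (auto simp: lookup_sum lookup_single when_def in_keys_iff)

lemma term_in_subring:
  assumes S: "subring_on S" "scalars \<subseteq> S" "\<And>v. v \<in> vars m \<Longrightarrow> Var v \<in> S"
  shows "term_of m (c :: 'k::field) \<in> S"
proof -
  have "term_of (\<Sum>v\<in>A. Poly_Mapping.single v (Poly_Mapping.lookup m v)) c \<in> S"
    if "finite A" "A \<subseteq> vars m" for A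
    using that
  proof (induction A rule: finite_induct)
    case empty
    then show ?case using S(2) by (auto simp flip: Const_def)
  next
    case (insert v A)
    have "term_of (Poly_Mapping.single v i) (1::'k) = Var v ^ i" for i
      by (simp add: Var_def term_power mult_single flip: single_of_nat)
    then have "term_of (\<Sum>v\<in>insert v A. Poly_Mapping.single v (Poly_Mapping.lookup m v)) c =
        term_of (\<Sum>v\<in>A. Poly_Mapping.single v (Poly_Mapping.lookup m v)) c * Var v ^ Poly_Mapping.lookup m v"
      using insert by (metis sum.insert add.commute term_add_mult)
    then show ?case
      using insert by (auto intro!: subring_onD(5)[OF S(1)] subring_on_power[OF S(1)] S(3))
  qed
  from this[of "vars m"] show ?thesis using exponent_sum_single[of m] by simp
qed

text \<open>Monomials involving another variable vanish modulo \<open>L\<close>, so the quotient is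
  covered by a finitely generated subring, where the basis theorem and the Goldman descent
  apply.\<close>

lemma approx_adjoin_list:
  fixes f :: "'k::field mpoly"
  assumes L: "is_ideal L" and out: "\<And>v. v \<notin> set vs \<Longrightarrow> Var v \<in> L"
  shows "\<exists>g\<in>adjoin_list scalars (map Var vs). f - g \<in> L"
proof (induction f rule: mpoly_induct)
  let ?S = "adjoin_list scalars (map Var vs) :: 'k mpoly set"
  note S = subring_on_adjoin_list[OF subring_on_scalars, of "map Var vs"]
  case zero
  show ?case using subring_onD(1)[OF S] is_idealD(1)[OF L] by (auto intro!: bexI[of _ 0])
  case (add f g)
  then obtain f' g' where "f' \<in> ?S" "g' \<in> ?S" "f - f' \<in> L" "g - g' \<in> L" by blast
  then have "f' + g' \<in> ?S" "(f + g) - (f' + g') \<in> L"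
    using subring_onD(4)[OF S] is_idealD(2)[OF L, of "f - f'" "g - g'"] by (auto simp: algebra_simps)
  then show ?case by blast
next
  let ?S = "adjoin_list scalars (map Var vs) :: 'k mpoly set"
  note S = subring_on_adjoin_list[OF subring_on_scalars, of "map Var vs"]
  case (single m c)
  show ?case
  proof (cases "vars m \<subseteq> set vs")
    case True
    then have "term_of m c \<in> ?S"
      using adjoin_list_superset[OF subring_on_scalars, of "map Var vs"]
        adjoin_list_set[OF subring_on_scalars, of "map Var vs"]
      unfolding set_map by (intro term_in_subring S) blast+
    then show ?thesis using is_idealD(1)[OF L] by (auto intro!: bexI[of _ "term_of m c"])
  next
    case False
    then obtain v where "v \<in> vars m" "v \<notin> set vs" by auto
    then have "term_of m c \<in> L" using out by (intro term_in_ideal_Var[OF L]) auto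
    then show ?thesis using subring_onD(1)[OF S] by (auto intro!: bexI[of _ 0])
  qed
qed

context ring_quotient
begin

lemma noetherian_ringI_quotient:
  assumes S: "subring_on S" "noetherian_on S" "\<And>x. \<exists>y\<in>S. x - y \<in> ker"
  shows "noetherian_ring R"
proof (rule noetherian_ringI)
  fix I assume I: "ideal I R"
  have id: "ideal_on S (\<pi> -` J \<inter> S)" if "ideal J R" for J
    using is_idealD[OF is_ideal_vimage[OF that]] subring_onD[OF S(1)] by (auto simp: ideal_on_def)
  obtain B where B: "finite B" "B \<subseteq> \<pi> -` I \<inter> S" "\<And>J. ideal_on S J \<Longrightarrow> B \<subseteq> J \<Longrightarrow> \<pi> -` I \<inter> S \<subseteq> J"
    using S(2) id[OF I] unfolding noetherian_on_def fin_gen_def by metis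
  have "I = genideal R (\<pi> ` B)"
  proof
    show "genideal R (\<pi> ` B) \<subseteq> I" by (rule genideal_minimal[OF I]) (use B(2) in auto)
    have G: "ideal (genideal R (\<pi> ` B)) R" by (rule genideal_ideal) auto
    have "\<pi> ` B \<subseteq> genideal R (\<pi> ` B)" by (rule genideal_self) auto
    then have *: "\<pi> -` I \<inter> S \<subseteq> \<pi> -` genideal R (\<pi> ` B) \<inter> S"
      using B(2) by (intro B(3) id G) auto
    show "I \<subseteq> genideal R (\<pi> ` B)"
    proof
      fix a assume a: "a \<in> I"
      then obtain x where x: "a = \<pi> x"
        using ideal.Icarr[OF I] by (auto elim: carrierE)
      obtain y where y: "y \<in> S" "x - y \<in> ker" using S(3) by blast
      then have "\<pi> y = a" using hom_eq_iff[of x y] x by simp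
      then show "a \<in> genideal R (\<pi> ` B)" using * a y(1) by auto
    qed
  qed
  then show "\<exists>A\<subseteq>carrier R. finite A \<and> I = genideal R A"
    using B(1) by (intro exI[of _ "\<pi> ` B"]) auto
qed

lemma maximalideal_vimage_inverse:
  assumes m: "maximalideal m R" and f: "\<pi> f \<notin> m"
  obtains g where "\<pi> (f * g - 1) \<in> m"
proof -
  interpret m: maximalideal m R by (rule m)
  let ?L = "\<pi> -` m"
  have L: "is_ideal ?L" "ker \<subseteq> ?L"
    using is_ideal_vimage[OF m.ideal_axioms] ker_subset_vimage[OF m.ideal_axioms] by auto
  have L': "is_ideal (ideal_plus ?L f)" "ker \<subseteq> ideal_plus ?L f"
    using is_ideal_ideal_plus[OF L(1)] L(2) ideal_plus_superset[of ?L f] by auto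
  have "m \<subseteq> \<pi> ` ideal_plus ?L f"
    using image_vimage[OF m.a_subset] ideal_plus_superset[of ?L f] by blast
  moreover have "\<pi> f \<in> \<pi> ` ideal_plus ?L f" using ideal_plus_self[OF L(1)] by blast
  ultimately have "\<pi> ` ideal_plus ?L f = carrier R"
    using m.I_maximal[OF ideal_image[OF L'(1)]] f surj by blast
  then have "1 \<in> ideal_plus ?L f" using image_eq_carrier_iff[OF L'] by blast
  then obtain a b where "1 = a + f * b" "a \<in> ?L" by (rule ideal_plusE)
  then have "f * b - 1 = - a" by (simp add: algebra_simps)
  then have "f * b - 1 \<in> ?L" using is_idealD(6)[OF L(1) \<open>a \<in> ?L\<close>] by simp
  then show thesis using that by simp
qed

end

context
  fixes n :: nat and \<Delta> :: "nat set set"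
  assumes sc: "simplicial_complex n \<Delta>"
begin

lemma Var_outside: "v \<notin> set [1..<Suc n] \<Longrightarrow> (Var v :: 'k::field mpoly) \<in> face_ideal \<Delta>"
  using sc by (intro Var_in_face_ideal) (auto simp: simplicial_complex_def)

lemma noetherian_stanley_reisner_ring:
  "noetherian_ring (stanley_reisner_ring n \<Delta> :: 'k::field mpoly set ring)"
proof -
  interpret ring_quotient "stanley_reisner_ring n \<Delta>" "sr_map n \<Delta> :: 'k mpoly \<Rightarrow> _"
    by (rule ring_quotient_sr_map[OF sc])
  show ?thesis
  proof (rule noetherian_ringI_quotient)
    show "\<exists>y\<in>adjoin_list scalars (map Var [1..<Suc n]). x - y \<in> ker" for x
      unfolding ker_sr_map[OF sc]
      by (intro approx_adjoin_list is_ideal_face_ideal simplicial_complex_down_closed[OF sc] Var_outside)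
    show "noetherian_on (adjoin_list scalars (map Var [1..<Suc n]))"
      by (intro noetherian_on_adjoin_list subring_on_scalars noetherian_on_scalars)
  qed (rule subring_on_adjoin_list[OF subring_on_scalars])
qed

text \<open>The residue ring at \<open>m\<close> is a field, so it has the Goldman property with t =
  1; descent to the coefficients makes x_v algebraic.\<close>

theorem algebraic_residue_field:
  fixes m :: "'k::field mpoly set set"
  assumes m: "maximalideal m (stanley_reisner_ring n \<Delta>)" and v: "v \<in> {1..n}"
  shows "algebraic_mod (sr_map n \<Delta> -` m) scalars (Var v)"
proof -
  interpret ring_quotient "stanley_reisner_ring n \<Delta>" "sr_map n \<Delta> :: 'k mpoly \<Rightarrow> _"
    by (rule ring_quotient_sr_map[OF sc])
  let ?Q = "sr_map n \<Delta> -` m"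
  have Q: "is_prime ?Q" using is_prime_vimage maximalideal_prime m by blast
  have FQ: "face_ideal \<Delta> \<subseteq> ?Q"
    using ker_subset_vimage[OF maximalideal.axioms(1)[OF m]] ker_sr_map[OF sc, where 'k='k] by simp
  \<comment> \<open>\<open>v\<close> is put last so that its variable is adjoined first.\<close>
  let ?vs = "remove1 v [1..<Suc n] @ [v]"
  let ?S = "adjoin_list scalars (map Var ?vs) :: 'k mpoly set"
  have S: "subring_on ?S" by (rule subring_on_adjoin_list[OF subring_on_scalars])
  have "goldman_mod ?Q ?S"
    unfolding goldman_mod_def
  proof (intro bexI[of _ 1] ballI)
    show "1 \<in> ?S - ?Q" using subring_onD(2)[OF S] is_primeD(2)[OF Q] by auto
    fix s assume s: "s \<in> ?S - ?Q"
    then have "sr_map n \<Delta> s \<notin> m" by auto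
    from maximalideal_vimage_inverse[OF m this] obtain g where g: "s * g - 1 \<in> ?Q" by auto
    have "set ?vs = set [1..<Suc n]" using v by auto
    then have "\<exists>h\<in>?S. g - h \<in> ?Q"
      using FQ Var_outside by (intro approx_adjoin_list is_primeD(1)[OF Q]) auto
    then obtain h where h: "h \<in> ?S" "g - h \<in> ?Q" by blast
    have "s * h - 1 = (s * g - 1) - s * (g - h)" by (simp add: algebra_simps)
    then have "s * h - 1 \<in> ?Q"
      using is_idealD(5)[OF is_primeD(1)[OF Q] g is_idealD(3)[OF is_primeD(1)[OF Q] h(2)]] by metis
    then show "\<exists>N. \<exists>u\<in>?S. s * u - 1 ^ N \<in> ?Q" using h(1) by auto
  qed
  then show ?thesis
    using goldman_imp_algebraic[OF Q subring_on_scalars] by simp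
qed

theorem depth_ge_vertex_decomposable:
  fixes m :: "'k::field mpoly set set"
  assumes m: "maximalideal m (stanley_reisner_ring n \<Delta>)" and vd: "vertex_decomposable d \<Delta>"
  shows "enat d \<le> depth (stanley_reisner_ring n \<Delta>) m"
proof -
  interpret ring_quotient "stanley_reisner_ring n \<Delta>" "sr_map n \<Delta> :: 'k mpoly \<Rightarrow> _"
    by (rule ring_quotient_sr_map[OF sc])
  let ?Q = "sr_map n \<Delta> -` m"
  have Qp: "is_prime ?Q" using is_prime_vimage maximalideal_prime m by blast
  note Q = is_primeD(1)[OF Qp]
  have FQ: "face_ideal \<Delta> \<subseteq> ?Q"
    using ker_subset_vimage[OF maximalideal.axioms(1)[OF m]] ker_sr_map[OF sc, where 'k='k] by simp
  have "\<exists>q u. q \<in> polys_over scalars \<and> u * Polynomial.lead_coeff q = 1 \<and> Polynomial.coeff q 0 = 0 \<and> poly q (Var v) \<in> ?Q" for v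
  proof (cases "v \<in> {1..n}")
    case True
    from algebraic_residue_field[OF m True] obtain p where
      p: "p \<in> polys_over scalars" "poly p (Var v) \<in> ?Q" "\<not> poly_zero_mod ?Q p"
      by (auto simp: algebraic_mod_def)
    let ?p = "reduce_mod ?Q p"
    have p': "?p \<in> polys_over scalars" "poly ?p (Var v) \<in> ?Q" "Polynomial.lead_coeff ?p \<notin> ?Q"
      using p reduce_mod_over[OF Q subring_on_scalars] poly_reduce_mod[OF Q] lead_coeff_reduce_mod[OF Q]
      by auto
    then obtain a where a: "Polynomial.lead_coeff ?p = Const a" by (auto simp: polys_over_def)
    then have "a \<noteq> 0" using p'(3) is_idealD(1)[OF Q] by (auto simp: Const_simps)
    \<comment> \<open>\<open>pCons 0\<close> multiplies the relation by X. This makes the constant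
      coefficient vanish and keeps the leading coefficient and the membership in
      \<open>?Q\<close>.\<close>
    then have "Const (inverse a) * Polynomial.lead_coeff (pCons 0 ?p) = 1"
      using a Const_inverse[of a] Const_eq_0_iff[of a] by auto
    moreover have "pCons 0 ?p \<in> polys_over scalars"
      by (intro polys_over_intros subring_on_scalars p' subring_onD)
    moreover have "poly (pCons 0 ?p) (Var v) \<in> ?Q" using is_idealD(3)[OF Q p'(2)] by simp
    ultimately show ?thesis by (metis coeff_pCons_0)
  next
    case False
    \<comment> \<open>Outside [n] the variable itself lies in \<open>?Q\<close>, so the polynomial X
      will do.\<close>
    then have "Var v \<in> ?Q" using Var_outside FQ by fastforce
    moreover have "[:0, 1:] \<in> polys_over (scalars :: 'k mpoly set)"
      by (intro polys_over_intros subring_on_scalars subring_onD)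
    ultimately show ?thesis by (intro exI[of _ "[:0, 1:]"] exI[of _ 1]) auto
  qed
  then obtain q u where q: "\<And>v. q v \<in> polys_over scalars" "\<And>v. u v * Polynomial.lead_coeff (q v) = 1"
    "\<And>v. Polynomial.coeff (q v) 0 = 0" "\<And>v. poly (q v) (Var v) \<in> ?Q"
    by metis
  let ?\<theta> = "map (esym (\<lambda>v. poly (q v) (Var v)) {1..n}) (rev [1..<Suc d])"
  have "\<Union>\<Delta> \<subseteq> {1..n}" using sc by (auto simp: simplicial_complex_def)
  then have reg: "weakly_regular (face_ideal \<Delta>) ?\<theta>"
    by (intro weakly_regular_vertex_decomposable[OF q(1,2,3) _ vd]) auto
  \<comment> \<open>For index 0 the function is 1; otherwise every product has a factor in
    \<open>?Q\<close>.\<close>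
  have "esym (\<lambda>v. poly (q v) (Var v)) {1..n} i \<in> ?Q" if "i \<noteq> 0" for i
    unfolding esym_def
  proof (rule is_ideal_sum[OF Q])
    fix T assume T: "T \<in> {T. T \<subseteq> {1..n} \<and> card T = i}"
    then have "T \<noteq> {}" "finite T" using that by (auto intro: finite_subset)
    then obtain t where t: "t \<in> T" "finite T" by blast
    have "(\<Prod>t\<in>T. poly (q t) (Var t)) = poly (q t) (Var t) * (\<Prod>t\<in>T - {t}. poly (q t) (Var t))"
      using t by (rule prod.remove[rotated])
    then show "(\<Prod>t\<in>T. poly (q t) (Var t)) \<in> ?Q" using is_idealD(4)[OF Q q(4)] by simp
  qed
  then have in_Q: "set ?\<theta> \<subseteq> ?Q" by auto
  then have "ideal_plus_list (face_ideal \<Delta>) ?\<theta> \<subseteq> ?Q"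
    by (intro ideal_plus_list_least Q FQ)
  then have "1 \<notin> ideal_plus_list (face_ideal \<Delta>) ?\<theta>" using is_primeD(2)[OF Qp] by blast
  with reg have "regular_sequence (stanley_reisner_ring n \<Delta>) (map (sr_map n \<Delta>) ?\<theta>)"
    unfolding regular_sequence_iff ker_sr_map[OF sc] by blast
  moreover have "set (map (sr_map n \<Delta>) ?\<theta>) \<subseteq> m" using in_Q by auto
  moreover have "length (map (sr_map n \<Delta>) ?\<theta>) = d" by simp
  ultimately show ?thesis
    unfolding depth_def
    by (intro Sup_upper CollectI exI[of _ "map (sr_map n \<Delta>) ?\<theta>"] conjI) (simp_all only:)
qed

theorem cohen_macaulay_vertex_decomposable:
  assumes vd: "vertex_decomposable d \<Delta>"
    and dim: "krull_dim (stanley_reisner_ring n \<Delta> :: 'k::field mpoly set ring) \<le> enat d"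
  shows "cohen_macaulay (stanley_reisner_ring n \<Delta> :: 'k mpoly set ring)"
proof -
  interpret ring_quotient "stanley_reisner_ring n \<Delta>" "sr_map n \<Delta> :: 'k mpoly \<Rightarrow> _"
    by (rule ring_quotient_sr_map[OF sc])
  let ?A = "stanley_reisner_ring n \<Delta> :: 'k mpoly set ring"
  have "depth ?A m = height ?A m" if m: "maximalideal m ?A" for m
  proof (rule antisym)
    show "depth ?A m \<le> height ?A m" by (intro depth_le_height maximalideal_prime m)
    have "height ?A m \<le> enat d" using height_le_krull_dim dim by (rule order.trans)
    also have "\<dots> \<le> depth ?A m" by (rule depth_ge_vertex_decomposable[OF m vd])
    finally show "height ?A m \<le> depth ?A m" .
  qed
  then show ?thesis
    unfolding cohen_macaulay_def using noetherian_stanley_reisner_ring is_cring by blast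
qed

end

section \<open>Krull dimension of the Stanley--Reisner ring\<close>

text \<open>Gaussian elimination: a pivot \<open>j\<close> removes the equation \<open>b\<close>
  together with one unknown.\<close>

lemma ex_nontrivial_solution:
  fixes v :: "'i \<Rightarrow> 'b \<Rightarrow> 'k::field"
  assumes "finite B" "finite I" "card B < card I"
  shows "\<exists>c. (\<exists>i\<in>I. c i \<noteq> 0) \<and> (\<forall>b\<in>B. (\<Sum>i\<in>I. c i * v i b) = 0)"
  using assms
proof (induction B arbitrary: I v rule: finite_induct)
  case empty
  then obtain i where "i \<in> I" by fastforce
  then show ?case by (intro exI[of _ "\<lambda>_. 1"]) auto
next
  case (insert b B)
  show ?case
  proof (cases "\<forall>i\<in>I. v i b = 0")
    case True
    have "card B < card I" using insert by simp
    from insert.IH[OF insert.prems(1) this, of v] True show ?thesis by auto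
  next
    case False
    then obtain j where j: "j \<in> I" "v j b \<noteq> 0" by blast
    define w where "w i x = v i x - v i b / v j b * v j x" for i x
    have "card B < card (I - {j})" using insert j by simp
    then obtain c where c: "\<exists>i\<in>I - {j}. c i \<noteq> 0" "\<forall>x\<in>B. (\<Sum>i\<in>I - {j}. c i * w i x) = 0"
      using insert.IH[of "I - {j}" w] insert.prems(1) by auto
    define t where "t = (\<Sum>i\<in>I - {j}. c i * v i b) / v j b"
    define c' where "c' i = (if i = j then - t else c i)" for i
    have sum: "(\<Sum>i\<in>I. c' i * v i x) = (\<Sum>i\<in>I - {j}. c i * v i x) - t * v j x" for x
      using insert.prems(1) j(1) by (subst sum.remove[of _ j]) (auto simp: c'_def intro!: sum.cong)
    have "(\<Sum>i\<in>I. c' i * v i x) = (\<Sum>i\<in>I - {j}. c i * w i x)" for x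
      unfolding sum w_def t_def by (simp add: right_diff_distrib sum_subtractf sum_divide_distrib sum_distrib_right mult.assoc)
    moreover have "(\<Sum>i\<in>I - {j}. c i * w i b) = 0" using j(2) by (simp add: w_def)
    ultimately have "\<forall>x\<in>insert b B. (\<Sum>i\<in>I. c' i * v i x) = 0" using c(2) by simp
    moreover have "\<exists>i\<in>I. c' i \<noteq> 0" using c(1) by (auto simp: c'_def)
    ultimately show ?thesis by blast
  qed
qed

fun power_product :: "(nat \<Rightarrow> 'a::comm_ring_1) \<Rightarrow> nat list \<Rightarrow> 'a" where
  "power_product a [] = 1"
| "power_product a (e # es) = a 0 ^ e * power_product (\<lambda>i. a (Suc i)) es"

definition exponent_lists :: "nat \<Rightarrow> nat \<Rightarrow> nat list set" where
  "exponent_lists r s = {es. set es \<subseteq> {..s} \<and> length es = r}"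

lemma finite_exponent_lists: "finite (exponent_lists r s)"
  unfolding exponent_lists_def by (rule finite_lists_length_eq) simp

lemma card_exponent_lists: "card (exponent_lists r s) = Suc s ^ r"
  unfolding exponent_lists_def by (subst card_lists_length_eq) auto

lemma exponent_lists_Suc: "exponent_lists (Suc r) s = (\<lambda>(e, es). e # es) ` ({..s} \<times> exponent_lists r s)"
  by (auto simp: exponent_lists_def length_Suc_conv image_iff)

lemma sum_exponent_lists_Suc:
  "(\<Sum>es\<in>exponent_lists (Suc r) s. f es) = (\<Sum>e\<le>s. \<Sum>es\<in>exponent_lists r s. f (e # es))"
  unfolding exponent_lists_Suc
  by (subst sum.reindex) (auto simp: inj_on_def sum.cartesian_product split_def)

text \<open>The steps of a chain of primes are algebraically independent: in a polynomial relation, the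
  coefficient of the lexicographically smallest exponent vector would be in a prime of the chain.\<close>

lemma chain_algebraically_independent:
  fixes P :: "nat \<Rightarrow> 'k::field mpoly set" and c :: "nat list \<Rightarrow> 'k"
  assumes "\<And>i. i \<le> r \<Longrightarrow> is_prime (P i)" "\<And>i. i < r \<Longrightarrow> P i \<subseteq> P (Suc i)"
    "\<And>i. i < r \<Longrightarrow> a i \<in> P (Suc i) - P i"
    "(\<Sum>es\<in>exponent_lists r s. Const (c es) * power_product a es) \<in> P 0" "es \<in> exponent_lists r s"
  shows "c es = 0"
  using assms
proof (induction r arbitrary: P a c es)
  case 0
  have es: "exponent_lists 0 s = {[]}" by (auto simp: exponent_lists_def)
  have P: "is_prime (P 0)" using 0 by simp
  have "Const (c []) \<in> P 0" using 0(4) by (simp add: es)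
  then have *: "Const (inverse (c [])) * Const (c []) \<in> P 0" by (rule is_idealD(3)[OF is_primeD(1)[OF P]])
  have "c [] = 0"
  proof (rule ccontr)
    assume "c [] \<noteq> 0"
    from * show False unfolding Const_inverse[OF \<open>c [] \<noteq> 0\<close>] using is_primeD(2)[OF P] by blast
  qed
  then show ?case using 0(5) by (simp add: es)
next
  case (Suc r)
  define S where "S e = (\<Sum>es\<in>exponent_lists r s. Const (c (e # es)) * power_product (\<lambda>i. a (Suc i)) es)" for e
  have P0: "is_prime (P 0)" and P1: "is_prime (P 1)" by (rule Suc.prems(1); simp)+
  have P01: "P 0 \<subseteq> P 1" and a0: "a 0 \<in> P 1" "a 0 \<notin> P 0"
    using Suc.prems(2)[of 0] Suc.prems(3)[of 0] by simp_all
  have "(\<Sum>es\<in>exponent_lists (Suc r) s. Const (c es) * power_product a es) = (\<Sum>e\<le>s. a 0 ^ e * S e)"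
    unfolding sum_exponent_lists_Suc S_def by (simp add: sum_distrib_left mult.left_commute)
  then have sum: "(\<Sum>e\<le>s. a 0 ^ e * S e) \<in> P 0" using Suc.prems(4) by simp
  have zero: "\<forall>es\<in>exponent_lists r s. c (e # es) = 0" if "e \<le> s" for e
    using that
  proof (induction e rule: less_induct)
    case (less e)
    have S0: "S i = 0" if "i < e" for i
      using less.IH[OF that] that less.prems by (simp add: S_def Const_simps)
    define T where "T = (\<Sum>i\<in>{e<..s}. a 0 ^ (i - Suc e) * S i)"
    have "(\<Sum>i\<le>s. a 0 ^ i * S i) = (\<Sum>i\<in>{e..s}. a 0 ^ i * S i)"
      by (rule sum.mono_neutral_right) (auto simp: S0)
    also have "\<dots> = a 0 ^ e * S e + (\<Sum>i\<in>{e<..s}. a 0 ^ i * S i)"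
      using less.prems by (rule sum.head)
    also have "(\<Sum>i\<in>{e<..s}. a 0 ^ i * S i) = a 0 ^ e * (a 0 * T)"
      unfolding T_def sum_distrib_left
    proof (rule sum.cong)
      fix i assume "i \<in> {e<..s}"
      then have "i = e + Suc (i - Suc e)" by auto
      then have "a 0 ^ i = a 0 ^ e * (a 0 * a 0 ^ (i - Suc e))" by (metis power_add power_Suc)
      then show "a 0 ^ i * S i = a 0 ^ e * (a 0 * (a 0 ^ (i - Suc e) * S i))" by (simp add: mult.assoc)
    qed simp
    also have "a 0 ^ e * S e + a 0 ^ e * (a 0 * T) = a 0 ^ e * (S e + a 0 * T)" by (simp add: distrib_left)
    finally have "a 0 ^ e * (S e + a 0 * T) \<in> P 0" using sum by simp
    \<comment> \<open>The power of \<open>a 0\<close> cancels because \<open>a 0\<close> is outside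
      the prime \<open>P 0\<close>. As \<open>a 0\<close> lies in \<open>P 1\<close>, the relation
      \<open>S e \<in> P 1\<close> remains, to which the induction for the shifted chain
      applies.\<close>
    then have "S e + a 0 * T \<in> P 1"
      using is_primeD(3)[OF P0] is_prime_power[OF P0] a0(2) P01 by blast
    moreover have "a 0 * T \<in> P 1" using is_idealD(4)[OF is_primeD(1)[OF P1] a0(1)] .
    ultimately have "S e \<in> P 1" using is_ideal_add_left[OF is_primeD(1)[OF P1]] by blast
    then show ?case
      unfolding S_def
      by (intro ballI Suc.IH[where P="\<lambda>i. P (Suc i)" and a="\<lambda>i. a (Suc i)" and c="\<lambda>es. c (e # es)"])
        (use Suc.prems(1,2,3) in \<open>simp_all\<close>)
  qed
  show ?case using Suc.prems(5) zero by (auto simp: exponent_lists_Suc)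
qed

text \<open>Bounding each exponent separately, and not the total degree, puts the monomials on a
  face into a box that is easy to count.\<close>

definition exponents_le :: "nat \<Rightarrow> 'k::field mpoly \<Rightarrow> bool" where
  "exponents_le N f \<longleftrightarrow> (\<forall>m\<in>Poly_Mapping.keys f. \<forall>v. Poly_Mapping.lookup m v \<le> N)"

lemma exponents_le_mult: "exponents_le N f \<Longrightarrow> exponents_le N' g \<Longrightarrow> exponents_le (N + N') (f * g)"
  unfolding exponents_le_def by (auto elim!: mkeys_multE simp: lookup_add intro!: add_mono)

lemma exponents_le_Const: "exponents_le N (Const c)"
  by (auto simp: exponents_le_def Const_def split: if_splits)

lemma exponents_le_1: "exponents_le N 1"
  using exponents_le_Const[of N 1] by (simp add: Const_simps)

lemma exponents_le_power: "exponents_le N f \<Longrightarrow> exponents_le (e * N) (f ^ e)"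
  by (induction e) (auto simp: exponents_le_1 intro: exponents_le_mult)

lemma exponents_le_mono: "exponents_le N f \<Longrightarrow> N \<le> N' \<Longrightarrow> exponents_le N' f"
  unfolding exponents_le_def using order.trans by blast

lemma exponents_le_sum:
  "(\<And>i. i \<in> A \<Longrightarrow> exponents_le N (f i)) \<Longrightarrow> exponents_le N (\<Sum>i\<in>A. f i :: 'k::field mpoly)"
proof (induction A rule: infinite_finite_induct)
  case (insert i A)
  then show ?case using mkeys_plusE[of _ "f i" "sum f A"] unfolding exponents_le_def by auto
qed (auto simp: exponents_le_def)

lemma ex_exponents_le: "\<exists>N. exponents_le N (f :: 'k::field mpoly)"
proof (induction f rule: mpoly_induct)
  case zero
  then show ?case by (simp add: exponents_le_def)
next
  case (add f g)
  then obtain N N' where "exponents_le N f" "exponents_le N' g" by blast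
  then have "exponents_le (max N N') f" "exponents_le (max N N') g" by (auto intro: exponents_le_mono)
  then show ?case unfolding exponents_le_def using mkeys_plusE by blast
next
  case (single m c)
  have "Poly_Mapping.lookup m v \<le> (\<Sum>w\<in>vars m. Poly_Mapping.lookup m w)" for v
    by (cases "v \<in> vars m") (auto intro!: member_le_sum simp: in_keys_iff)
  then show ?case unfolding exponents_le_def by (auto split: if_splits)
qed

lemma exponents_le_power_product:
  "(\<And>i. i < length es \<Longrightarrow> exponents_le \<delta> (a i)) \<Longrightarrow> set es \<subseteq> {..s} \<Longrightarrow>
    exponents_le (length es * s * \<delta>) (power_product a es)"
proof (induction es arbitrary: a)
  case Nil
  then show ?case by (simp add: exponents_le_1)
next
  case (Cons e es)
  have "exponents_le (s * \<delta>) (a 0 ^ e)"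
    by (rule exponents_le_mono[OF exponents_le_power[OF Cons.prems(1)[of 0]]]) (use Cons.prems in auto)
  moreover have "exponents_le (length es * s * \<delta>) (power_product (\<lambda>i. a (Suc i)) es)"
    by (rule Cons.IH) (use Cons.prems in auto)
  ultimately show ?case using exponents_le_mult by (fastforce simp: algebra_simps)
qed

lemma card_bounded_monomials:
  assumes "finite \<Delta>" "\<And>F. F \<in> \<Delta> \<Longrightarrow> finite F \<and> card F \<le> D"
  shows "finite {m. vars m \<in> \<Delta> \<and> (\<forall>v. Poly_Mapping.lookup m v \<le> N)}"
    "card {m. vars m \<in> \<Delta> \<and> (\<forall>v. Poly_Mapping.lookup m v \<le> N)} \<le> card \<Delta> * Suc N ^ D"
proof -
  define B where "B F = {m. vars m = F \<and> (\<forall>v. Poly_Mapping.lookup m v \<le> N)}" for F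
  have B: "{m. vars m \<in> \<Delta> \<and> (\<forall>v. Poly_Mapping.lookup m v \<le> N)} = (\<Union>F\<in>\<Delta>. B F)"
    by (auto simp: B_def)
  have BF: "finite (B F) \<and> card (B F) \<le> Suc N ^ D" if F: "F \<in> \<Delta>" for F
  proof -
    let ?h = "\<lambda>m. restrict (Poly_Mapping.lookup m) F"
    have inj: "inj_on ?h (B F)"
    proof (rule inj_onI)
      fix m m' assume *: "m \<in> B F" "m' \<in> B F" "?h m = ?h m'"
      show "m = m'"
      proof (rule poly_mapping_eqI)
        fix v show "Poly_Mapping.lookup m v = Poly_Mapping.lookup m' v"
        proof (cases "v \<in> F")
          case True
          then show ?thesis using fun_cong[OF *(3), of v] by simp
        next
          case False
          then have "v \<notin> vars m" "v \<notin> vars m'" using * by (auto simp: B_def)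
          then show ?thesis by (simp add: in_keys_iff)
        qed
      qed
    qed
    have sub: "?h ` B F \<subseteq> PiE F (\<lambda>_. {..N})" by (auto simp: B_def)
    have fin: "finite (PiE F (\<lambda>_. {..N}))" using assms(2)[OF F] by (intro finite_PiE) auto
    have "card (B F) \<le> card (PiE F (\<lambda>_. {..N}))" by (rule card_inj_on_le[OF inj sub fin])
    also have "\<dots> = Suc N ^ card F" using assms(2)[OF F] by (simp add: card_PiE)
    also have "\<dots> \<le> Suc N ^ D" using assms(2)[OF F] by (intro power_increasing) auto
    finally show ?thesis using inj_on_finite[OF inj sub fin] by blast
  qed
  show "finite {m. vars m \<in> \<Delta> \<and> (\<forall>v. Poly_Mapping.lookup m v \<le> N)}"
    unfolding B using assms(1) BF by blast
  have "card (\<Union>F\<in>\<Delta>. B F) \<le> (\<Sum>F\<in>\<Delta>. card (B F))" by (rule card_UN_le[OF assms(1)])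
  also have "\<dots> \<le> (\<Sum>F\<in>\<Delta>. Suc N ^ D)" by (rule sum_mono) (use BF in blast)
  finally show "card {m. vars m \<in> \<Delta> \<and> (\<forall>v. Poly_Mapping.lookup m v \<le> N)} \<le> card \<Delta> * Suc N ^ D"
    unfolding B by simp
qed

text \<open>The power products of \<open>Suc D\<close> elements with exponents up to
  \<open>s\<close> number (s + 1)^(D + 1), while the monomials on faces that they can involve grow
  only like s^D. Making all those coefficients vanish is a homogeneous linear system with more
  unknowns than equations.\<close>

lemma ex_algebraic_relation:
  fixes a :: "nat \<Rightarrow> 'k::field mpoly"
  assumes "finite \<Delta>" "\<And>F. F \<in> \<Delta> \<Longrightarrow> finite F \<and> card F \<le> D"
  obtains s c where "(\<Sum>es\<in>exponent_lists (Suc D) s. Const (c es) * power_product a es) \<in> face_ideal \<Delta>"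
    "\<exists>es\<in>exponent_lists (Suc D) s. c es \<noteq> 0"
proof -
  have "\<forall>i. \<exists>N. exponents_le N (a i)" using ex_exponents_le by blast
  then obtain \<beta> where \<beta>: "\<And>i. exponents_le (\<beta> i) (a i)" by metis
  define \<delta> where "\<delta> = (\<Sum>i\<le>D. \<beta> i)"
  have \<delta>: "exponents_le \<delta> (a i)" if "i \<le> D" for i
    using that unfolding \<delta>_def by (intro exponents_le_mono[OF \<beta>] member_le_sum) auto
  \<comment> \<open>\<open>K\<close> yields N + 1 \<le> K (s + 1), and \<open>s\<close> is chosen so
    that there are at most s (s + 1)^D equations, fewer than (s + 1)^(D + 1).\<close>
  define K where "K = Suc D * \<delta> + 1"
  define s where "s = card \<Delta> * K ^ D"
  define N where "N = Suc D * s * \<delta>"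
  define B where "B = {m. vars m \<in> \<Delta> \<and> (\<forall>v. Poly_Mapping.lookup m v \<le> N)}"
  have "Suc N \<le> K * Suc s" unfolding N_def K_def by (simp add: algebra_simps)
  then have "card \<Delta> * Suc N ^ D \<le> card \<Delta> * (K * Suc s) ^ D" by (intro mult_left_mono power_mono) auto
  also have "\<dots> = s * Suc s ^ D" unfolding power_mult_distrib by (simp add: s_def)
  also have "\<dots> < Suc s ^ Suc D" by simp
  finally have "card B < card (exponent_lists (Suc D) s)"
    using card_bounded_monomials(2)[OF assms, of N] unfolding B_def card_exponent_lists by linarith
  moreover have "finite B" unfolding B_def by (rule card_bounded_monomials(1)[OF assms])
  ultimately have "\<exists>c. (\<exists>es\<in>exponent_lists (Suc D) s. c es \<noteq> 0) \<and>
    (\<forall>m\<in>B. (\<Sum>es\<in>exponent_lists (Suc D) s. c es * Poly_Mapping.lookup (power_product a es) m) = 0)"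
    by (intro ex_nontrivial_solution finite_exponent_lists)
  then obtain c where c: "\<exists>es\<in>exponent_lists (Suc D) s. c es \<noteq> 0"
    "\<forall>m\<in>B. (\<Sum>es\<in>exponent_lists (Suc D) s. c es * Poly_Mapping.lookup (power_product a es) m) = 0" by blast
  let ?f = "\<Sum>es\<in>exponent_lists (Suc D) s. Const (c es) * power_product a es"
  have "exponents_le N ?f"
  proof (rule exponents_le_sum)
    fix es assume "es \<in> exponent_lists (Suc D) s"
    then have "exponents_le N (power_product a es)"
      using exponents_le_power_product[of es \<delta> a s] \<delta> by (auto simp: exponent_lists_def N_def less_Suc_eq_le)
    then show "exponents_le N (Const (c es) * power_product a es)"
      using exponents_le_mult[OF exponents_le_Const[of 0]] by fastforce
  qed
  then have "?f \<in> face_ideal \<Delta>"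
    unfolding face_ideal_def exponents_le_def
  proof (intro CollectI ballI notI)
    fix m assume *: "\<forall>m\<in>mkeys ?f. \<forall>v. Poly_Mapping.lookup m v \<le> N" "m \<in> mkeys ?f" "vars m \<in> \<Delta>"
    then have "m \<in> B" by (simp add: B_def)
    then have "Poly_Mapping.lookup ?f m = 0" using c(2) by (simp add: lookup_sum lookup_Const_mult)
    then show False using *(2) by (simp add: in_keys_iff)
  qed
  then show thesis using that c(1) by blast
qed

text \<open>It is the kernel of \<open>restrict_vars G\<close>, a homomorphism into an integral
  domain.\<close>

lemma is_prime_face_ideal_Pow: "is_prime (face_ideal (Pow G) :: 'k::field mpoly set)"
proof -
  have eq: "f \<in> face_ideal (Pow G) \<longleftrightarrow> restrict_vars G f = 0" for f :: "'k mpoly"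
  proof -
    have "restrict_vars G f = 0 \<longleftrightarrow> (\<forall>m. (Poly_Mapping.lookup f m when vars m \<subseteq> G) = 0)"
      by (simp add: poly_mapping_eq_iff fun_eq_iff lookup_restrict_vars)
    then show ?thesis by (auto simp: face_ideal_def in_keys_iff when_def)
  qed
  have "1 \<notin> (face_ideal (Pow G) :: 'k mpoly set)" by (simp add: face_ideal_def)
  then show ?thesis
    unfolding is_prime_def using is_ideal_face_ideal[OF down_closed_Pow[of G], where 'k='k]
    by (simp add: eq restrict_vars_mult)
qed

context
  fixes n :: nat and \<Delta> :: "nat set set"
  assumes sc: "simplicial_complex n \<Delta>"
begin

text \<open>Dropping the vertices of \<open>F\<close> one at a time makes the primes of the
  simplices grow strictly, as each dropped variable enters the next prime.\<close>

lemma krull_dim_ge_face: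
  assumes F: "F \<in> \<Delta>"
  shows "enat (card F) \<le> krull_dim (stanley_reisner_ring n \<Delta> :: 'k::field mpoly set ring)"
proof -
  interpret ring_quotient "stanley_reisner_ring n \<Delta>" "sr_map n \<Delta> :: 'k mpoly \<Rightarrow> _"
    by (rule ring_quotient_sr_map[OF sc])
  have fin: "finite F" using sc F by (auto simp: simplicial_complex_def intro: finite_subset)
  then obtain xs where xs: "set xs = F" "distinct xs" using finite_distinct_list by blast
  let ?P = "\<lambda>i. face_ideal (Pow (set (drop i xs))) :: 'k mpoly set"
  have sub: "face_ideal \<Delta> \<subseteq> ?P i" for i
    using simplicial_complex_down_closed[OF sc] F xs(1) set_drop_subset[of i xs]
    by (intro face_ideal_mono) (auto simp: down_closed_def)
  have "prime_chain (stanley_reisner_ring n \<Delta>) (card F) (\<lambda>i. sr_map n \<Delta> ` ?P i)"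
    unfolding prime_chain_def
  proof (intro conjI allI impI)
    fix i show "primeideal (sr_map n \<Delta> ` ?P i) (stanley_reisner_ring n \<Delta>)"
      using sub by (intro primeideal_image is_prime_face_ideal_Pow) (simp add: ker_sr_map[OF sc])
  next
    fix i assume "i < card F"
    then have i: "i < length xs" using xs distinct_card by fastforce
    have d: "drop i xs = xs ! i # drop (Suc i) xs" using Cons_nth_drop_Suc[OF i] by simp
    have ni: "xs ! i \<notin> set (drop (Suc i) xs)"
      using distinct_drop[OF xs(2), of i] unfolding d by simp
    have "?P i \<subseteq> ?P (Suc i)" by (intro face_ideal_mono) (auto simp: d)
    moreover have "Var (xs ! i) \<in> ?P (Suc i)" using ni by (intro Var_in_face_ideal) auto
    moreover have "Var (xs ! i) \<notin> ?P i" by (simp add: face_ideal_def Var_def d)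
    then have "sr_map n \<Delta> (Var (xs ! i)) \<notin> sr_map n \<Delta> ` ?P i"
      using sub by (subst image_mem_iff)
        (auto simp: ker_sr_map[OF sc] is_ideal_face_ideal down_closed_Pow)
    ultimately show "sr_map n \<Delta> ` ?P i \<subset> sr_map n \<Delta> ` ?P (Suc i)" by blast
  qed
  then show ?thesis unfolding krull_dim_def by (intro Sup_upper) blast
qed

text \<open>In a chain with more than \<open>D\<close> steps, elements chosen from the first
  \<open>D + 1\<close> steps are algebraically independent, against
  \<open>ex_algebraic_relation\<close>.\<close>

lemma krull_dim_le:
  assumes D: "\<And>F. F \<in> \<Delta> \<Longrightarrow> card F \<le> D"
  shows "krull_dim (stanley_reisner_ring n \<Delta> :: 'k::field mpoly set ring) \<le> enat D"
  unfolding krull_dim_def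
proof (rule Sup_least, safe)
  interpret ring_quotient "stanley_reisner_ring n \<Delta>" "sr_map n \<Delta> :: 'k mpoly \<Rightarrow> _"
    by (rule ring_quotient_sr_map[OF sc])
  fix r and P :: "nat \<Rightarrow> 'k mpoly set set"
  assume P: "prime_chain (stanley_reisner_ring n \<Delta>) r P"
  show "enat r \<le> enat D"
  proof (rule ccontr)
    assume "\<not> enat r \<le> enat D"
    then have r: "Suc D \<le> r" by simp
    let ?P = "\<lambda>i. sr_map n \<Delta> -` P i"
    have Pr: "primeideal (P i) (stanley_reisner_ring n \<Delta>)" if "i \<le> Suc D" for i
      using P that r unfolding prime_chain_def by (meson order.trans)
    have PS: "P i \<subset> P (Suc i)" if "i < Suc D" for i
      using P that r unfolding prime_chain_def by (meson less_le_trans)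
    have prime: "is_prime (?P i)" if "i \<le> Suc D" for i
      by (rule is_prime_vimage[OF Pr[OF that]])
    have "\<exists>a. a \<in> ?P (Suc i) - ?P i" if "i < Suc D" for i
    proof -
      obtain b where b: "b \<in> P (Suc i)" "b \<notin> P i" using PS[of i] \<open>i < Suc D\<close> by blast
      have "b \<in> carrier (stanley_reisner_ring n \<Delta>)"
        by (rule ideal.Icarr[OF primeideal.axioms(1)[OF Pr] b(1)]) (use \<open>i < Suc D\<close> in simp)
      then obtain x where "b = sr_map n \<Delta> x" by (rule carrierE)
      then show ?thesis using b by blast
    qed
    then obtain a where a: "\<And>i. i < Suc D \<Longrightarrow> a i \<in> ?P (Suc i) - ?P i" by metis
    have fin: "finite \<Delta>" "\<And>F. F \<in> \<Delta> \<Longrightarrow> finite F \<and> card F \<le> D"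
      using sc D by (auto simp: simplicial_complex_def intro: finite_subset[of _ "Pow {1..n}"] finite_subset)
    obtain s c where c: "(\<Sum>es\<in>exponent_lists (Suc D) s. Const (c es) * power_product a es) \<in> face_ideal \<Delta>"
      "\<exists>es\<in>exponent_lists (Suc D) s. c es \<noteq> 0"
      by (rule ex_algebraic_relation[OF fin, of a])
    have "face_ideal \<Delta> \<subseteq> ?P 0"
      using ker_subset_vimage[OF primeideal.axioms(1)[OF Pr[of 0]]] ker_sr_map[OF sc, where 'k='k] by simp
    then have mem: "(\<Sum>es\<in>exponent_lists (Suc D) s. Const (c es) * power_product a es) \<in> ?P 0" using c(1) by blast
    have sub: "?P i \<subseteq> ?P (Suc i)" if "i < Suc D" for i using PS[OF that] by blast
    have "c es = 0" if "es \<in> exponent_lists (Suc D) s" for es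
    proof (rule chain_algebraically_independent[where P="?P" and r="Suc D" and a=a and s=s and c=c])
      show "is_prime (?P i)" if "i \<le> Suc D" for i by (rule prime[OF that])
      show "?P i \<subseteq> ?P (Suc i)" if "i < Suc D" for i by (rule sub[OF that])
      show "a i \<in> ?P (Suc i) - ?P i" if "i < Suc D" for i by (rule a[OF that])
    qed (rule mem, rule that)
    then show False using c(2) by blast
  qed
qed

lemma krull_dim_eqD:
  assumes "krull_dim (stanley_reisner_ring n \<Delta> :: 'k::field mpoly set ring) = enat d"
  shows "F \<in> \<Delta> \<Longrightarrow> card F \<le> d" and "\<Delta> \<noteq> {} \<Longrightarrow> \<exists>F\<in>\<Delta>. card F = d"
proof -
  show le: "card F \<le> d" if "F \<in> \<Delta>" for F using krull_dim_ge_face[OF that, where 'k='k] assms by simp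
  assume ne: "\<Delta> \<noteq> {}"
  show "\<exists>F\<in>\<Delta>. card F = d"
  proof (rule ccontr)
    assume "\<not> (\<exists>F\<in>\<Delta>. card F = d)"
    then have "card F \<le> d - 1" if "F \<in> \<Delta>" for F using le[OF that] that by fastforce
    from krull_dim_le[OF this, where 'k='k] have "d \<le> d - 1" using assms by simp
    \<comment> \<open>This rules out the truncated case 0 - 1 = 0.\<close>
    moreover have "d \<noteq> 0" using ne \<open>\<not> (\<exists>F\<in>\<Delta>. card F = d)\<close> le by fastforce
    ultimately show False by simp
  qed
qed

end

section \<open>Hilbert polynomial of the Stanley--Reisner ring\<close>

definition face_monomials :: "nat set set \<Rightarrow> nat \<Rightarrow> (nat \<Rightarrow>\<^sub>0 nat) set" where
  "face_monomials \<Delta> j = {m. Poly_Mapping.keys m \<in> \<Delta> \<and> total_degree m = j}"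

text \<open>Lowering every exponent on \<open>F\<close> by one turns these monomials into lists of
  length \<open>card F\<close> with sum \<open>j - card F\<close>, counted by stars and
  bars.\<close>

lemma card_monomials_vars_eq:
  assumes F: "finite F" "F \<noteq> {}" and j: "card F \<le> j"
  shows "finite {m. vars m = F \<and> total_degree m = j}"
    "card {m. vars m = F \<and> total_degree m = j} = (j - 1) choose (card F - 1)"
proof -
  define S where "S = {m. vars m = F \<and> total_degree m = j}"
  define T where "T = {l::nat list. length l = card F \<and> sum_list l = j - card F}"
  obtain xs where xs: "set xs = F" "distinct xs" using finite_distinct_list[OF F(1)] by blast
  have len: "length xs = card F" using xs distinct_card by fastforce
  define h where "h m = map (\<lambda>v. Poly_Mapping.lookup m v - 1) xs" for m :: "nat \<Rightarrow>\<^sub>0 nat"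
  have pos: "1 \<le> Poly_Mapping.lookup m v" if "m \<in> S" "v \<in> F" for m v
    using that by (auto simp: S_def in_keys_iff Suc_le_eq)
  have "inj_on h S"
  proof (rule inj_onI)
    fix m m' assume *: "m \<in> S" "m' \<in> S" "h m = h m'"
    show "m = m'"
    proof (rule poly_mapping_eqI)
      fix v show "Poly_Mapping.lookup m v = Poly_Mapping.lookup m' v"
      proof (cases "v \<in> F")
        case True
        then have "Poly_Mapping.lookup m v - 1 = Poly_Mapping.lookup m' v - 1"
          using *(3) xs(1) by (auto simp: h_def)
        then show ?thesis using pos[OF *(1) True] pos[OF *(2) True] by linarith
      next
        case False
        then have "v \<notin> vars m" "v \<notin> vars m'" using * by (auto simp: S_def)
        then show ?thesis by (simp add: in_keys_iff)
      qed
    qed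
  qed
  moreover have "h ` S = T"
  proof
    show "h ` S \<subseteq> T"
    proof safe
      fix m assume m: "m \<in> S"
      have "sum_list (h m) = (\<Sum>v\<in>F. Poly_Mapping.lookup m v - 1)"
        unfolding h_def using xs by (simp add: sum_list_distinct_conv_sum_set)
      also have "\<dots> = (\<Sum>v\<in>F. Poly_Mapping.lookup m v) - (\<Sum>v\<in>F. 1)"
        by (rule sum_subtractf_nat) (use pos[OF m] in auto)
      also have "\<dots> = j - card F" using m by (auto simp: S_def total_degree_def)
      finally show "h m \<in> T" by (simp add: T_def h_def len)
    qed
    show "T \<subseteq> h ` S"
    proof
      fix l assume l: "l \<in> T"
      define m where "m = (\<Sum>i<card F. Poly_Mapping.single (xs ! i) (Suc (l ! i)))"
      have look: "Poly_Mapping.lookup m (xs ! k) = Suc (l ! k)" if "k < card F" for k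
      proof -
        have "Poly_Mapping.lookup m (xs ! k) = (\<Sum>i<card F. if i = k then Suc (l ! i) else 0)"
          unfolding m_def lookup_sum
          by (rule sum.cong) (use that xs(2) len in \<open>auto simp: lookup_single when_def nth_eq_iff_index_eq\<close>)
        then show ?thesis using that by simp
      qed
      have "vars m \<subseteq> F"
      proof
        fix v assume "v \<in> vars m"
        then have "(\<Sum>i<card F. Poly_Mapping.lookup (Poly_Mapping.single (xs ! i) (Suc (l ! i))) v) \<noteq> 0"
          by (simp add: m_def in_keys_iff lookup_sum)
        then obtain i where i: "i \<in> {..<card F}" "Poly_Mapping.lookup (Poly_Mapping.single (xs ! i) (Suc (l ! i))) v \<noteq> 0"
          by (rule sum.not_neutral_contains_not_neutral)
        have "xs ! i = v" using i(2) by (rule contrapos_np) (rule lookup_single_not_eq)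
        moreover have "i < length xs" using i(1) len by simp
        ultimately show "v \<in> F" using xs(1) nth_mem by blast
      qed
      moreover have "F \<subseteq> vars m"
      proof
        fix v assume "v \<in> F"
        then obtain k where "k < card F" "v = xs ! k" using xs(1) len by (metis in_set_conv_nth)
        then show "v \<in> vars m" using look by (simp add: in_keys_iff)
      qed
      ultimately have vm: "vars m = F" by blast
      have "total_degree m = (\<Sum>i<card F. Poly_Mapping.lookup m (xs ! i))"
        unfolding total_degree_def vm
        using sum_list_distinct_conv_sum_set[OF xs(2), of "Poly_Mapping.lookup m"]
        by (simp add: xs(1) sum_list_sum_nth len atLeast0LessThan)
      also have "\<dots> = (\<Sum>i<card F. Suc (l ! i))" by (rule sum.cong) (auto simp: look)
      also have "\<dots> = card F + sum_list l"
        using l by (simp add: sum_Suc sum_list_sum_nth T_def atLeast0LessThan)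
      also have "\<dots> = j" using l j by (simp add: T_def)
      finally have "m \<in> S" using vm by (simp add: S_def)
      moreover have "h m = l"
        using l len look by (auto simp: h_def T_def intro!: nth_equalityI)
      ultimately show "l \<in> h ` S" by blast
    qed
  qed
  ultimately have bij: "bij_betw h S T" by (simp add: bij_betw_def)
  have F0: "card F > 0" using F by (simp add: card_gt_0_iff)
  have "card T = (j - card F + card F - 1) choose (j - card F)"
    unfolding T_def by (rule card_length_sum_list)
  also have "\<dots> = (j - 1) choose (card F - 1)"
    using j F0 by (subst binomial_symmetric) (auto intro: arg_cong2[where f="(choose)"])
  finally have T: "card T = (j - 1) choose (card F - 1)" .
  have "T \<subseteq> {l. set l \<subseteq> {..j} \<and> length l = card F}"
    unfolding T_def using member_le_sum_list by fastforce
  then have "finite T" by (rule finite_subset) (rule finite_lists_length_eq, simp)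
  then show "finite {m. vars m = F \<and> total_degree m = j}"
    "card {m. vars m = F \<and> total_degree m = j} = (j - 1) choose (card F - 1)"
    using bij_betw_same_card[OF bij] bij_betw_finite[OF bij] T unfolding S_def by auto
qed

text \<open>Monomials are sorted by support. The empty face carries none of positive degree, but
  with its truncated \<open>card F - 1 = 0\<close> it would add 1 to the sum.\<close>

lemma card_face_monomials:
  assumes \<Delta>: "finite \<Delta>" "\<And>F. F \<in> \<Delta> \<Longrightarrow> finite F \<and> card F \<le> j" and j: "0 < j"
  shows "finite (face_monomials \<Delta> j)"
    "card (face_monomials \<Delta> j) = (\<Sum>F\<in>\<Delta> - {{}}. (j - 1) choose (card F - 1))"
proof -
  have "face_monomials \<Delta> j = (\<Union>F\<in>\<Delta> - {{}}. {m. vars m = F \<and> total_degree m = j})"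
    using j by (auto simp: face_monomials_def total_degree_def)
  moreover have "finite (\<Union>F\<in>\<Delta> - {{}}. {m. vars m = F \<and> total_degree m = j})"
    using \<Delta> card_monomials_vars_eq(1) by auto
  moreover have "card (\<Union>F\<in>\<Delta> - {{}}. {m. vars m = F \<and> total_degree m = j}) =
      (\<Sum>F\<in>\<Delta> - {{}}. card {m. vars m = F \<and> total_degree m = j})"
    by (rule card_UN_disjoint) (use \<Delta> card_monomials_vars_eq(1) in auto)
  ultimately show "finite (face_monomials \<Delta> j)"
    "card (face_monomials \<Delta> j) = (\<Sum>F\<in>\<Delta> - {{}}. (j - 1) choose (card F - 1))"
    using \<Delta> card_monomials_vars_eq(2) by (auto intro!: sum.cong)
qed

text \<open>The binomial coefficient of X - 1 over \<open>p\<close>, as a polynomial in X.\<close>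

definition shifted_binomial_poly :: "nat \<Rightarrow> rat poly" where
  "shifted_binomial_poly p = smult (1 / fact p) (\<Prod>i<p. [:- of_nat (Suc i), 1:])"

lemma poly_shifted_binomial_poly:
  assumes "0 < j"
  shows "poly (shifted_binomial_poly p) (of_nat j) = of_nat ((j - 1) choose p)"
proof -
  have *: "- of_nat (Suc i) + of_nat j = (of_nat (j - 1) - of_nat i :: rat)" for i
    using assms by (cases j) auto
  have "(\<Prod>i<p. - of_nat (Suc i) + of_nat j) = (\<Prod>i = 0..<p. of_nat (j - 1) - of_nat i :: rat)"
    by (intro prod.cong *) auto
  moreover have "poly (shifted_binomial_poly p) (of_nat j) =
      (\<Prod>i<p. - of_nat (Suc i) + of_nat j) / fact p"
    by (simp add: shifted_binomial_poly_def poly_prod del: of_nat_Suc)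
  ultimately show ?thesis
    unfolding binomial_gbinomial gbinomial_prod_rev by (simp only: divide_inverse)
qed

lemma shifted_binomial_poly_degree:
  "Polynomial.degree (shifted_binomial_poly p) = p" "Polynomial.coeff (shifted_binomial_poly p) p = 1 / fact p"
proof -
  let ?q = "\<Prod>i<p. [:- of_nat (Suc i), 1:] :: rat poly"
  have d: "Polynomial.degree ?q = p" by (subst degree_prod_sum_eq) auto
  have "Polynomial.lead_coeff ?q = 1" by (simp add: lead_coeff_prod)
  with d show "Polynomial.degree (shifted_binomial_poly p) = p"
    "Polynomial.coeff (shifted_binomial_poly p) p = 1 / fact p"
    by (simp_all add: shifted_binomial_poly_def)
qed

lemma poly_eqI_eventually:
  fixes p q :: "rat poly"
  assumes "\<forall>\<^sub>F j in sequentially. poly p (of_nat j) = poly q (of_nat j)"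
  shows "p = q"
proof (rule ccontr)
  assume "p \<noteq> q"
  then have fin: "finite {x. poly (p - q) x = 0}" by (intro poly_roots_finite) simp
  obtain N where "\<And>j. N \<le> j \<Longrightarrow> poly p (of_nat j) = poly q (of_nat j)"
    using assms by (auto simp: eventually_sequentially)
  then have "of_nat ` {N..} \<subseteq> {x. poly (p - q) x = 0}" by auto
  then have "finite (of_nat ` {N..} :: rat set)" using fin finite_subset by blast
  then have "finite {N..}" by (rule finite_imageD) (simp add: inj_on_def)
  then show False using infinite_Ici by blast
qed

context
  fixes n :: nat and \<Delta> :: "nat set set"
  assumes sc: "simplicial_complex n \<Delta>" and ne: "\<Delta> \<noteq> {}"
begin

lemma sr_residue_eq_sr_map: "f \<in> carrier (mpoly_ring n) \<Longrightarrow> sr_residue n \<Delta> f = sr_map n \<Delta> f"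
  unfolding sr_map_def by (simp only: restrict_vars_id)

lemma sr_scalars_eq: "sr_scalars n \<Delta> = sr_map n \<Delta> ` (scalars :: 'k::field mpoly set)"
proof -
  have "Const a \<in> carrier (mpoly_ring n)" for a :: 'k
    by (auto simp: carrier_mpoly_ring Const_def split: if_splits)
  then show ?thesis by (auto simp: sr_scalars_def sr_residue_eq_sr_map image_image)
qed

lemma term_notin_face_ideal:
  "vars m \<in> \<Delta> \<Longrightarrow> Poly_Mapping.lookup f m \<noteq> 0 \<Longrightarrow> (f :: 'k::field mpoly) \<notin> face_ideal \<Delta>"
  by (auto simp: face_ideal_def in_keys_iff)

lemma subfield_sr_scalars:
  "subfield (sr_scalars n \<Delta>) (stanley_reisner_ring n \<Delta> :: 'k::field mpoly set ring)"
proof -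
  interpret ring_quotient "stanley_reisner_ring n \<Delta>" "sr_map n \<Delta> :: 'k mpoly \<Rightarrow> _"
    by (rule ring_quotient_sr_map[OF sc])
  let ?A = "stanley_reisner_ring n \<Delta> :: 'k mpoly set ring"
  let ?c = "\<lambda>a :: 'k. sr_map n \<Delta> (Const a)"
  have K: "sr_scalars n \<Delta> = range ?c" unfolding sr_scalars_eq by (simp add: image_image)
  have hom: "?c (a + b) = ?c a \<oplus>\<^bsub>?A\<^esub> ?c b" "?c (a * b) = ?c a \<otimes>\<^bsub>?A\<^esub> ?c b"
    "?c 1 = \<one>\<^bsub>?A\<^esub>" "?c 0 = \<zero>\<^bsub>?A\<^esub>" for a b
    by (simp_all add: Const_simps hom_add hom_mult hom_one hom_zero)
  note L = is_ideal_face_ideal[OF simplicial_complex_down_closed[OF sc], where 'k='k]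
  \<comment> \<open>The empty face keeps nonzero constants out of
    \<open>face_ideal \<Delta>\<close>.\<close>
  have empty: "{} \<in> \<Delta>" using sc ne unfolding simplicial_complex_def by blast
  have c0: "?c a = \<zero>\<^bsub>?A\<^esub> \<longleftrightarrow> a = 0" for a
  proof -
    have "?c a = ?c 0 \<longleftrightarrow> Const a - Const 0 \<in> (face_ideal \<Delta> :: 'k mpoly set)"
      by (simp add: hom_eq_iff ker_sr_map[OF sc])
    also have "\<dots> \<longleftrightarrow> a = 0"
      using term_notin_face_ideal[of 0 "Const a"] empty is_idealD(1)[OF L]
      by (auto simp: Const_simps Const_def)
    finally show ?thesis by (simp add: hom)
  qed
  have "subring (sr_scalars n \<Delta>) ?A"
    unfolding K
  proof (rule subringI)
    show "\<one>\<^bsub>?A\<^esub> \<in> range ?c" using hom(3) by (metis rangeI)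
    fix x y assume "x \<in> range ?c" "y \<in> range ?c"
    then obtain a b where ab: "x = ?c a" "y = ?c b" by auto
    show "x \<otimes>\<^bsub>?A\<^esub> y \<in> range ?c" "x \<oplus>\<^bsub>?A\<^esub> y \<in> range ?c"
      unfolding ab by (simp_all flip: hom(1,2))
    have "?c (- a) \<oplus>\<^bsub>?A\<^esub> x = \<zero>\<^bsub>?A\<^esub>" unfolding ab by (simp flip: hom)
    then have "\<ominus>\<^bsub>?A\<^esub> x = ?c (- a)" by (rule minus_equality) (auto simp: ab)
    then show "\<ominus>\<^bsub>?A\<^esub> x \<in> range ?c" by simp
  qed auto
  then have sub: "subcring (sr_scalars n \<Delta>) ?A" by (rule subcringI')
  show ?thesis
  proof (rule subfieldI[OF sub])
    show "Units (?A\<lparr>carrier := sr_scalars n \<Delta>\<rparr>) = sr_scalars n \<Delta> - {\<zero>\<^bsub>?A\<^esub>}"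
    proof (intro equalityI subsetI)
      fix x assume "x \<in> Units (?A\<lparr>carrier := sr_scalars n \<Delta>\<rparr>)"
      then obtain a b where ab: "x = ?c a" "?c a \<otimes>\<^bsub>?A\<^esub> ?c b = \<one>\<^bsub>?A\<^esub>"
        unfolding Units_def K by auto
      then have "?c (a * b) \<noteq> \<zero>\<^bsub>?A\<^esub>" using c0[of 1] by (simp add: hom)
      then have "a \<noteq> 0" by (auto simp: hom)
      then show "x \<in> sr_scalars n \<Delta> - {\<zero>\<^bsub>?A\<^esub>}" using ab(1) c0 by (auto simp: K)
    next
      fix x assume "x \<in> sr_scalars n \<Delta> - {\<zero>\<^bsub>?A\<^esub>}"
      then obtain a where a: "x = ?c a" "a \<noteq> 0" using c0 by (auto simp: K)
      then have "?c (inverse a) \<otimes>\<^bsub>?A\<^esub> x = \<one>\<^bsub>?A\<^esub>" "x \<otimes>\<^bsub>?A\<^esub> ?c (inverse a) = \<one>\<^bsub>?A\<^esub>"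
        by (simp_all add: hom(3) flip: hom(2))
      then show "x \<in> Units (?A\<lparr>carrier := sr_scalars n \<Delta>\<rparr>)"
        unfolding Units_def K using a(1) by auto
    qed
  qed
qed

text \<open>Monomials supported on faces are linearly independent modulo the face ideal, so each new
  one extends the span by a line.\<close>

lemma dimension_monomial_span:
  assumes "finite B" "\<And>m. m \<in> B \<Longrightarrow> vars m \<in> \<Delta>"
  shows "ring.dimension (stanley_reisner_ring n \<Delta> :: 'k::field mpoly set ring) (card B) (sr_scalars n \<Delta>)
    (sr_map n \<Delta> ` {f. mkeys f \<subseteq> B})"
proof -
  interpret ring_quotient "stanley_reisner_ring n \<Delta>" "sr_map n \<Delta> :: 'k mpoly \<Rightarrow> _"
    by (rule ring_quotient_sr_map[OF sc])
  let ?A = "stanley_reisner_ring n \<Delta> :: 'k mpoly set ring"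
  let ?E = "\<lambda>B. sr_map n \<Delta> ` {f :: 'k mpoly. mkeys f \<subseteq> B}"
  show ?thesis
    using assms
  proof (induction B rule: finite_induct)
    case empty
    have "{f :: 'k mpoly. mkeys f \<subseteq> {}} = {0}" by auto
    then show ?case using zero_dim hom_zero by simp
  next
    case (insert m B)
    let ?t = "term_of m (1::'k)"
    have "sr_map n \<Delta> ?t \<notin> ?E B"
    proof
      assume "sr_map n \<Delta> ?t \<in> ?E B"
      then obtain f where f: "mkeys f \<subseteq> B" "?t - f \<in> face_ideal \<Delta>"
        by (auto simp: hom_eq_iff ker_sr_map[OF sc])
      then have "Poly_Mapping.lookup (?t - f) m = 1"
        using insert.hyps(2) by (auto simp: lookup_minus in_keys_iff)
      then show False using term_notin_face_ideal[of m "?t - f"] f(2) insert.prems by simp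
    qed
    then have "dimension (Suc (card B)) (sr_scalars n \<Delta>) (line_extension (sr_scalars n \<Delta>) (sr_map n \<Delta> ?t) (?E B))"
      using insert by (intro Suc_dim) auto
    moreover have "line_extension (sr_scalars n \<Delta>) (sr_map n \<Delta> ?t) (?E B) = ?E (insert m B)"
    proof (intro equalityI subsetI)
      fix u assume "u \<in> line_extension (sr_scalars n \<Delta>) (sr_map n \<Delta> ?t) (?E B)"
      then obtain a f where af: "mkeys f \<subseteq> B" "u = sr_map n \<Delta> (Const a * ?t + f)"
        unfolding line_extension_mem_iff sr_scalars_eq by (auto simp: hom_add hom_mult)
      have "mkeys (Const a * ?t + f) \<subseteq> insert m B"
      proof
        fix x assume "x \<in> mkeys (Const a * ?t + f)"
        then have "x \<in> mkeys (Const a * ?t) \<or> x \<in> mkeys f" by (rule mkeys_plusE)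
        then show "x \<in> insert m B" using af(1) by (auto simp: Const_def mult_single split: if_splits)
      qed
      then show "u \<in> ?E (insert m B)" using af(2) by blast
    next
      fix u assume "u \<in> ?E (insert m B)"
      then obtain f where f: "mkeys f \<subseteq> insert m B" "u = sr_map n \<Delta> f" by auto
      define a where "a = Poly_Mapping.lookup f m"
      have "mkeys (f - Const a * ?t) \<subseteq> B"
        using f(1) by (auto simp: in_keys_iff lookup_minus lookup_Const_mult lookup_single a_def when_def split: if_splits)
      moreover have "u = sr_map n \<Delta> (Const a) \<otimes>\<^bsub>?A\<^esub> sr_map n \<Delta> ?t \<oplus>\<^bsub>?A\<^esub> sr_map n \<Delta> (f - Const a * ?t)"
        by (simp add: f(2) flip: hom_mult hom_add)
      ultimately show "u \<in> line_extension (sr_scalars n \<Delta>) (sr_map n \<Delta> ?t) (?E B)"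
        unfolding line_extension_mem_iff sr_scalars_eq by blast
    qed
    ultimately show ?case using insert by simp
  qed
qed

text \<open>Monomials not supported on a face vanish in the quotient, so a homogeneous
  representative can be chosen without them.\<close>

lemma sr_component_eq:
  "sr_component n \<Delta> j = sr_map n \<Delta> ` {f :: 'k::field mpoly. mkeys f \<subseteq> face_monomials \<Delta> j}"
proof (intro equalityI subsetI)
  interpret ring_quotient "stanley_reisner_ring n \<Delta>" "sr_map n \<Delta> :: 'k mpoly \<Rightarrow> _"
    by (rule ring_quotient_sr_map[OF sc])
  fix x :: "'k mpoly set" assume "x \<in> sr_component n \<Delta> j"
  then obtain f where f: "x = sr_map n \<Delta> f" "homogeneous j f"
    by (auto simp: sr_component_def sr_residue_eq_sr_map)
  have "\<exists>g. mkeys g \<subseteq> mkeys f \<inter> {m. vars m \<in> \<Delta>} \<and> f - g \<in> face_ideal \<Delta>"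
  proof -
    define g where "g = (\<Sum>m\<in>mkeys f \<inter> {m. vars m \<in> \<Delta>}. term_of m (Poly_Mapping.lookup f m))"
    have g: "Poly_Mapping.lookup g m = (if vars m \<in> \<Delta> then Poly_Mapping.lookup f m else 0)" for m
      by (auto simp: g_def lookup_sum lookup_single when_def in_keys_iff)
    show ?thesis
      by (intro exI[of _ g]) (auto simp: face_ideal_def in_keys_iff lookup_minus g split: if_splits)
  qed
  then obtain g where g: "mkeys g \<subseteq> mkeys f \<inter> {m. vars m \<in> \<Delta>}" "f - g \<in> face_ideal \<Delta>" by blast
  have "x = sr_map n \<Delta> g" using g(2) by (simp add: f(1) hom_eq_iff ker_sr_map[OF sc])
  moreover have "mkeys g \<subseteq> face_monomials \<Delta> j"
    using g(1) f(2) by (auto simp: homogeneous_def face_monomials_def)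
  ultimately show "x \<in> sr_map n \<Delta> ` {f. mkeys f \<subseteq> face_monomials \<Delta> j}" by blast
next
  fix x :: "'k mpoly set" assume "x \<in> sr_map n \<Delta> ` {f. mkeys f \<subseteq> face_monomials \<Delta> j}"
  then obtain f where f: "x = sr_map n \<Delta> f" "mkeys f \<subseteq> face_monomials \<Delta> j" by auto
  have "f \<in> carrier (mpoly_ring n)"
    using f(2) sc unfolding carrier_mpoly_ring face_monomials_def simplicial_complex_def by blast
  moreover have "homogeneous j f" using f(2) by (auto simp: homogeneous_def face_monomials_def)
  ultimately show "x \<in> sr_component n \<Delta> j"
    using f(1) sr_residue_eq_sr_map unfolding sr_component_def by blast
qed

lemma finite_simplicial_complex: "finite \<Delta>" "F \<in> \<Delta> \<Longrightarrow> finite F \<and> card F \<le> n"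
proof -
  have "\<Delta> \<subseteq> Pow {1..n}" using sc by (simp only: simplicial_complex_def)
  then show "finite \<Delta>" by (rule finite_subset) simp
  assume "F \<in> \<Delta>"
  then have "F \<subseteq> {1..n}" using sc by (auto simp: simplicial_complex_def)
  then show "finite F \<and> card F \<le> n" using card_mono[of "{1..n}" F] finite_subset by auto
qed

lemma hilbert_function_stanley_reisner:
  assumes j: "n \<le> j" "0 < j"
  shows "hilbert_function (stanley_reisner_ring n \<Delta> :: 'k::field mpoly set ring) (sr_scalars n \<Delta>)
    (sr_component n \<Delta>) j = (\<Sum>F\<in>\<Delta> - {{}}. (j - 1) choose (card F - 1))"
proof -
  interpret ring_quotient "stanley_reisner_ring n \<Delta>" "sr_map n \<Delta> :: 'k mpoly \<Rightarrow> _"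
    by (rule ring_quotient_sr_map[OF sc])
  have fm: "finite (face_monomials \<Delta> j)"
    "card (face_monomials \<Delta> j) = (\<Sum>F\<in>\<Delta> - {{}}. (j - 1) choose (card F - 1))"
    using card_face_monomials[OF finite_simplicial_complex(1) _ j(2)] finite_simplicial_complex(2) j(1)
    by (meson order.trans)+
  have "dimension (card (face_monomials \<Delta> j)) (sr_scalars n \<Delta>) (sr_component n \<Delta> j :: 'k mpoly set set)"
    unfolding sr_component_eq by (rule dimension_monomial_span[OF fm(1)]) (simp add: face_monomials_def)
  from dimI[OF subfield_sr_scalars this] show ?thesis
    unfolding hilbert_function_def over_def fm(2) .
qed

lemma hilbert_polynomial_stanley_reisner:
  "hilbert_polynomial (stanley_reisner_ring n \<Delta> :: 'k::field mpoly set ring) (sr_scalars n \<Delta>)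
    (sr_component n \<Delta>) = (\<Sum>F\<in>\<Delta> - {{}}. shifted_binomial_poly (card F - 1))"
    (is "_ = ?p")
proof -
  let ?H = "hilbert_function (stanley_reisner_ring n \<Delta> :: 'k mpoly set ring) (sr_scalars n \<Delta>) (sr_component n \<Delta>)"
  have ev: "\<forall>\<^sub>F j in sequentially. of_nat (?H j) = poly ?p (of_nat j)"
    unfolding eventually_sequentially
  proof (intro exI[of _ "Suc n"] allI impI)
    fix j assume "Suc n \<le> j"
    then show "of_nat (?H j) = poly ?p (of_nat j)"
      by (simp add: hilbert_function_stanley_reisner poly_sum poly_shifted_binomial_poly)
  qed
  show ?thesis
    unfolding hilbert_polynomial_def
  proof (rule the_equality)
    show "\<forall>\<^sub>F j in sequentially. of_nat (?H j) = poly ?p (of_nat j)" by (rule ev)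
    fix q :: "rat poly" assume q: "\<forall>\<^sub>F j in sequentially. of_nat (?H j) = poly q (of_nat j)"
    show "q = ?p"
      by (rule poly_eqI_eventually) (use ev q in eventually_elim, simp)
  qed
qed

text \<open>The summand of a face has degree \<open>card F - 1\<close>, so only faces of size
  \<open>d\<close> reach the coefficient of index \<open>d - 1\<close>, each contributing 1 / (d -
  1)!.\<close>

theorem multiplicity_stanley_reisner:
  assumes d: "krull_dim (stanley_reisner_ring n \<Delta> :: 'k::field mpoly set ring) = enat d" "0 < d"
  shows "multiplicity_graded (stanley_reisner_ring n \<Delta> :: 'k mpoly set ring) (sr_scalars n \<Delta>) (sr_component n \<Delta>)
    = of_nat (card {F \<in> \<Delta>. card F = d})"
proof -
  note le = krull_dim_eqD(1)[OF sc d(1)]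
  have "Polynomial.coeff (shifted_binomial_poly (card F - 1)) (d - 1) =
      (if card F = d then 1 / fact (d - 1) else 0)" if F: "F \<in> \<Delta> - {{}}" for F
  proof (cases "card F = d")
    case True
    then show ?thesis by (simp add: shifted_binomial_poly_degree)
  next
    case False
    have "0 < card F" using F finite_simplicial_complex(2) by (auto simp: card_gt_0_iff)
    then have "card F - 1 < d - 1" using False le[of F] F by auto
    then show ?thesis using False by (simp add: coeff_eq_0 shifted_binomial_poly_degree)
  qed
  then have "Polynomial.coeff (\<Sum>F\<in>\<Delta> - {{}}. shifted_binomial_poly (card F - 1)) (d - 1) =
      (\<Sum>F\<in>\<Delta> - {{}}. if card F = d then 1 / fact (d - 1) else 0)"
    unfolding coeff_sum by (intro sum.cong) auto
  also have "\<dots> = of_nat (card {F \<in> \<Delta>. card F = d}) / fact (d - 1)"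
  proof -
    have "{F \<in> \<Delta> - {{}}. card F = d} = {F \<in> \<Delta>. card F = d}" using d(2) by auto
    moreover have "(\<Sum>F\<in>\<Delta> - {{}}. if card F = d then 1 / fact (d - 1) else 0) =
        (\<Sum>F\<in>{F \<in> \<Delta> - {{}}. card F = d}. 1 / fact (d - 1) :: rat)"
      using finite_simplicial_complex(1) by (intro sum.inter_filter[symmetric]) auto
    ultimately show ?thesis by simp
  qed
  finally show ?thesis
    unfolding multiplicity_graded_def hilbert_polynomial_stanley_reisner d(1) using d(2) by simp
qed

end

section \<open>Cohen--Macaulayness from large multiplicity\<close>

lemma few_missing_facets:
  assumes sc: "simplicial_complex n \<Delta>" and d: "0 < d" "d \<le> n"
    and dim: "\<And>F. F \<in> \<Delta> \<Longrightarrow> card F \<le> d"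
    and missing: "card {G. G \<subseteq> {1..n} \<and> card G = d \<and> G \<notin> \<Delta>} \<le> n - d"
  shows "\<Delta> = punctured_skeleton {} {1..n} d {G. G \<subseteq> {1..n} \<and> card G = d \<and> G \<notin> \<Delta>}"
proof (intro equalityI subsetI)
  let ?M = "{G. G \<subseteq> {1..n} \<and> card G = d \<and> G \<notin> \<Delta>}"
  fix F assume "F \<in> \<Delta>"
  moreover from this have "F \<subseteq> {1..n}" using sc by (auto simp: simplicial_complex_def)
  moreover from this have "F \<inter> {1..n} = F" by blast
  ultimately show "F \<in> punctured_skeleton {} {1..n} d ?M"
    unfolding punctured_skeleton_def using dim by auto
next
  let ?M = "{G. G \<subseteq> {1..n} \<and> card G = d \<and> G \<notin> \<Delta>}"
  have finM: "finite ?M" by (rule finite_subset[of _ "Pow {1..n}"]) auto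
  have ridge: "G \<in> \<Delta>" if G: "G \<subseteq> {1..n}" "card G = d - 1" for G
  proof -
    have finG: "finite G" using G(1) finite_subset by blast
    have "card ((\<lambda>v. insert v G) ` ({1..n} - G)) = n - (d - 1)"
      using G finG by (subst card_image) (auto simp: inj_on_def card_Diff_subset)
    moreover have "card ((\<lambda>v. insert v G) ` ({1..n} - G)) \<le> card ?M"
      if "(\<lambda>v. insert v G) ` ({1..n} - G) \<subseteq> ?M"
      using that by (rule card_mono[OF finM])
    ultimately have "\<not> (\<lambda>v. insert v G) ` ({1..n} - G) \<subseteq> ?M"
      using missing d by linarith
    then obtain v where "v \<in> {1..n} - G" "insert v G \<notin> ?M" by blast
    moreover from this have "card (insert v G) = d" "insert v G \<subseteq> {1..n}" using G finG d by auto
    ultimately have "insert v G \<in> \<Delta>" by auto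
    then show ?thesis using sc unfolding simplicial_complex_def by blast
  qed
  fix F assume "F \<in> punctured_skeleton {} {1..n} d ?M"
  then have F: "F \<subseteq> {1..n}" "card (F \<inter> {1..n}) \<le> d" "F \<inter> {1..n} \<notin> ?M"
    by (auto simp: punctured_skeleton_def)
  then have F': "F \<inter> {1..n} = F" by blast
  show "F \<in> \<Delta>"
  proof (cases "card F = d")
    case True
    then show ?thesis using F F' by auto
  next
    case False
    \<comment> \<open>A set with fewer than \<open>d\<close> elements extends to one of size
      \<open>d - 1\<close>, which is a face by \<open>ridge\<close>.\<close>
    then have "card F \<le> d - 1" "d - 1 \<le> card {1..n}" using F(2) F' d by auto
    then obtain G where "F \<subseteq> G" "G \<subseteq> {1..n}" "card G = d - 1"
      using exists_subset_between[of F "d - 1" "{1..n}"] F(1) by auto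
    then show ?thesis using ridge sc unfolding simplicial_complex_def by blast
  qed
qed

theorem theorem2p1:
  fixes n d c :: nat and \<Delta> :: "nat set set" and A :: "'k::field mpoly set ring"
  assumes "simplicial_complex n \<Delta>"
    and "A = stanley_reisner_ring n \<Delta>"
    and "krull_dim A = enat d" and "d \<ge> 2"
    and "c = n - d"
    and "multiplicity_graded A (sr_scalars n \<Delta>) (sr_component n \<Delta>)
           \<ge> of_nat (n choose c) - of_nat c"
  shows "cohen_macaulay A"
proof -
  note sc = assms(1)
  have dimA: "krull_dim (stanley_reisner_ring n \<Delta> :: 'k mpoly set ring) = enat d"
    using assms(2,3) by simp
  \<comment> \<open>The empty family passes \<open>simplicial_complex\<close> when n = 0; the
    dimension excludes it.\<close>
  have ne: "\<Delta> \<noteq> {}"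
  proof
    assume "\<Delta> = {}"
    then have "krull_dim (stanley_reisner_ring n \<Delta> :: 'k mpoly set ring) \<le> enat 0"
      by (intro krull_dim_le sc) auto
    then show False using dimA assms(4) by simp
  qed
  let ?M = "{G. G \<subseteq> {1..n} \<and> card G = d \<and> G \<notin> \<Delta>}"
  obtain F where "F \<in> \<Delta>" "card F = d" using krull_dim_eqD(2)[OF sc dimA ne] by blast
  then have dn: "d \<le> n" using finite_simplicial_complex(2)[OF sc ne] by auto
  \<comment> \<open>The \<open>d\<close>-subsets split into the missing ones and the facets counted
    by the multiplicity, which turns the hypothesis into \<open>card ?M \<le> c\<close>.\<close>
  have "{G. G \<subseteq> {1..n} \<and> card G = d} = ?M \<union> {F \<in> \<Delta>. card F = d}"
    using sc by (auto simp: simplicial_complex_def)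
  moreover have "card {G. G \<subseteq> {1..n} \<and> card G = d} = n choose d" by (simp add: n_subsets)
  moreover have "card (?M \<union> {F \<in> \<Delta>. card F = d}) = card ?M + card {F \<in> \<Delta>. card F = d}"
    using finite_simplicial_complex(1)[OF sc ne] by (intro card_Un_disjoint) auto
  ultimately have "n choose d = card ?M + card {F \<in> \<Delta>. card F = d}" by simp
  moreover have "n choose c = n choose d" using binomial_symmetric[OF dn] assms(5) by simp
  moreover have "of_nat (n choose c) - of_nat c \<le> (of_nat (card {F \<in> \<Delta>. card F = d}) :: rat)"
    using assms(6) multiplicity_stanley_reisner[OF sc ne dimA] assms(2,4) by simp
  ultimately have "of_nat (card ?M) \<le> (of_nat c :: rat)" by simp
  then have M: "card ?M \<le> n - d" unfolding assms(5) of_nat_le_iff .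
  have "vertex_decomposable d (punctured_skeleton {} {1..n} d ?M)"
    by (rule vertex_decomposable_punctured_skeleton) (use M dn assms(4) in auto)
  moreover have "\<Delta> = punctured_skeleton {} {1..n} d ?M"
    by (rule few_missing_facets[OF sc _ dn krull_dim_eqD(1)[OF sc dimA] M]) (use assms(4) in auto)
  ultimately have "vertex_decomposable d \<Delta>" by simp
  then show ?thesis
    unfolding assms(2) by (rule cohen_macaulay_vertex_decomposable[OF sc]) (simp add: dimA)
qed

end
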